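(* Let $X$ be a finite $T_0$-space and let $x\in X$ be a $\gamma$-point. Then the inclusion $i: X\smallsetminus\{x\}\hookrightarrow X$ is a weak homotopy equivalence.
   Context: Finite $T_0$-spaces are identified with finite posets: for a finite $T_0$-space $X$ and $x\in X$, $U_x$ denotes the intersection of all open sets containing $x$, and $x\le y$ if and only if $x\in U_y$. Thus $U_x=\{y\in X: y\le x\}$, the open sets are the down-sets, and $F_x=\{y\in X: y\ge x\}$ is the closure of $\{x\}$. Subsets carry the subspace topology (the induced order). The star of $x$ is $C_x=U_x\cup F_x$, the set of points comparable with $x$, and the link of $x$ is $\hat{C}_x=C_x\smallsetminus\{x\}$. A space is homotopically trivial if all its homotopy groups are trivial (in particular it is non-empty and path-connected). A point $x\in X$ is a $\gamma$-point if its link $\hat{C}_x$ is homotopically trivial. A weak homotopy equivalence is a continuous map inducing isomorphisms in all homotopy groups (a bijection on path components and isomorphisms on all homotopy groups at every base point). *)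

theory Defs
  imports "HOL-Analysis.Analysis" "HOL-Algebra.Group"
begin

section \<open>Finite T0-spaces as posets\<close>

definition min_open :: "'a topology \<Rightarrow> 'a \<Rightarrow> 'a set" where
  "min_open X x = \<Inter>{U. openin X U \<and> x \<in> U}"

definition spec_le :: "'a topology \<Rightarrow> 'a \<Rightarrow> 'a \<Rightarrow> bool" where
  "spec_le X x y \<longleftrightarrow> x \<in> min_open X y"

definition up_set :: "'a topology \<Rightarrow> 'a \<Rightarrow> 'a set" where
  "up_set X x = {y \<in> topspace X. spec_le X x y}"

definition star :: "'a topology \<Rightarrow> 'a \<Rightarrow> 'a set" where
  "star X x = min_open X x \<union> up_set X x"

definition link :: "'a topology \<Rightarrow> 'a \<Rightarrow> 'a set" where
  "link X x = star X x - {x}"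


section \<open>Homotopy groups\<close>

text \<open>
  The points of the n-cube are the functions in \<^term>\<open>PiE {..<n} (\<lambda>_. {0..1::real})\<close>.
\<close>

definition cube :: "nat \<Rightarrow> (nat \<Rightarrow> real) topology" where
  "cube n = product_topology (\<lambda>_. top_of_set {0..1}) {..<n}"

definition cube_boundary :: "nat \<Rightarrow> (nat \<Rightarrow> real) set" where
  "cube_boundary n = {t \<in> topspace (cube n). \<exists>i<n. t i = 0 \<or> t i = 1}"

definition based_maps :: "nat \<Rightarrow> 'a topology \<Rightarrow> 'a \<Rightarrow> ((nat \<Rightarrow> real) \<Rightarrow> 'a) set" where
  "based_maps n X a = {f. continuous_map (cube n) X f \<and> f ` cube_boundary n \<subseteq> {a}}"

text \<open>
  Homotopy relative to the boundary of the cube. Values of a map outside the cube are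
  irrelevant: maps that agree on the cube are homotopic.
\<close>

definition based_homotopy ::
    "nat \<Rightarrow> 'a topology \<Rightarrow> 'a \<Rightarrow> (((nat \<Rightarrow> real) \<Rightarrow> 'a) \<times> ((nat \<Rightarrow> real) \<Rightarrow> 'a)) set" where
  "based_homotopy n X a =
    {(f, g). homotopic_with (\<lambda>h. h ` cube_boundary n \<subseteq> {a}) (cube n) X f g}"

definition cube_concat ::
    "((nat \<Rightarrow> real) \<Rightarrow> 'a) \<Rightarrow> ((nat \<Rightarrow> real) \<Rightarrow> 'a) \<Rightarrow> (nat \<Rightarrow> real) \<Rightarrow> 'a" where
  "cube_concat f g = (\<lambda>t. if t 0 \<le> 1/2 then f (t(0 := 2 * t 0)) else g (t(0 := 2 * t 0 - 1)))"

text \<open>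
  The n-th homotopy group at the base point \<open>a\<close>, meaningful as a group for \<open>n \<ge> 1\<close>.
  Concatenation respects homotopy, so the union defining the product is the union of a
  single homotopy class; the same holds for the induced map below.
\<close>

definition homotopy_group :: "nat \<Rightarrow> 'a topology \<Rightarrow> 'a \<Rightarrow> ((nat \<Rightarrow> real) \<Rightarrow> 'a) set monoid" where
  "homotopy_group n X a =
    \<lparr> carrier = based_maps n X a // based_homotopy n X a,
      monoid.mult = (\<lambda>A B. \<Union>f\<in>A. \<Union>g\<in>B. based_homotopy n X a `` {cube_concat f g}),
      one = based_homotopy n X a `` {\<lambda>_. a} \<rparr>"

definition homotopy_group_map ::
    "nat \<Rightarrow> 'b topology \<Rightarrow> ('a \<Rightarrow> 'b) \<Rightarrow> 'a
      \<Rightarrow> ((nat \<Rightarrow> real) \<Rightarrow> 'a) set \<Rightarrow> ((nat \<Rightarrow> real) \<Rightarrow> 'b) set" where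
  "homotopy_group_map n Y f a A = (\<Union>p\<in>A. based_homotopy n Y (f a) `` {f \<circ> p})"

definition path_component_map :: "'b topology \<Rightarrow> ('a \<Rightarrow> 'b) \<Rightarrow> 'a set \<Rightarrow> 'b set" where
  "path_component_map Y f C = (\<Union>a\<in>C. path_component_of_set Y (f a))"

definition homotopically_trivial :: "'a topology \<Rightarrow> bool" where
  "homotopically_trivial X \<longleftrightarrow>
    topspace X \<noteq> {} \<and> path_connected_space X \<and>
    (\<forall>n\<ge>1. \<forall>a\<in>topspace X. carrier (homotopy_group n X a) = {\<one>\<^bsub>homotopy_group n X a\<^esub>})"

definition weak_homotopy_equivalence :: "'a topology \<Rightarrow> 'b topology \<Rightarrow> ('a \<Rightarrow> 'b) \<Rightarrow> bool" where
  "weak_homotopy_equivalence X Y f \<longleftrightarrow>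
    continuous_map X Y f \<and>
    bij_betw (path_component_map Y f) (path_components_of X) (path_components_of Y) \<and>
    (\<forall>n\<ge>1. \<forall>a\<in>topspace X.
      homotopy_group_map n Y f a \<in> iso (homotopy_group n X a) (homotopy_group n Y (f a)))"

definition gamma_point :: "'a topology \<Rightarrow> 'a \<Rightarrow> bool" where
  "gamma_point X x \<longleftrightarrow>
    x \<in> topspace X \<and> homotopically_trivial (subtopology X (link X x))"

end

theory Submission
  imports Defs
begin

text \<open>
  Let \<open>K X\<close> be the poset of nonempty chains of \<open>X\<close>, the barycentric subdivision. Taking the
  maximum of a chain gives a map \<open>K X \<rightarrow> X\<close> with contractible preimages of the minimal open sets,
  so it is a weak equivalence. In \<open>X\<close> itself the star of \<open>x\<close> need not be open, but in \<open>K X\<close> the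
  chains avoiding \<open>x\<close> and the chains in the star of \<open>x\<close> form an open cover; the second set is
  contractible and the intersection of both is \<open>K\<close> of the link, which is weakly contractible.
  Hence \<open>K (X - {x}) \<rightarrow> K X\<close> is a weak equivalence, and the theorem follows by the two-out-of-three
  property of the square formed with the maximum maps.

  Weak equivalences are handled through a relative lifting property for maps on boxes and their
  rims. It passes from the members of a finite intersection-closed open cover to the whole space:
  a map on a box is cut into small boxes that are each mapped into one member of the cover.
\<close>

text \<open>A map into \<open>X\<close> need not lift strictly through the maximum map, and
  homotopies chosen over adjacent pieces must agree where the pieces meet. The lifting property
  therefore carries a prescribed homotopy on the rim and demands that the new one extend it. Boxes
  are kept inside the single space of real sequences, with finitely many non-degenerate sides, so
  that a cylinder over a box is again a box (a spare coordinate stores the time) and faces and walls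
  need no change of type. The same format expresses weak contractibility: every map on a rim extends
  over the box. Lifting over a member of the cover follows once that member and its preimage are
  weakly contractible, and in finite spaces this comes from comparing maps pointwise in the order.
  In the final square the singletons \<open>{y}\<close> lift every base point \<open>y\<close> of
  \<open>X - {x}\<close>, with maximum \<open>y\<close> itself, so no change of base point ever
  occurs.\<close>

section \<open>Continuous maps on subsets: restriction, composition, pasting\<close>

abbreviation cont_into :: "'d::topological_space set \<Rightarrow> 'e topology \<Rightarrow> ('d \<Rightarrow> 'e) \<Rightarrow> bool" where
  "cont_into S E g \<equiv> continuous_map (top_of_set S) E g"

lemma cont_into_compose:
  assumes "cont_into T E g" "continuous_on S \<phi>" "\<phi> ` S \<subseteq> T"
  shows "cont_into S E (\<lambda>x. g (\<phi> x))"
proof -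
  have "continuous_map (top_of_set S) (top_of_set T) \<phi>"
    using assms by auto
  from continuous_map_compose[OF this assms(1)] show ?thesis by (simp add: o_def)
qed

lemma cont_into_subset:
  assumes "cont_into T E g" "S \<subseteq> T"
  shows "cont_into S E g"
  using continuous_map_from_subtopology_mono[OF assms] .

lemma cont_into_eq:
  assumes "cont_into S E f" "\<And>x. x \<in> S \<Longrightarrow> f x = g x"
  shows "cont_into S E g"
  by (rule continuous_map_eq[OF assms(1)]) (use assms(2) in simp)

lemma cont_into_paste:
  assumes "closed S" "closed T" "cont_into S E f" "cont_into T E g"
    and agree: "\<And>x. x \<in> S \<Longrightarrow> x \<in> T \<Longrightarrow> f x = g x"
  shows "cont_into (S \<union> T) E (\<lambda>x. if x \<in> S then f x else g x)"
proof (rule pasting_lemma_closed[where I = "UNIV :: bool set"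
      and T = "\<lambda>b. if b then S else T" and f = "\<lambda>b. if b then f else g"])
  have "closedin (top_of_set (S \<union> T)) S" "closedin (top_of_set (S \<union> T)) T"
    using assms(1,2) by (auto intro: closed_subset)
  then show "closedin (top_of_set (S \<union> T)) (if b then S else T)" for b by simp
  have "(S \<union> T) \<inter> S = S" "(S \<union> T) \<inter> T = T" by auto
  then show "continuous_map (subtopology (top_of_set (S \<union> T)) (if b then S else T)) E (if b then f else g)" for b
    using assms(3,4) by (simp add: subtopology_subtopology)
  show "(if i then f else g) x = (if j then f else g) x"
    if "x \<in> topspace (top_of_set (S \<union> T)) \<inter> (if i then S else T) \<inter> (if j then S else T)" for i j x
    using that agree by (auto split: if_splits)
  show "\<exists>j. j \<in> UNIV \<and> x \<in> (if j then S else T) \<and> (if x \<in> S then f x else g x) = (if j then f else g) x"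
    if "x \<in> topspace (top_of_set (S \<union> T))" for x
    using that by (cases "x \<in> S") (auto intro: exI[of _ True] exI[of _ False])
qed auto

lemma cont_into_homotopy_slice:
  assumes "cont_into ({0..1::real} \<times> S) E h" "\<tau> \<in> {0..1}"
  shows "cont_into S E (\<lambda>t. h (\<tau>, t))"
  by (rule cont_into_compose[OF assms(1)]) (use assms(2) in \<open>auto intro!: continuous_intros\<close>)

lemma continuous_on_coord [continuous_intros]: "continuous_on S (\<lambda>t :: nat \<Rightarrow> real. t i)"
  by (rule continuous_on_product_then_coordinatewise) (rule continuous_on_id)

lemma continuous_on_snd_coord [continuous_intros]:
  "continuous_on S (\<lambda>x :: 'd::topological_space \<times> (nat \<Rightarrow> real). snd x i)"
  by (rule continuous_on_product_then_coordinatewise) (intro continuous_intros)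

lemma continuous_on_fun_upd:
  fixes g :: "'d::topological_space \<Rightarrow> nat \<Rightarrow> real"
  assumes "continuous_on S g" "continuous_on S h"
  shows "continuous_on S (\<lambda>x. (g x)(k := h x))"
proof (rule continuous_on_coordinatewise_then_product)
  fix i
  show "continuous_on S (\<lambda>x. ((g x)(k := h x)) i)"
    by (cases "i = k") (simp_all add: assms continuous_on_product_then_coordinatewise)
qed

section \<open>Boxes\<close>

text \<open>
  A box is a subset of the space of all real sequences; its dimension is the number of coordinates
  with \<open>a i < b i\<close>, and the rim is its boundary relative to these coordinates, empty for a point.
\<close>

definition cell :: "(nat \<Rightarrow> real) \<Rightarrow> (nat \<Rightarrow> real) \<Rightarrow> (nat \<Rightarrow> real) set" where
  "cell a b = {t. \<forall>i. a i \<le> t i \<and> t i \<le> b i}"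

definition rim :: "(nat \<Rightarrow> real) \<Rightarrow> (nat \<Rightarrow> real) \<Rightarrow> (nat \<Rightarrow> real) set" where
  "rim a b = {t \<in> cell a b. \<exists>i. a i < b i \<and> (t i = a i \<or> t i = b i)}"

definition is_cell :: "(nat \<Rightarrow> real) \<Rightarrow> (nat \<Rightarrow> real) \<Rightarrow> bool" where
  "is_cell a b \<longleftrightarrow> (\<forall>i. a i \<le> b i) \<and> finite {i. a i < b i}"

lemma rim_subset_cell: "rim a b \<subseteq> cell a b"
  by (auto simp: rim_def)

text \<open>The maximum norm after each non-degenerate side is rescaled to [-1, 1] about its
  midpoint; in these coordinates the box is the unit ball. The inserted 0 gives a point box the norm
  0.\<close>

definition centred_norm :: "(nat \<Rightarrow> real) \<Rightarrow> (nat \<Rightarrow> real) \<Rightarrow> (nat \<Rightarrow> real) \<Rightarrow> real" where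
  "centred_norm a b t = Max (insert 0 ((\<lambda>i. \<bar>2 * t i - a i - b i\<bar> / (b i - a i)) ` {i. a i < b i}))"

lemma continuous_on_Max_finite:
  fixes f :: "'i \<Rightarrow> 'd::topological_space \<Rightarrow> real"
  assumes "finite I" "\<And>i. i \<in> I \<Longrightarrow> continuous_on S (f i)"
  shows "continuous_on S (\<lambda>t. Max (insert 0 ((\<lambda>i. f i t) ` I)))"
  using assms
proof (induction I)
  case empty
  then show ?case by simp
next
  case (insert j I)
  have "Max (insert 0 ((\<lambda>i. f i t) ` insert j I)) = max (f j t) (Max (insert 0 ((\<lambda>i. f i t) ` I)))" for t
    by (simp only: image_insert insert_commute[of 0], subst Max_insert) (use insert(1) in auto)
  then show ?case
    using insert by (auto intro!: continuous_intros)
qed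

lemma continuous_on_centred_norm:
  assumes "is_cell a b"
  shows "continuous_on S (centred_norm a b)"
proof -
  have "continuous_on S (\<lambda>t. Max (insert 0 ((\<lambda>i. \<bar>2 * t i - a i - b i\<bar> / (b i - a i)) ` {i. a i < b i})))"
    by (rule continuous_on_Max_finite)
       (use assms in \<open>auto simp: is_cell_def intro!: continuous_intros\<close>)
  then show ?thesis
    by (simp add: centred_norm_def[abs_def])
qed

lemma centred_norm_le_iff:
  assumes "is_cell a b" "c \<ge> 0"
  shows "centred_norm a b t \<le> c \<longleftrightarrow> (\<forall>i. a i < b i \<longrightarrow> \<bar>2 * t i - a i - b i\<bar> \<le> c * (b i - a i))"
  using assms by (auto simp: centred_norm_def is_cell_def divide_le_eq)

lemma centred_norm_nonneg: "is_cell a b \<Longrightarrow> 0 \<le> centred_norm a b t"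
  by (simp add: centred_norm_def is_cell_def)

lemma centred_norm_le_1: "is_cell a b \<Longrightarrow> t \<in> cell a b \<Longrightarrow> centred_norm a b t \<le> 1"
  by (subst centred_norm_le_iff) (auto simp: cell_def abs_le_iff algebra_simps, smt+)

lemma cell_iff_centred_norm:
  assumes "is_cell a b"
  shows "t \<in> cell a b \<longleftrightarrow> (\<forall>i. \<not> a i < b i \<longrightarrow> t i = a i) \<and> centred_norm a b t \<le> 1"
proof -
  have "\<And>i. a i \<le> b i" using assms by (simp add: is_cell_def)
  then have "t \<in> cell a b \<longleftrightarrow> (\<forall>i. \<not> a i < b i \<longrightarrow> t i = a i) \<and> (\<forall>i. a i < b i \<longrightarrow> \<bar>2 * t i - a i - b i\<bar> \<le> 1 * (b i - a i))"
    unfolding cell_def mem_Collect_eq all_conj_distrib[symmetric]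
    by (intro all_cong1) (smt (verit, del_insts))
  then show ?thesis by (subst centred_norm_le_iff[OF assms]) auto
qed

text \<open>On the box all entries of the maximum are at most 1, so norm 1 means that some entry
  equals 1, that is, a non-degenerate coordinate sits at an end of its side. For a point box the
  norm is 0 and the rim is empty.\<close>

lemma rim_iff_centred_norm:
  assumes "is_cell a b"
  shows "t \<in> rim a b \<longleftrightarrow> t \<in> cell a b \<and> centred_norm a b t = 1"
proof (cases "t \<in> cell a b")
  case True
  let ?A = "insert 0 ((\<lambda>i. \<bar>2 * t i - a i - b i\<bar> / (b i - a i)) ` {i. a i < b i})"
  have fin: "finite ?A" using assms by (simp add: is_cell_def)
  have le: "\<forall>x\<in>?A. x \<le> 1"
    using centred_norm_le_1[OF assms True] fin by (auto simp: centred_norm_def)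
  have "centred_norm a b t = 1 \<longleftrightarrow> 1 \<in> ?A"
  proof
    assume "centred_norm a b t = 1"
    then have "Max ?A = 1" by (simp only: centred_norm_def)
    then show "1 \<in> ?A" using Max_in[OF fin] by (metis insert_not_empty)
  next
    assume "1 \<in> ?A"
    then show "centred_norm a b t = 1"
      unfolding centred_norm_def using le fin by (intro Max_eqI) auto
  qed
  also have "\<dots> \<longleftrightarrow> (\<exists>i. a i < b i \<and> \<bar>2 * t i - a i - b i\<bar> = b i - a i)"
    by (auto simp: image_iff eq_divide_eq)
  also have "\<dots> \<longleftrightarrow> t \<in> rim a b"
    using True unfolding rim_def cell_def mem_Collect_eq
    by (smt (verit, del_insts))
  finally show ?thesis using True by simp
qed (auto simp: rim_def)

lemma closed_cell: "closed (cell a b)"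
proof -
  have "cell a b = (\<Inter>i. {t. a i \<le> t i} \<inter> {t. t i \<le> b i})"
    by (auto simp: cell_def)
  moreover have "closed {t::nat\<Rightarrow>real. a i \<le> t i}" "closed {t::nat\<Rightarrow>real. t i \<le> b i}" for i
    by (intro closed_Collect_le continuous_intros; simp)+
  ultimately show ?thesis by (simp add: closed_Int closed_INT)
qed

text \<open>The rim is a level set of the norm inside the box; finiteness of the set of
  non-degenerate sides enters through continuity of the norm.\<close>

lemma closed_rim:
  assumes "is_cell a b"
  shows "closed (rim a b)"
proof -
  have "rim a b = cell a b \<inter> {t. centred_norm a b t = 1}"
    using rim_iff_centred_norm[OF assms] by auto
  moreover have "closed {t. centred_norm a b t = 1}"
    by (intro closed_Collect_eq continuous_on_centred_norm[OF assms] continuous_intros)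
  ultimately show ?thesis using closed_cell by auto
qed

text \<open>
  The radial projection of the cylinder \<open>[0,1] \<times> cell\<close> from the point at height 2 above the
  centre of the box onto bottom and sides.
\<close>

definition cyl_retract :: "(nat \<Rightarrow> real) \<Rightarrow> (nat \<Rightarrow> real) \<Rightarrow> real \<times> (nat \<Rightarrow> real) \<Rightarrow> real \<times> (nat \<Rightarrow> real)" where
  "cyl_retract a b = (\<lambda>(\<tau>, t). let l = 1 / max (centred_norm a b t) (1 - \<tau> / 2) in
     (2 - l * (2 - \<tau>), \<lambda>i. (a i + b i) / 2 + l * (t i - (a i + b i) / 2)))"

lemma continuous_on_cyl_retract:
  assumes "is_cell a b"
  shows "continuous_on ({0..1} \<times> S) (cyl_retract a b)"
proof -
  have "continuous_on ({0..1} \<times> S) (\<lambda>x. centred_norm a b (snd x))"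
    using continuous_on_compose2[OF continuous_on_centred_norm[OF assms, of UNIV] continuous_on_snd[OF continuous_on_id]]
    by simp
  then show ?thesis
    unfolding cyl_retract_def case_prod_beta Let_def
    by (intro continuous_intros continuous_on_coordinatewise_then_product) auto
qed

lemma centred_norm_scale:
  assumes "is_cell a b" "l \<ge> 0"
  shows "centred_norm a b (\<lambda>i. (a i + b i) / 2 + l * (t i - (a i + b i) / 2)) = l * centred_norm a b t"
proof -
  let ?I = "{i. a i < b i}" and ?x = "\<lambda>i. \<bar>2 * t i - a i - b i\<bar> / (b i - a i)"
  have "\<bar>2 * ((a i + b i) / 2 + l * (t i - (a i + b i) / 2)) - a i - b i\<bar> = l * \<bar>2 * t i - a i - b i\<bar>" for i
  proof -
    have "2 * ((a i + b i) / 2 + l * (t i - (a i + b i) / 2)) - a i - b i = l * (2 * t i - a i - b i)"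
      by (simp add: field_simps)
    then show ?thesis using assms(2) by (simp add: abs_mult)
  qed
  then have "insert 0 ((\<lambda>i. \<bar>2 * ((a i + b i) / 2 + l * (t i - (a i + b i) / 2)) - a i - b i\<bar> / (b i - a i)) ` ?I)
    = (\<lambda>x. l * x) ` insert 0 (?x ` ?I)"
    by (simp add: image_image)
  moreover have "Max ((\<lambda>x. l * x) ` insert 0 (?x ` ?I)) = l * Max (insert 0 (?x ` ?I))"
    by (rule mono_Max_commute[symmetric])
       (use assms in \<open>auto simp: mono_def is_cell_def intro: mult_left_mono\<close>)
  ultimately show ?thesis by (simp add: centred_norm_def)
qed

text \<open>The factor \<open>l\<close> stretches the ray from the centre of projection until it
  meets a side or the floor. If \<open>M = N\<close>, the stretched point has norm 1 and lies on a
  side, at a height in [0, 1] because \<open>M\<close> is between \<open>1 - \<tau>/2\<close> and 1.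
  If \<open>M = 1 - \<tau>/2\<close>, the height has become 0 while the norm is still at most
  1.\<close>

lemma cyl_retract_mem:
  assumes c: "is_cell a b" and "t \<in> cell a b" "\<tau> \<in> {0..1}"
  shows "cyl_retract a b (\<tau>, t) \<in> {0} \<times> cell a b \<union> {0..1} \<times> rim a b"
proof -
  define N where "N = centred_norm a b t"
  define M where "M = max N (1 - \<tau> / 2)"
  define l where "l = 1 / M"
  have N: "0 \<le> N" "N \<le> 1" using assms by (auto simp: N_def centred_norm_nonneg centred_norm_le_1)
  have M: "M > 0" "M \<ge> N" "M \<ge> 1 - \<tau>/2" "M \<le> 1" "M = N \<or> M = 1 - \<tau>/2" using assms(3) N by (auto simp: M_def max_def)
  let ?t = "\<lambda>i. (a i + b i) / 2 + l * (t i - (a i + b i) / 2)"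
  have eq: "cyl_retract a b (\<tau>, t) = (2 - l * (2 - \<tau>), ?t)"
    by (simp add: cyl_retract_def Let_def l_def M_def N_def)
  have n: "centred_norm a b ?t = l * N"
    using centred_norm_scale[OF c, of l t] M by (simp add: l_def N_def)
  have nonact: "t i = a i" "b i = a i" if "\<not> a i < b i" for i
    using assms(1,2) that unfolding cell_def is_cell_def mem_Collect_eq by (smt (verit, best))+
  have "?t i = a i" if "\<not> a i < b i" for i
    by (simp only: nonact[OF that]) simp
  then have cell: "?t \<in> cell a b"
    unfolding cell_iff_centred_norm[OF c] n using M N by (auto simp: l_def divide_le_eq)
  from M(5) show ?thesis
  proof
    assume "M = N"
    then have "?t \<in> rim a b"
      unfolding rim_iff_centred_norm[OF c] n using cell M by (simp add: l_def)
    moreover have "2 - l * (2 - \<tau>) \<in> {0..1}"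
    proof -
      have "2 - \<tau> \<le> 2 * M" "M \<le> 2 - \<tau>" using M assms(3) by auto
      then show ?thesis using M(1) by (simp add: l_def field_simps)
    qed
    ultimately show ?thesis by (simp add: eq)
  next
    assume "M = 1 - \<tau>/2"
    then have "2 - l * (2 - \<tau>) = 0" using M(1) by (simp add: l_def field_simps)
    then show ?thesis using cell by (simp add: eq)
  qed
qed

text \<open>On the floor \<open>1 - \<tau> / 2\<close> is 1, on the sides the norm is 1, and neither
  exceeds 1; so the stretching factor is 1.\<close>

lemma cyl_retract_id:
  assumes "is_cell a b" "\<tau> \<in> {0..1}" "t \<in> cell a b" "\<tau> = 0 \<or> t \<in> rim a b"
  shows "cyl_retract a b (\<tau>, t) = (\<tau>, t)"
proof -
  have "max (centred_norm a b t) (1 - \<tau> / 2) = 1"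
    using assms(2,4) centred_norm_le_1[OF assms(1,3)] rim_iff_centred_norm[OF assms(1), of t]
    by (elim disjE) (simp_all add: max_def)
  then show ?thesis by (simp add: cyl_retract_def)
qed

text \<open>\<open>u\<close> on the floor and \<open>h\<close> on the sides fit together by
  \<open>h0\<close>; composition with the radial retraction spreads them over the cylinder.\<close>

lemma homotopy_extension:
  fixes h :: "real \<times> (nat \<Rightarrow> real) \<Rightarrow> 'e"
  assumes c: "is_cell a b" and u: "cont_into (cell a b) B u"
    and h: "cont_into ({0..1} \<times> rim a b) B h" and h0: "\<And>t. t \<in> rim a b \<Longrightarrow> h (0, t) = u t"
  obtains h' where "cont_into ({0..1} \<times> cell a b) B h'" "\<And>t. t \<in> cell a b \<Longrightarrow> h' (0, t) = u t"
    "\<And>\<tau> t. \<tau> \<in> {0..1} \<Longrightarrow> t \<in> rim a b \<Longrightarrow> h' (\<tau>, t) = h (\<tau>, t)"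
proof -
  let ?S = "{0::real} \<times> cell a b" and ?T = "{0..1::real} \<times> rim a b"
  define w where "w = (\<lambda>x. if x \<in> ?S then u (snd x) else h x)"
  have "cont_into ?S B (\<lambda>x. u (snd x))"
    by (rule cont_into_compose[OF u]) (auto intro!: continuous_intros)
  then have w: "cont_into (?S \<union> ?T) B w"
    unfolding w_def
    by (intro cont_into_paste h) (auto simp: h0 closed_Times closed_cell closed_rim[OF c])
  let ?h = "\<lambda>x. w (cyl_retract a b x)"
  show ?thesis
  proof (rule that[of ?h])
    show "cont_into ({0..1} \<times> cell a b) B ?h"
      by (rule cont_into_compose[OF w continuous_on_cyl_retract[OF c]]) (use cyl_retract_mem[OF c] in blast)
    show "?h (0, t) = u t" if "t \<in> cell a b" for t
      using that cyl_retract_id[OF c, of 0 t] by (simp add: w_def)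
    show "?h (\<tau>, t) = h (\<tau>, t)" if "\<tau> \<in> {0..1}" "t \<in> rim a b" for \<tau> t
      using that rim_subset_cell[of a b] cyl_retract_id[OF c, of \<tau> t] h0 by (auto simp: w_def subset_iff)
  qed
qed

text \<open>The end slice of the extended homotopy. Hence whether a map on the rim extends over the
  box depends only on its homotopy class.\<close>

lemma change_rim_values:
  fixes h :: "real \<times> (nat \<Rightarrow> real) \<Rightarrow> 'e"
  assumes "is_cell a b" "cont_into (cell a b) B u"
    and "cont_into ({0..1} \<times> rim a b) B h" "\<And>t. t \<in> rim a b \<Longrightarrow> h (0, t) = u t"
  obtains u' where "cont_into (cell a b) B u'" "\<And>t. t \<in> rim a b \<Longrightarrow> u' t = h (1, t)"
proof -
  obtain h' where h': "cont_into ({0..1} \<times> cell a b) B h'" 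
    "\<And>\<tau> t. \<tau> \<in> {0..1} \<Longrightarrow> t \<in> rim a b \<Longrightarrow> h' (\<tau>, t) = h (\<tau>, t)"
    using homotopy_extension[OF assms] by metis
  show ?thesis
    by (rule that[of "\<lambda>t. h' (1, t)"]) (use h' cont_into_homotopy_slice[OF h'(1), of 1] in auto)
qed

section \<open>Extension and lifting over boxes\<close>

definition cyl_rim :: "(nat \<Rightarrow> real) \<Rightarrow> (nat \<Rightarrow> real) \<Rightarrow> (real \<times> (nat \<Rightarrow> real)) set" where
  "cyl_rim a b = {0, 1} \<times> cell a b \<union> {0..1} \<times> rim a b"

text \<open>Only finitely many sides are non-degenerate, so some coordinate \<open>k\<close> is
  constant on the box; the time is stored there. \<open>\<psi>\<close> reads the time off and
  restores the value \<open>a k\<close>.\<close>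

lemma cylinder_as_box:
  assumes c: "is_cell a b"
  obtains a' b' \<phi> \<psi> where "is_cell a' b'"
    "\<And>S. continuous_on S (\<phi> :: real \<times> (nat \<Rightarrow> real) \<Rightarrow> nat \<Rightarrow> real)" "\<And>S. continuous_on S \<psi>"
    "\<phi> ` ({0..1} \<times> cell a b) \<subseteq> cell a' b'" "\<psi> ` cell a' b' \<subseteq> {0..1} \<times> cell a b"
    "\<phi> ` cyl_rim a b \<subseteq> rim a' b'" "\<psi> ` rim a' b' \<subseteq> cyl_rim a b"
    "\<And>x. x \<in> {0..1} \<times> cell a b \<Longrightarrow> \<psi> (\<phi> x) = x"
proof -
  obtain k where "k \<notin> {i. a i < b i}"
    using c ex_new_if_finite[OF infinite_UNIV_nat] by (auto simp: is_cell_def)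
  then have k: "b k = a k" using c by (auto simp: is_cell_def intro: antisym)
  define a' b' where "a' = a(k := 0)" and "b' = b(k := 1)"
  let ?\<phi> = "\<lambda>x::real \<times> (nat \<Rightarrow> real). (snd x)(k := fst x)" and ?\<psi> = "\<lambda>t::nat \<Rightarrow> real. (t k, t(k := a k))"
  have "{i. a' i < b' i} \<subseteq> insert k {i. a i < b i}" by (auto simp: a'_def b'_def)
  then have "finite {i. a' i < b' i}" using c unfolding is_cell_def by (meson finite.insertI finite_subset)
  then have 1: "is_cell a' b'" using c by (auto simp: is_cell_def a'_def b'_def)
  have 2: "continuous_on S ?\<phi>" for S by (intro continuous_on_fun_upd continuous_intros)
  have 3: "continuous_on S ?\<psi>" for S by (intro continuous_on_fun_upd continuous_intros)
  have tk: "t k = a k" if "t \<in> cell a b" for t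
    using that k unfolding cell_def mem_Collect_eq by (metis antisym)
  have cell': "t \<in> cell a' b' \<longleftrightarrow> t k \<in> {0..1} \<and> t(k := a k) \<in> cell a b" for t
    using k by (auto simp: cell_def a'_def b'_def)
  have rim': "t \<in> rim a' b' \<longleftrightarrow> t \<in> cell a' b' \<and> (t k = 0 \<or> t k = 1 \<or> t(k := a k) \<in> rim a b)" for t
    unfolding rim_def cell' mem_Collect_eq using k by (auto simp: a'_def b'_def)
  have upd: "t(k := a k) = t" if "t \<in> cell a b" for t using tk[OF that] by auto
  show ?thesis
    by (rule that[OF 1 2 3])
       (use rim_subset_cell[of a b] in \<open>auto simp: cell' rim' upd cyl_rim_def subset_iff\<close>)
qed

lemma cyl_rim_subset: "cyl_rim a b \<subseteq> {0..1} \<times> cell a b"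
  using rim_subset_cell[of a b] by (auto simp: cyl_rim_def)

text \<open>Weak contractibility. For a point box the rim is empty and the condition says that
  \<open>E\<close> is non-empty; for an interval it is path-connectedness; in higher dimensions it
  is the vanishing of the homotopy groups.\<close>

definition fills :: "'e topology \<Rightarrow> bool" where
  "fills E \<longleftrightarrow> (\<forall>a b g. is_cell a b \<longrightarrow> cont_into (rim a b) E g \<longrightarrow>
     (\<exists>G. cont_into (cell a b) E G \<and> (\<forall>t\<in>rim a b. G t = g t)))"

lemma fillsD:
  assumes "fills E" "is_cell a b" "cont_into (rim a b) E g"
  obtains G where "cont_into (cell a b) E G" "\<And>t. t \<in> rim a b \<Longrightarrow> G t = g t"
  using assms(1)[unfolded fills_def, rule_format, OF assms(2,3)] that by blast

lemma fills_cylinder: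
  assumes E: "fills E" and c: "is_cell a b" and g: "cont_into (cyl_rim a b) E g"
  obtains G where "cont_into ({0..1} \<times> cell a b) E G" "\<And>x. x \<in> cyl_rim a b \<Longrightarrow> G x = g x"
proof -
  obtain a' b' \<phi> \<psi> where box: "is_cell a' b'"
    "\<And>S. continuous_on S (\<phi> :: real \<times> (nat \<Rightarrow> real) \<Rightarrow> nat \<Rightarrow> real)" "\<And>S. continuous_on S \<psi>"
    "\<phi> ` ({0..1} \<times> cell a b) \<subseteq> cell a' b'" "\<psi> ` cell a' b' \<subseteq> {0..1} \<times> cell a b"
    "\<phi> ` cyl_rim a b \<subseteq> rim a' b'" "\<psi> ` rim a' b' \<subseteq> cyl_rim a b"
    "\<And>x. x \<in> {0..1} \<times> cell a b \<Longrightarrow> \<psi> (\<phi> x) = x"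
    using cylinder_as_box[OF c] by metis
  have "cont_into (rim a' b') E (\<lambda>t. g (\<psi> t))"
    by (rule cont_into_compose[OF g box(3,7)])
  then obtain G where G: "cont_into (cell a' b') E G" "\<And>t. t \<in> rim a' b' \<Longrightarrow> G t = g (\<psi> t)"
    using fillsD[OF E box(1)] by blast
  show ?thesis
  proof (rule that[of "\<lambda>x. G (\<phi> x)"])
    show "cont_into ({0..1} \<times> cell a b) E (\<lambda>x. G (\<phi> x))"
      by (rule cont_into_compose[OF G(1) box(2,4)])
    show "G (\<phi> x) = g x" if "x \<in> cyl_rim a b" for x
    proof -
      have "x \<in> {0..1} \<times> cell a b" "\<phi> x \<in> rim a' b'" using that box(6) cyl_rim_subset by blast+
      then show ?thesis using G(2) box(8) by metis
    qed
  qed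
qed

text \<open>The cylinder is treated as a box with one more side. This allows boundary values to be
  deformed or reparametrised after the cylinder has been filled.\<close>

lemma change_cyl_rim_values:
  fixes h :: "real \<times> (real \<times> (nat \<Rightarrow> real)) \<Rightarrow> 'e"
  assumes c: "is_cell a b" and u: "cont_into ({0..1} \<times> cell a b) B u"
    and h: "cont_into ({0..1} \<times> cyl_rim a b) B h" "\<And>x. x \<in> cyl_rim a b \<Longrightarrow> h (0, x) = u x"
  obtains u' where "cont_into ({0..1} \<times> cell a b) B u'" "\<And>x. x \<in> cyl_rim a b \<Longrightarrow> u' x = h (1, x)"
proof -
  obtain a' b' \<phi> \<psi> where box: "is_cell a' b'"
    "\<And>S. continuous_on S (\<phi> :: real \<times> (nat \<Rightarrow> real) \<Rightarrow> nat \<Rightarrow> real)" "\<And>S. continuous_on S \<psi>"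
    "\<phi> ` ({0..1} \<times> cell a b) \<subseteq> cell a' b'" "\<psi> ` cell a' b' \<subseteq> {0..1} \<times> cell a b"
    "\<phi> ` cyl_rim a b \<subseteq> rim a' b'" "\<psi> ` rim a' b' \<subseteq> cyl_rim a b"
    "\<And>x. x \<in> {0..1} \<times> cell a b \<Longrightarrow> \<psi> (\<phi> x) = x"
    using cylinder_as_box[OF c] by metis
  have 1: "cont_into (cell a' b') B (\<lambda>t. u (\<psi> t))"
    by (rule cont_into_compose[OF u box(3,5)])
  have "continuous_on S (\<lambda>x :: real \<times> (nat \<Rightarrow> real). (fst x, \<psi> (snd x)))" for S
    using continuous_on_compose2[OF box(3)[of UNIV] continuous_on_snd[OF continuous_on_id]]
    by (auto intro!: continuous_intros)
  then have 2: "cont_into ({0..1} \<times> rim a' b') B (\<lambda>x. h (fst x, \<psi> (snd x)))"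
    by (rule cont_into_compose[OF h(1)]) (use box(7) in auto)
  obtain u' where u': "cont_into (cell a' b') B u'" "\<And>t. t \<in> rim a' b' \<Longrightarrow> u' t = h (1, \<psi> t)"
    using change_rim_values[OF box(1) 1 2] h(2) box(7) by (auto simp: image_subset_iff)
  show ?thesis
  proof (rule that[of "\<lambda>x. u' (\<phi> x)"])
    show "cont_into ({0..1} \<times> cell a b) B (\<lambda>x. u' (\<phi> x))"
      by (rule cont_into_compose[OF u'(1) box(2,4)])
    show "u' (\<phi> x) = h (1, x)" if "x \<in> cyl_rim a b" for x
    proof -
      have "x \<in> {0..1} \<times> cell a b" "\<phi> x \<in> rim a' b'" using that box(6) cyl_rim_subset by blast+
      then show ?thesis using u'(2) box(8) by metis
    qed
  qed
qed

text \<open>A contraction of \<open>E\<close>, read backwards, deforms a constant map on the rim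
  into \<open>g\<close>. The constant map extends over the box, hence so does
  \<open>g\<close>.\<close>

lemma contractible_imp_fills:
  assumes "contractible_space E" "topspace E \<noteq> {}"
  shows "fills E"
  unfolding fills_def
proof (intro allI impI)
  fix a b g
  assume c: "is_cell a b" and g: "cont_into (rim a b) E g"
  obtain e where "e \<in> topspace E" and e: "homotopic_with (\<lambda>x. True) E E id (\<lambda>x. e)"
    using assms unfolding contractible_space_alt by blast
  then have "homotopic_with (\<lambda>x. True) (top_of_set (rim a b)) E ((\<lambda>x. e) \<circ> g) (id \<circ> g)"
    by (intro homotopic_with_compose_continuous_map_right[OF homotopic_with_symD[OF e] g]) auto
  then obtain h where h: "cont_into ({0..1::real} \<times> rim a b) E h"
    "\<And>t. h (0, t) = e" "\<And>t. h (1, t) = g t"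
    unfolding homotopic_with_def prod_topology_subtopology_eu o_apply id_apply by blast
  have "cont_into (cell a b) E (\<lambda>_. e)" using \<open>e \<in> topspace E\<close> by simp
  from change_rim_values[OF c this h(1)] h(2,3)
  show "\<exists>G. cont_into (cell a b) E G \<and> (\<forall>t\<in>rim a b. G t = g t)" by metis
qed

text \<open>
  The relative lifting property of weak equivalences: a lift, up to a given homotopy, over the
  rim extends to a lift, up to a homotopy extending the given one, over the box.
\<close>

definition rel_lifting :: "'e topology \<Rightarrow> 'b topology \<Rightarrow> ('e \<Rightarrow> 'b) \<Rightarrow> bool" where
  "rel_lifting E B p \<longleftrightarrow> (\<forall>a b f g H. is_cell a b \<longrightarrow> cont_into (cell a b) B f \<longrightarrow> cont_into (rim a b) E g \<longrightarrow>
     cont_into ({0..1::real} \<times> rim a b) B H \<longrightarrow> (\<forall>t\<in>rim a b. H (0, t) = f t \<and> H (1, t) = p (g t)) \<longrightarrow>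
     (\<exists>G K. cont_into (cell a b) E G \<and> cont_into ({0..1} \<times> cell a b) B K \<and>
        (\<forall>t\<in>cell a b. K (0, t) = f t \<and> K (1, t) = p (G t)) \<and>
        (\<forall>t\<in>rim a b. G t = g t \<and> (\<forall>\<tau>\<in>{0..1}. K (\<tau>, t) = H (\<tau>, t)))))"

lemma rel_liftingD:
  assumes "rel_lifting E B p" "is_cell a b" "cont_into (cell a b) B f" "cont_into (rim a b) E g"
    "cont_into ({0..1::real} \<times> rim a b) B H" "\<And>t. t \<in> rim a b \<Longrightarrow> H (0, t) = f t"
    "\<And>t. t \<in> rim a b \<Longrightarrow> H (1, t) = p (g t)"
  obtains G K where "cont_into (cell a b) E G" "cont_into ({0..1::real} \<times> cell a b) B K"
    "\<And>t. t \<in> cell a b \<Longrightarrow> K (0, t) = f t" "\<And>t. t \<in> cell a b \<Longrightarrow> K (1, t) = p (G t)"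
    "\<And>t. t \<in> rim a b \<Longrightarrow> G t = g t" "\<And>\<tau> t. \<tau> \<in> {0..1::real} \<Longrightarrow> t \<in> rim a b \<Longrightarrow> K (\<tau>, t) = H (\<tau>, t)"
proof -
  have "\<exists>G K. cont_into (cell a b) E G \<and> cont_into ({0..1::real} \<times> cell a b) B K \<and>
        (\<forall>t\<in>cell a b. K (0, t) = f t \<and> K (1, t) = p (G t)) \<and>
        (\<forall>t\<in>rim a b. G t = g t \<and> (\<forall>\<tau>\<in>{0..1::real}. K (\<tau>, t) = H (\<tau>, t)))"
    by (rule assms(1)[unfolded rel_lifting_def, rule_format]) (use assms(2-) in auto)
  then obtain G K where "cont_into (cell a b) E G" "cont_into ({0..1::real} \<times> cell a b) B K"
    "\<forall>t\<in>cell a b. K (0, t) = f t \<and> K (1, t) = p (G t)"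
    "\<forall>t\<in>rim a b. G t = g t \<and> (\<forall>\<tau>\<in>{0..1}. K (\<tau>, t) = H (\<tau>, t))"
    by (elim exE conjE)
  then show ?thesis by (intro that[of G K]) simp_all
qed

text \<open>\<open>B\<close> is typically an open piece of a larger target, so only the points of
  \<open>E\<close> over \<open>B\<close> matter; \<open>H\<close> forces \<open>g\<close> to take
  its values there. Once \<open>g\<close> is extended to \<open>G\<close>, the maps
  \<open>f\<close>, \<open>p \<circ> G\<close> and \<open>H\<close> on floor, top and sides form a
  map on the boundary of the cylinder, which \<open>B\<close> fills.\<close>

lemma rel_lifting_of_fills:
  assumes E: "fills (subtopology E {e \<in> topspace E. p e \<in> topspace B})" and B: "fills B"
    and p: "continuous_map (subtopology E {e \<in> topspace E. p e \<in> topspace B}) B p"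
  shows "rel_lifting E B p"
  unfolding rel_lifting_def
proof (intro allI impI)
  fix a b f g and H :: "real \<times> (nat \<Rightarrow> real) \<Rightarrow> 'b"
  let ?E = "subtopology E {e \<in> topspace E. p e \<in> topspace B}"
  assume c: "is_cell a b" and f: "cont_into (cell a b) B f" and g: "cont_into (rim a b) E g"
    and H: "cont_into ({0..1} \<times> rim a b) B H" and eq: "\<forall>t\<in>rim a b. H (0, t) = f t \<and> H (1, t) = p (g t)"
  have "p (g t) \<in> topspace B" if "t \<in> rim a b" for t
    using continuous_map_image_subset_topspace[OF cont_into_homotopy_slice[OF H, of 1]] eq that
    by (auto simp: image_subset_iff)
  then have "cont_into (rim a b) ?E g"
    using g continuous_map_image_subset_topspace[OF g] by (auto simp: continuous_map_in_subtopology)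
  then obtain G where G: "cont_into (cell a b) ?E G" "\<And>t. t \<in> rim a b \<Longrightarrow> G t = g t"
    using fillsD[OF E c] by blast
  define k where "k = (\<lambda>x. if x \<in> {0..1} \<times> rim a b then H x else if x \<in> {0} \<times> cell a b then f (snd x) else p (G (snd x)))"
  have fcont: "cont_into ({0} \<times> cell a b) B (\<lambda>x. f (snd x))"
    by (rule cont_into_compose[OF f]) (auto intro!: continuous_intros)
  have "cont_into (cell a b) B (\<lambda>t. p (G t))"
    using continuous_map_compose[OF G(1) p] by (simp add: o_def)
  then have gcont: "cont_into ({1} \<times> cell a b) B (\<lambda>x. p (G (snd x)))"
    by (rule cont_into_compose) (auto intro!: continuous_intros)
  have "cont_into ({0} \<times> cell a b \<union> {1} \<times> cell a b) B
      (\<lambda>x::real \<times> (nat \<Rightarrow> real). if x \<in> {0} \<times> cell a b then f (snd x) else p (G (snd x)))"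
    by (rule cont_into_paste[OF _ _ fcont gcont]) (auto simp: closed_cell closed_Times)
  then have "cont_into ({0..1} \<times> rim a b \<union> ({0} \<times> cell a b \<union> {1} \<times> cell a b)) B k"
    unfolding k_def
    by (intro cont_into_paste H fcont gcont) (use eq G(2) in \<open>auto simp: closed_cell closed_rim[OF c] closed_Times\<close>)
  moreover have "{0..1} \<times> rim a b \<union> ({0} \<times> cell a b \<union> {1} \<times> cell a b) = cyl_rim a b"
    by (auto simp: cyl_rim_def)
  ultimately have "cont_into (cyl_rim a b) B k" by simp
  then obtain K where K: "cont_into ({0..1::real} \<times> cell a b) B K" "\<And>x. x \<in> cyl_rim a b \<Longrightarrow> K x = k x"
    using fills_cylinder[OF B c] by blast
  show "\<exists>G K. cont_into (cell a b) E G \<and> cont_into ({0..1::real} \<times> cell a b) B K \<and>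
        (\<forall>t\<in>cell a b. K (0, t) = f t \<and> K (1, t) = p (G t)) \<and>
        (\<forall>t\<in>rim a b. G t = g t \<and> (\<forall>\<tau>\<in>{0..1}. K (\<tau>, t) = H (\<tau>, t)))"
  proof (intro exI[of _ G] exI[of _ K] conjI ballI)
    show "cont_into (cell a b) E G" using G(1) by (simp add: continuous_map_in_subtopology)
    show "K (0, t) = f t" "K (1, t) = p (G t)" if "t \<in> cell a b" for t
      using K(2) eq G(2) that by (auto simp: cyl_rim_def k_def)
    show "K (\<tau>, t) = H (\<tau>, t)" if "t \<in> rim a b" "\<tau> \<in> {0..1}" for \<tau> t
      using K(2) that by (auto simp: cyl_rim_def k_def)
  qed (use K G in auto)
qed

text \<open>Here the target is a subspace of the source, so the end slice of an extension of
  \<open>H\<close> is already a lift.\<close>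

lemma rel_lifting_inclusion: 
  assumes "topspace B \<subseteq> topspace E" "B = subtopology E (topspace B)"
  shows "rel_lifting E B (\<lambda>x. x)"
  unfolding rel_lifting_def
proof (intro allI impI)
  fix a b f g and H :: "real \<times> (nat \<Rightarrow> real) \<Rightarrow> 'a"
  assume c: "is_cell a b" and f: "cont_into (cell a b) B f" and g: "cont_into (rim a b) E g"
    and H: "cont_into ({0..1} \<times> rim a b) B H" and eq: "\<forall>t\<in>rim a b. H (0, t) = f t \<and> H (1, t) = g t"
  obtain K where K: "cont_into ({0..1::real} \<times> cell a b) B K" "\<And>t. t \<in> cell a b \<Longrightarrow> K (0, t) = f t"
    "\<And>\<tau> t. \<tau> \<in> {0..1} \<Longrightarrow> t \<in> rim a b \<Longrightarrow> K (\<tau>, t) = H (\<tau>, t)"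
    using homotopy_extension[OF c f H] eq by metis
  have "cont_into (cell a b) E (\<lambda>t. K (1, t))"
    using cont_into_homotopy_slice[OF K(1), of 1] assms(2) by (metis atLeastAtMost_iff continuous_map_in_subtopology order_refl zero_le_one)
  with K eq show "\<exists>G K. cont_into (cell a b) E G \<and> cont_into ({0..1::real} \<times> cell a b) B K \<and>
        (\<forall>t\<in>cell a b. K (0, t) = f t \<and> K (1, t) = G t) \<and>
        (\<forall>t\<in>rim a b. G t = g t \<and> (\<forall>\<tau>\<in>{0..1}. K (\<tau>, t) = H (\<tau>, t)))"
    by (intro exI[of _ "\<lambda>t. K (1, t)"] exI[of _ K]) auto
qed

text \<open>Extending \<open>H\<close> over the box moves \<open>f\<close> to a map that equals
  \<open>p \<circ> g\<close> on the rim, where the strict hypothesis applies and yields a second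
  homotopy. The concatenation of both has the wrong speed on the rim and is corrected by changing
  its boundary values.\<close>

lemma rel_lifting_if_strict:
  fixes E :: "'e topology" and B :: "'b topology"
  assumes strict: "\<And>a b f g. is_cell a b \<Longrightarrow> cont_into (cell a b) B f \<Longrightarrow> cont_into (rim a b) E g \<Longrightarrow>
      (\<And>t. t \<in> rim a b \<Longrightarrow> f t = p (g t)) \<Longrightarrow>
      \<exists>G K. cont_into (cell a b) E G \<and> cont_into ({0..1::real} \<times> cell a b) B K \<and>
        (\<forall>t\<in>cell a b. K (0, t) = f t \<and> K (1, t) = p (G t)) \<and>
        (\<forall>t\<in>rim a b. G t = g t \<and> (\<forall>\<tau>\<in>{0..1}. K (\<tau>, t) = f t))"
  shows "rel_lifting E B p"
  unfolding rel_lifting_def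
proof (intro allI impI)
  fix a b f g and H :: "real \<times> (nat \<Rightarrow> real) \<Rightarrow> 'b"
  assume c: "is_cell a b" and f: "cont_into (cell a b) B f" and g: "cont_into (rim a b) E g"
    and H: "cont_into ({0..1} \<times> rim a b) B H" and eq: "\<forall>t\<in>rim a b. H (0, t) = f t \<and> H (1, t) = p (g t)"
  obtain F where F: "cont_into ({0..1} \<times> cell a b) B F" "\<And>t. t \<in> cell a b \<Longrightarrow> F (0, t) = f t"
    "\<And>\<tau> t. \<tau> \<in> {0..1} \<Longrightarrow> t \<in> rim a b \<Longrightarrow> F (\<tau>, t) = H (\<tau>, t)"
    using homotopy_extension[OF c f H] eq by metis
  have "cont_into (cell a b) B (\<lambda>t. F (1, t))" using cont_into_homotopy_slice[OF F(1)] by simp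
  moreover have "F (1, t) = p (g t)" if "t \<in> rim a b" for t using F(3) eq that by simp
  ultimately obtain G L where G: "cont_into (cell a b) E G" and L: "cont_into ({0..1::real} \<times> cell a b) B L"
    and L01: "\<And>t. t \<in> cell a b \<Longrightarrow> L (0, t) = F (1, t)" "\<And>t. t \<in> cell a b \<Longrightarrow> L (1, t) = p (G t)"
    and Gr: "\<And>t. t \<in> rim a b \<Longrightarrow> G t = g t" and Lr: "\<And>t \<tau>. t \<in> rim a b \<Longrightarrow> \<tau> \<in> {0..1} \<Longrightarrow> L (\<tau>, t) = F (1, t)"
    using strict[OF c _ g, of "\<lambda>t. F (1, t)"] by blast
  let ?S = "{0..1/2::real} \<times> cell a b" and ?T = "{1/2..1::real} \<times> cell a b"
  define C where "C = (\<lambda>x. if x \<in> ?S then F (fst x * 2, snd x) else L (fst x * 2 - 1, snd x))"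
  have "cont_into ?S B (\<lambda>x. F (fst x * 2, snd x))" "cont_into ?T B (\<lambda>x. L (fst x * 2 - 1, snd x))"
    by (rule cont_into_compose[OF F(1)] cont_into_compose[OF L]; auto intro!: continuous_intros)+
  then have "cont_into (?S \<union> ?T) B C"
    unfolding C_def by (intro cont_into_paste) (auto simp: closed_Times closed_cell L01)
  moreover have "?S \<union> ?T = {0..1} \<times> cell a b" by auto
  ultimately have C: "cont_into ({0..1} \<times> cell a b) B C" by simp
  let ?S' = "{0..1::real} \<times> ({0..1::real} \<times> rim a b)" and ?T' = "{0..1::real} \<times> ({0, 1::real} \<times> cell a b)"
  \<comment> \<open>On the sides the concatenation is \<open>H\<close> at double speed followed by a
    rest, namely \<open>H (min 1 (2 * \<tau>), t)\<close>. With first coordinate \<open>s\<close>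
    running from 0 to 1, the factor \<open>2 - s\<close> slows this down to \<open>H\<close> itself;
    the parameters 0 and 1 are fixed for every \<open>s\<close>, so floor and top do not
    move.\<close>
  define h where "h = (\<lambda>x. if x \<in> ?S' then H (min 1 (fst (snd x) * (2 - fst x)), snd (snd x)) else C (snd x))"
  have "cont_into ?S' B (\<lambda>x. H (min 1 (fst (snd x) * (2 - fst x)), snd (snd x)))"
  proof (rule cont_into_compose[OF H])
    show "continuous_on ?S' (\<lambda>x. (min 1 (fst (snd x) * (2 - fst x)), snd (snd x)))"
      by (intro continuous_on_Pair continuous_on_min continuous_on_mult continuous_on_diff
          continuous_on_const continuous_on_fst continuous_on_snd continuous_on_id)
  qed auto
  moreover have "cont_into ?T' B (\<lambda>x. C (snd x))"
    by (rule cont_into_compose[OF C]) (auto intro!: continuous_intros)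
  ultimately have "cont_into (?S' \<union> ?T') B h"
    unfolding h_def
    by (intro cont_into_paste)
       (use eq rim_subset_cell[of a b] in \<open>auto simp: closed_Times closed_cell closed_rim[OF c] C_def F L01 Gr subset_iff\<close>)
  moreover have "?S' \<union> ?T' = {0..1} \<times> cyl_rim a b" by (auto simp: cyl_rim_def)
  ultimately have h: "cont_into ({0..1} \<times> cyl_rim a b) B h" by simp
  have h0: "h (0, x) = C x" if "x \<in> cyl_rim a b" for x
    using that rim_subset_cell[of a b] eq
    by (auto simp: cyl_rim_def h_def C_def F Lr L01 Gr min_def subset_iff)
  obtain K where K: "cont_into ({0..1::real} \<times> cell a b) B K" "\<And>x. x \<in> cyl_rim a b \<Longrightarrow> K x = h (1, x)"
    using change_cyl_rim_values[OF c C h h0] by metis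
  show "\<exists>G K. cont_into (cell a b) E G \<and> cont_into ({0..1::real} \<times> cell a b) B K \<and>
        (\<forall>t\<in>cell a b. K (0, t) = f t \<and> K (1, t) = p (G t)) \<and>
        (\<forall>t\<in>rim a b. G t = g t \<and> (\<forall>\<tau>\<in>{0..1}. K (\<tau>, t) = H (\<tau>, t)))"
  proof (intro exI[of _ G] exI[of _ K] conjI ballI)
    show "K (0, t) = f t" "K (1, t) = p (G t)" if "t \<in> cell a b" for t
      using that K(2) eq by (auto simp: cyl_rim_def h_def C_def F(2) L01(2) Gr)
    show "K (\<tau>, t) = H (\<tau>, t)" if "t \<in> rim a b" "\<tau> \<in> {0..1}" for \<tau> t
      using that K(2) by (auto simp: cyl_rim_def h_def min_def)
  qed (use G K Gr in auto)
qed

section \<open>Gluing lifts over an open cover\<close>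

lemma cell_mono: "(\<And>i. a i \<le> a' i) \<Longrightarrow> (\<And>i. b' i \<le> b i) \<Longrightarrow> cell a' b' \<subseteq> cell a b"
  unfolding cell_def by (auto intro: order_trans)

lemma compact_cell: "compact (cell a b)"
proof -
  have "cell a b = PiE UNIV (\<lambda>i. {a i..b i})" by (auto simp: cell_def PiE_def Pi_def)
  moreover have "compactin (product_topology (\<lambda>_. euclidean) UNIV) (PiE UNIV (\<lambda>i. {a i..b i}))"
    by (subst compactin_PiE) (auto simp: compactin_euclidean_iff)
  ultimately show ?thesis by (simp add: euclidean_product_topology compactin_euclidean_iff)
qed

text \<open>The distance is at most twice the largest difference among finitely many coordinates
  plus a tail \<open>(1/2) ^ N\<close>. Differences up to \<open>\<delta> / 8\<close> contribute
  \<open>\<delta> / 4\<close>, and the tail is chosen below \<open>\<delta> / 2\<close>.\<close>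

lemma uniformly_close_coords_imp_dist_less:
  assumes "\<delta> > 0"
  obtains \<epsilon> where "\<epsilon> > 0" "\<And>x y :: nat \<Rightarrow> real. (\<And>i. \<bar>x i - y i\<bar> \<le> \<epsilon>) \<Longrightarrow> dist x y < \<delta>"
proof -
  obtain N where N: "(1/2::real) ^ N < \<delta> / 2"
    using real_arch_pow_inv[of "\<delta> / 2" "1/2"] assms by auto
  show ?thesis
  proof (rule that[of "\<delta> / 8"])
    fix x y :: "nat \<Rightarrow> real"
    assume "\<And>i. \<bar>x i - y i\<bar> \<le> \<delta> / 8"
    then have "Max {dist (x (from_nat n)) (y (from_nat n)) |n. n \<le> N} \<le> \<delta> / 8"
      by (subst Max_le_iff) (auto simp: dist_real_def setcompr_eq_image)
    then show "dist x y < \<delta>"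
      using dist_fun_le_dist_first_terms[of x y N] N assms by linarith
  qed (use assms in simp)
qed

text \<open>Points at spacing \<open>\<epsilon>\<close> starting from \<open>u\<close>, with
  \<open>v\<close> added because the spacing may miss it. Fineness is stated through gaps, which is
  the form in which atoms of the grid are defined.\<close>

lemma fine_division:
  fixes u v \<epsilon> :: real
  assumes "u \<le> v" "\<epsilon> > 0"
  obtains D where "finite D" "u \<in> D" "v \<in> D" "D \<subseteq> {u..v}"
    "\<And>r s. r \<in> D \<Longrightarrow> s \<in> D \<Longrightarrow> D \<inter> {r<..<s} = {} \<Longrightarrow> s - r \<le> \<epsilon>"
proof -
  obtain K :: nat where "(v - u) / \<epsilon> \<le> K" using real_arch_simple by blast
  then have K: "v \<le> u + K * \<epsilon>" using assms by (simp add: field_simps)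
  define D where "D = insert v ((\<lambda>k. u + real k * \<epsilon>) ` {..K} \<inter> {..v})"
  show ?thesis
  proof (rule that[of D])
    show "u \<in> D" using assms by (auto simp: D_def intro!: image_eqI[of _ _ 0])
    show "s - r \<le> \<epsilon>" if rs: "r \<in> D" "s \<in> D" and gap: "D \<inter> {r<..<s} = {}" for r s
    proof (rule ccontr)
      assume "\<not> s - r \<le> \<epsilon>"
      then have lt: "r + \<epsilon> < s" by simp
      moreover have "s \<le> v" using rs by (auto simp: D_def)
      ultimately have "r \<noteq> v" using assms by auto
      then obtain k where k: "k \<le> K" "r = u + real k * \<epsilon>" using rs by (auto simp: D_def)
      \<comment> \<open>\<open>K\<close> steps reach or pass \<open>v\<close>, whereas
        \<open>r\<close> lies more than \<open>\<epsilon>\<close> below \<open>s \<le> v\<close>. So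
        one further step is available and lands strictly inside the gap.\<close>
      have "k \<noteq> K" using K k lt \<open>s \<le> v\<close> assms by auto
      then have "r + \<epsilon> = u + real (Suc k) * \<epsilon>" "Suc k \<le> K" using k by (auto simp: algebra_simps)
      moreover have "r + \<epsilon> \<le> v" using lt \<open>s \<le> v\<close> by simp
      ultimately have "r + \<epsilon> \<in> D" unfolding D_def by (metis (no_types, lifting) IntI atMost_iff image_eqI insertI2)
      then show False using gap lt assms by auto
    qed
  qed (use assms in \<open>auto simp: D_def\<close>)
qed

section \<open>Lifting over a grid of small boxes\<close>

text \<open>Openness of the cover enters through \<open>fine\<close>: the Lebesgue number will
  provide a division \<open>D\<close> for which every small box is mapped into one member. On
  degenerate sides \<open>D i\<close> is a single point.\<close>

locale grid_lifting =
  fixes E :: "'e topology" and B :: "'b topology" and p :: "'e \<Rightarrow> 'b"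
    and f :: "(nat \<Rightarrow> real) \<Rightarrow> 'b" and \<V> :: "'b set set"
    and a0 b0 :: "nat \<Rightarrow> real" and D :: "nat \<Rightarrow> real set"
  assumes finite_cover: "finite \<V>" and Int_cover: "V \<in> \<V> \<Longrightarrow> W \<in> \<V> \<Longrightarrow> V \<inter> W \<in> \<V>"
    and lifting: "V \<in> \<V> \<Longrightarrow> rel_lifting E (subtopology B V) p"
    and cell0: "is_cell a0 b0" and f: "cont_into (cell a0 b0) B f"
    and D: "finite (D i)" "a0 i \<in> D i" "b0 i \<in> D i" "D i \<subseteq> {a0 i..b0 i}"
    and fine: "(\<And>i. a i \<in> D i \<and> b i \<in> D i \<and> a i \<le> b i \<and> D i \<inter> {a i<..<b i} = {}) \<Longrightarrow> \<exists>V\<in>\<V>. f ` cell a b \<subseteq> V"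
begin

definition grid_box :: "(nat \<Rightarrow> real) \<Rightarrow> (nat \<Rightarrow> real) \<Rightarrow> bool" where
  "grid_box a b \<longleftrightarrow> (\<forall>i. a i \<in> D i \<and> b i \<in> D i \<and> a i \<le> b i)"

text \<open>Sides of length 0 are permitted, so the faces of an atom are atoms too; this lets the
  induction descend to walls of lower dimension.\<close>

definition atom :: "(nat \<Rightarrow> real) \<Rightarrow> (nat \<Rightarrow> real) \<Rightarrow> bool" where
  "atom a b \<longleftrightarrow> grid_box a b \<and> (\<forall>i. D i \<inter> {a i<..<b i} = {})"

text \<open>
  The last clause makes the homotopy stay in every set of the cover that contains the image of
  the atom; this is what lets lifts over adjacent atoms with different carriers fit together.
\<close>

definition partial_lift :: "(nat \<Rightarrow> real) set \<Rightarrow> ((nat \<Rightarrow> real) \<Rightarrow> 'e) \<Rightarrow> (real \<times> (nat \<Rightarrow> real) \<Rightarrow> 'b) \<Rightarrow> bool" where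
  "partial_lift L g H \<longleftrightarrow> cont_into L E g \<and> cont_into ({0..1} \<times> L) B H \<and>
     (\<forall>t\<in>L. H (0, t) = f t \<and> H (1, t) = p (g t)) \<and>
     (\<forall>a b V. atom a b \<longrightarrow> V \<in> \<V> \<longrightarrow> f ` cell a b \<subseteq> V \<longrightarrow> H ` ({0..1} \<times> (L \<inter> cell a b)) \<subseteq> V)"

lemma partial_lift_subset:
  assumes "partial_lift L g H" "L' \<subseteq> L"
  shows "partial_lift L' g H"
proof -
  have "cont_into L' E g" "cont_into ({0..1} \<times> L') B H"
    using assms by (auto simp: partial_lift_def intro: cont_into_subset)
  then show ?thesis using assms unfolding partial_lift_def by (auto simp: subset_iff image_subset_iff)
qed

lemma partial_lift_paste:
  assumes "partial_lift S g H" "partial_lift T g' H'" "closed S" "closed T"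
    "\<And>t. t \<in> S \<inter> T \<Longrightarrow> g t = g' t" "\<And>\<tau> t. \<tau> \<in> {0..1} \<Longrightarrow> t \<in> S \<inter> T \<Longrightarrow> H (\<tau>, t) = H' (\<tau>, t)"
  shows "partial_lift (S \<union> T) (\<lambda>t. if t \<in> S then g t else g' t) (\<lambda>x. if snd x \<in> S then H x else H' x)"
proof -
  have 1: "cont_into (S \<union> T) E (\<lambda>t. if t \<in> S then g t else g' t)"
    using assms by (intro cont_into_paste) (auto simp: partial_lift_def)
  have "cont_into ({0..1::real} \<times> S \<union> {0..1::real} \<times> T) B (\<lambda>x. if x \<in> {0..1::real} \<times> S then H x else H' x)"
    using assms by (intro cont_into_paste) (auto simp: partial_lift_def closed_Times)
  moreover have "{0..1::real} \<times> S \<union> {0..1::real} \<times> T = {0..1::real} \<times> (S \<union> T)" by auto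
  ultimately have "cont_into ({0..1::real} \<times> (S \<union> T)) B (\<lambda>x. if x \<in> {0..1::real} \<times> S then H x else H' x)" by simp
  then have 2: "cont_into ({0..1::real} \<times> (S \<union> T)) B (\<lambda>x. if snd x \<in> S then H x else H' x)"
    by (rule cont_into_eq) auto
  show ?thesis
    unfolding partial_lift_def
    using assms(1,2) by (intro conjI 1 2) (auto simp: partial_lift_def image_subset_iff)
qed

lemma inactive:
  assumes "grid_box a b" "\<not> a0 i < b0 i"
  shows "a i = a0 i" "b i = a0 i"
proof -
  have "b0 i = a0 i" using cell0 assms(2) by (auto simp: is_cell_def intro: antisym)
  then have "D i \<subseteq> {a0 i}" using D(4)[of i] by simp
  then show "a i = a0 i" "b i = a0 i" using assms(1) by (auto simp: grid_box_def)
qed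

lemma grid_box_is_cell:
  assumes "grid_box a b"
  shows "is_cell a b" "cell a b \<subseteq> cell a0 b0"
proof -
  have "{i. a i < b i} \<subseteq> {i. a0 i < b0 i}"
    using inactive[OF assms] by force
  moreover have "finite {i. a0 i < b0 i}" using cell0 by (simp add: is_cell_def)
  ultimately have "finite {i. a i < b i}" by (rule finite_subset)
  then show "is_cell a b" using assms by (simp add: is_cell_def grid_box_def)
  show "cell a b \<subseteq> cell a0 b0"
    by (rule cell_mono) (use assms D(4) in \<open>auto simp: grid_box_def subset_iff\<close>)
qed

text \<open>On a non-degenerate side, \<open>t i\<close> lies strictly between two neighbouring
  division points. The ends of the other atom are division points enclosing \<open>t i\<close>, so
  they enclose the whole side. A degenerate side is just the value \<open>t i\<close>.\<close>

lemma atom_subset_if_meets_interior: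
  assumes "atom a b" "atom a' b'" "t \<in> cell a b" "t \<notin> rim a b" "t \<in> cell a' b'"
  shows "cell a b \<subseteq> cell a' b'"
proof -
  have "a' i \<le> a i \<and> b i \<le> b' i" for i
  proof (cases "a i < b i")
    case True
    then have "a i < t i" "t i < b i" using assms(3,4) by (auto simp: rim_def cell_def order_less_le)
    moreover have "a' i \<le> t i" "t i \<le> b' i" using assms(5) by (auto simp: cell_def)
    moreover have "a' i \<in> D i" "b' i \<in> D i" "D i \<inter> {a i<..<b i} = {}"
      using assms(1,2) by (auto simp: atom_def grid_box_def)
    ultimately show ?thesis
      by (smt (verit) IntI empty_iff greaterThanLessThan_iff)
  next
    case False
    then show ?thesis
      using assms(3,5) unfolding cell_def mem_Collect_eq by (smt (verit))
  qed
  then show ?thesis unfolding cell_def by (auto intro: order_trans)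
qed

lemma Inter_cover:
  assumes "\<F> \<subseteq> \<V>" "\<F> \<noteq> {}"
  shows "\<Inter>\<F> \<in> \<V>"
proof -
  have "finite \<F>" using assms finite_cover finite_subset by blast
  from this assms(2,1) show ?thesis
    by (induction rule: finite_ne_induct) (auto intro: Int_cover)
qed

text \<open>The lift is taken over the smallest member \<open>V\<close> containing the image of the
  atom; it exists because the cover is finite and closed under intersections. The carrier condition
  for another atom is inherited at rim points. At an interior point this atom lies inside the other
  one, so any \<open>W\<close> containing the image of the other contains \<open>V\<close>.\<close>

lemma extend_over_atom:
  assumes "atom a b" and gH: "partial_lift (rim a b) g H"
  shows "\<exists>G K. partial_lift (cell a b) G K \<and>
    (\<forall>t\<in>rim a b. G t = g t \<and> (\<forall>\<tau>\<in>{0..1}. K (\<tau>, t) = H (\<tau>, t)))"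
proof -
  define V where "V = \<Inter>{W \<in> \<V>. f ` cell a b \<subseteq> W}"
  have box: "grid_box a b" using assms(1) by (simp add: atom_def)
  have "\<exists>W\<in>\<V>. f ` cell a b \<subseteq> W"
    by (rule fine) (use assms(1) in \<open>auto simp: atom_def grid_box_def\<close>)
  then have V: "V \<in> \<V>" unfolding V_def by (intro Inter_cover) auto
  have fV: "f ` cell a b \<subseteq> V" by (auto simp: V_def)
  have HV: "H ` ({0..1} \<times> rim a b) \<subseteq> V"
    using gH assms(1) V fV rim_subset_cell[of a b] unfolding partial_lift_def
    by (metis inf.absorb1)
  have "cont_into (cell a b) (subtopology B V) f"
    using cont_into_subset[OF f grid_box_is_cell(2)[OF box]] fV by (auto simp: continuous_map_in_subtopology)
  moreover have "cont_into ({0..1} \<times> rim a b) (subtopology B V) H"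
    using gH HV by (auto simp: partial_lift_def continuous_map_in_subtopology)
  ultimately obtain G K where G: "cont_into (cell a b) E G" and K: "cont_into ({0..1::real} \<times> cell a b) (subtopology B V) K"
    and K01: "\<And>t. t \<in> cell a b \<Longrightarrow> K (0, t) = f t" "\<And>t. t \<in> cell a b \<Longrightarrow> K (1, t) = p (G t)"
    and agree: "\<And>t. t \<in> rim a b \<Longrightarrow> G t = g t" "\<And>\<tau> t. \<tau> \<in> {0..1} \<Longrightarrow> t \<in> rim a b \<Longrightarrow> K (\<tau>, t) = H (\<tau>, t)"
    using rel_liftingD[OF lifting[OF V] grid_box_is_cell(1)[OF box], of f g H] gH
    by (auto simp: partial_lift_def)
  have KV: "K x \<in> V" if "x \<in> {0..1} \<times> cell a b" for x
    using K that by (auto simp: continuous_map_in_subtopology image_subset_iff)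
  have "K (\<tau>, t) \<in> W" if W: "atom c d" "W \<in> \<V>" "f ` cell c d \<subseteq> W" and t: "t \<in> cell a b" "t \<in> cell c d" "\<tau> \<in> {0..1}" for c d W \<tau> t
  proof (cases "t \<in> rim a b")
    case True
    have "H ` ({0..1} \<times> (rim a b \<inter> cell c d)) \<subseteq> W"
      using gH W unfolding partial_lift_def by blast
    then show ?thesis using agree(2) True t by auto
  next
    case False
    then have "cell a b \<subseteq> cell c d" by (rule atom_subset_if_meets_interior[OF assms(1) W(1) t(1) _ t(2)])
    then have "f ` cell a b \<subseteq> W" using W(3) by blast
    then have "V \<subseteq> W" using W(2) by (auto simp: V_def)
    then show ?thesis using KV t by auto
  qed
  then have "partial_lift (cell a b) G K"
    using G K K01 by (auto simp: partial_lift_def continuous_map_in_subtopology image_subset_iff)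
  with agree show ?thesis by blast
qed

text \<open>\<open>cell ar bl\<close> is the wall at height \<open>v\<close>. Its coordinate
  \<open>i\<close> is degenerate, so the rim of the wall lies in the old rim, while the rim of each
  half is its share of the old rim together with the wall.\<close>

lemma cut_cell:
  assumes "is_cell a b" "a i < v" "v < b i"
  defines "bl \<equiv> b(i := v)" and "ar \<equiv> a(i := v)"
  shows "cell a b = cell a bl \<union> cell ar b" "cell a bl \<inter> cell ar b = cell ar bl"
    "rim a bl = (rim a b \<inter> cell a bl) \<union> cell ar bl" "rim ar b = (rim a b \<inter> cell ar b) \<union> cell ar bl"
    "rim ar bl = rim a b \<inter> cell ar bl"
proof -
  have cl: "t \<in> cell a bl \<longleftrightarrow> t \<in> cell a b \<and> t i \<le> v" and cr: "t \<in> cell ar b \<longleftrightarrow> t \<in> cell a b \<and> v \<le> t i"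
    and cw: "t \<in> cell ar bl \<longleftrightarrow> t \<in> cell a b \<and> t i = v" for t
    unfolding cell_def bl_def ar_def mem_Collect_eq fun_upd_def using assms(2,3)
    by (smt (verit))+
  show "cell a b = cell a bl \<union> cell ar b" "cell a bl \<inter> cell ar b = cell ar bl"
    using cl cr cw by auto
  have rl: "(a j < bl j \<and> (t j = a j \<or> t j = bl j)) \<longleftrightarrow> (a j < b j \<and> (t j = a j \<or> t j = b j)) \<or> j = i \<and> t i = v"
    if "t i \<le> v" for t j
    using that assms(2,3) by (auto simp: bl_def)
  have rr: "(ar j < b j \<and> (t j = ar j \<or> t j = b j)) \<longleftrightarrow> (a j < b j \<and> (t j = a j \<or> t j = b j)) \<or> j = i \<and> t i = v"
    if "v \<le> t i" for t j
    using that assms(2,3) by (auto simp: ar_def)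
  have rw: "(ar j < bl j \<and> (t j = ar j \<or> t j = bl j)) \<longleftrightarrow> (a j < b j \<and> (t j = a j \<or> t j = b j))"
    if "t i = v" for t j
    using that assms(2,3) by (auto simp: ar_def bl_def)
  show "rim a bl = (rim a b \<inter> cell a bl) \<union> cell ar bl"
    unfolding set_eq_iff rim_def Un_iff Int_iff mem_Collect_eq cl cw using rl by (smt (verit))
  show "rim ar b = (rim a b \<inter> cell ar b) \<union> cell ar bl"
    unfolding set_eq_iff rim_def Un_iff Int_iff mem_Collect_eq cr cw using rr by (smt (verit))
  show "rim ar bl = rim a b \<inter> cell ar bl"
    unfolding set_eq_iff rim_def Un_iff Int_iff mem_Collect_eq cw using rw by (smt (verit))
qed

text \<open>A box that is not an atom is cut at an interior division point. The lift is extended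
  over the wall, whose rim carries given data, and after that over both halves, whose rims are now
  fully covered.\<close>

lemma extend_over_grid_box:
  assumes "grid_box a b" "partial_lift (rim a b) g H"
  shows "\<exists>G K. partial_lift (cell a b) G K \<and>
    (\<forall>t\<in>rim a b. G t = g t \<and> (\<forall>\<tau>\<in>{0..1}. K (\<tau>, t) = H (\<tau>, t)))"
  using assms
\<comment> \<open>The measure counts the division points strictly inside the box. The sum is
  restricted to the non-degenerate sides of the big box, so it is finite.\<close>
proof (induction "\<Sum>i | a0 i < b0 i. card (D i \<inter> {a i<..<b i})" arbitrary: a b g H rule: less_induct)
  case less
  define m where "m = (\<lambda>a b. \<Sum>i | a0 i < b0 i. card (D i \<inter> {a i<..<b i::real}))"
  note box = less.prems(1) and gH = less.prems(2)
  show ?case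
  proof (cases "atom a b")
    case True
    then show ?thesis using extend_over_atom gH by blast
  next
    case False
    then obtain i v where v: "v \<in> D i" "a i < v" "v < b i"
      using box by (auto simp: atom_def)
    define bl ar where "bl = b(i := v)" and "ar = a(i := v)"
    have i: "a0 i < b0 i" using inactive[OF box, of i] v by fastforce
    have boxes: "grid_box a bl" "grid_box ar b" "grid_box ar bl"
      using box v by (auto simp: grid_box_def bl_def ar_def)
    \<comment> \<open>No interval of the new box gains division points, and \<open>v\<close> is lost
      in direction \<open>i\<close>.\<close>
    have less_m: "m a' b' < m a b"
      if "\<And>j. D j \<inter> {a' j<..<b' j} \<subseteq> D j \<inter> {a j<..<b j}" "v \<notin> {a' i<..<b' i}" for a' b'
      unfolding m_def
    proof (rule sum_strict_mono_ex1)
      have "D i \<inter> {a' i<..<b' i} \<noteq> D i \<inter> {a i<..<b i}" using that(2) v by auto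
      then have "D i \<inter> {a' i<..<b' i} \<subset> D i \<inter> {a i<..<b i}" using that(1)[of i] by (rule psubsetI[rotated])
      then show "\<exists>j\<in>{i. a0 i < b0 i}. card (D j \<inter> {a' j<..<b' j}) < card (D j \<inter> {a j<..<b j})"
        using i psubset_card_mono[of "D i \<inter> {a i<..<b i}"] D(1)[of i] by blast
      show "finite {i. a0 i < b0 i}" using cell0 by (simp add: is_cell_def)
      show "\<forall>j\<in>{i. a0 i < b0 i}. card (D j \<inter> {a' j<..<b' j}) \<le> card (D j \<inter> {a j<..<b j})"
        using that(1) D(1) by (intro ballI card_mono) simp_all
    qed
    have m: "m a bl < m a b" "m ar b < m a b" "m ar bl < m a b"
      by (rule less_m; use v in \<open>auto simp: bl_def ar_def split: if_splits\<close>)+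
    note cut = cut_cell[OF grid_box_is_cell(1)[OF box] v(2,3), folded bl_def ar_def]
    have clo: "closed (rim a b)" using closed_rim grid_box_is_cell(1)[OF box] by blast
    have "partial_lift (rim ar bl) g H" using gH cut(5) by (auto intro: partial_lift_subset)
    then obtain g1 H1 where 1: "partial_lift (cell ar bl) g1 H1"
      "\<And>t. t \<in> rim ar bl \<Longrightarrow> g1 t = g t" "\<And>t \<tau>. t \<in> rim ar bl \<Longrightarrow> \<tau> \<in> {0..1} \<Longrightarrow> H1 (\<tau>, t) = H (\<tau>, t)"
      using less.hyps[OF m(3)[unfolded m_def] boxes(3)] by metis
    define g2 H2 where "g2 = (\<lambda>t. if t \<in> rim a b then g t else g1 t)"
      and "H2 = (\<lambda>x. if snd x \<in> rim a b then H x else H1 x)"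
    have 2: "partial_lift (rim a b \<union> cell ar bl) g2 H2"
      unfolding g2_def H2_def
      by (rule partial_lift_paste[OF gH 1(1) clo closed_cell]) (use 1 cut(5) in auto)
    have rims: "partial_lift (rim a bl) g2 H2" "partial_lift (rim ar b) g2 H2"
      by (rule partial_lift_subset[OF 2]; use cut(3,4) in auto)+
    from less.hyps[OF m(1)[unfolded m_def] boxes(1) rims(1)]
    obtain g3 H3 where 3: "partial_lift (cell a bl) g3 H3"
      "\<And>t. t \<in> rim a bl \<Longrightarrow> g3 t = g2 t" "\<And>t \<tau>. t \<in> rim a bl \<Longrightarrow> \<tau> \<in> {0..1} \<Longrightarrow> H3 (\<tau>, t) = H2 (\<tau>, t)"
      by blast
    from less.hyps[OF m(2)[unfolded m_def] boxes(2) rims(2)]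
    obtain g4 H4 where 4: "partial_lift (cell ar b) g4 H4"
      "\<And>t. t \<in> rim ar b \<Longrightarrow> g4 t = g2 t" "\<And>t \<tau>. t \<in> rim ar b \<Longrightarrow> \<tau> \<in> {0..1} \<Longrightarrow> H4 (\<tau>, t) = H2 (\<tau>, t)"
      by blast
    define G K where "G = (\<lambda>t. if t \<in> cell a bl then g3 t else g4 t)"
      and "K = (\<lambda>x. if snd x \<in> cell a bl then H3 x else H4 x)"
    \<comment> \<open>The halves meet in the wall, which belongs to both rims; there both extensions
      restrict to \<open>g2\<close> and \<open>H2\<close>.\<close>
    have wall: "t \<in> rim a bl \<and> t \<in> rim ar b" if "t \<in> cell a bl \<inter> cell ar b" for t
      using that cut(2-4) by auto
    have "partial_lift (cell a bl \<union> cell ar b) G K"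
      unfolding G_def K_def
      by (rule partial_lift_paste[OF 3(1) 4(1) closed_cell closed_cell])
         (use wall 3(2,3) 4(2,3) in auto)
    moreover have "G t = g t \<and> (\<forall>\<tau>\<in>{0..1}. K (\<tau>, t) = H (\<tau>, t))" if t: "t \<in> rim a b" for t
    proof -
      have g2: "g2 t = g t" "H2 (\<tau>, t) = H (\<tau>, t)" for \<tau> using t by (auto simp: g2_def H2_def)
      show ?thesis
      proof (cases "t \<in> cell a bl")
        case True
        then have "t \<in> rim a bl" using t cut(3) by simp
        then show ?thesis using 3(2,3)[of t] g2 True by (simp add: G_def K_def)
      next
        case False
        then have "t \<in> cell ar b" using t cut(1) rim_subset_cell[of a b] by auto
        then have "t \<in> rim ar b" using t cut(4) by simp
        then show ?thesis using 4(2,3)[of t] g2 False by (simp add: G_def K_def)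
      qed
    qed
    ultimately show ?thesis using cut(1) by auto
  qed
qed

end

text \<open>By the reduction to strict squares the homotopy on the rim may be taken constant. The
  box is divided finely enough for \<open>f\<close> to map each small box into one member, and the
  grid induction does the rest.\<close>

theorem rel_lifting_glue:
  fixes E :: "'e topology" and B :: "'b topology"
  assumes cover: "finite \<V>" "topspace B \<subseteq> \<Union>\<V>" "\<And>V. V \<in> \<V> \<Longrightarrow> openin B V"
    "\<And>V W. V \<in> \<V> \<Longrightarrow> W \<in> \<V> \<Longrightarrow> V \<inter> W \<in> \<V>"
    and lift: "\<And>V. V \<in> \<V> \<Longrightarrow> rel_lifting E (subtopology B V) p"
  shows "rel_lifting E B p"
proof (rule rel_lifting_if_strict)
  fix a b f g
  assume c: "is_cell a b" and f: "cont_into (cell a b) B f" and g: "cont_into (rim a b) E g"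
    and fg: "\<And>t. t \<in> rim a b \<Longrightarrow> f t = p (g t)"
  have "\<exists>O'. open O' \<and> cell a b \<inter> f -` V = cell a b \<inter> O'" if "V \<in> \<V>" for V
  proof -
    have "openin (top_of_set (cell a b)) {t \<in> cell a b. f t \<in> V}"
      using openin_continuous_map_preimage[OF f cover(3)[OF that]] by simp
    then show ?thesis by (auto simp: openin_open vimage_def Collect_conj_eq)
  qed
  then obtain O' where O': "\<And>V. V \<in> \<V> \<Longrightarrow> open (O' V)" "\<And>V. V \<in> \<V> \<Longrightarrow> cell a b \<inter> f -` V = cell a b \<inter> O' V"
    by metis
  have "f ` cell a b \<subseteq> \<Union>\<V>" using continuous_map_image_subset_topspace[OF f] cover(2) by auto
  then have "t \<in> \<Union>(O' ` \<V>)" if t: "t \<in> cell a b" for t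
  proof -
    from \<open>f ` cell a b \<subseteq> \<Union>\<V>\<close> t obtain V where V: "V \<in> \<V>" "f t \<in> V" by auto
    then have "t \<in> cell a b \<inter> f -` V" using t by simp
    then have "t \<in> O' V" unfolding O'(2)[OF V(1)] by simp
    then show ?thesis using V(1) by blast
  qed
  then have "cell a b \<subseteq> \<Union>(O' ` \<V>)" by blast
  \<comment> \<open>A Lebesgue number of the cover by the sets \<open>O' V\<close>, which extend the
    relatively open preimages to open sets of the sequence space. A small box with sides at most
    \<open>\<epsilon>\<close> lies in the ball of radius \<open>\<delta>\<close> about its lower
    corner.\<close>
  then obtain \<delta> where \<delta>: "\<delta> > 0" "\<And>x. x \<in> cell a b \<Longrightarrow> \<exists>U \<in> O' ` \<V>. ball x \<delta> \<subseteq> U"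
    using Heine_Borel_lemma[OF compact_cell[of a b], of "O' ` \<V>"] O'(1) by (metis imageE)
  obtain \<epsilon> where \<epsilon>: "\<epsilon> > 0" "\<And>x y :: nat \<Rightarrow> real. (\<And>i. \<bar>x i - y i\<bar> \<le> \<epsilon>) \<Longrightarrow> dist x y < \<delta>"
    using uniformly_close_coords_imp_dist_less[OF \<delta>(1)] by metis
  have "a i \<le> b i" for i using c by (simp add: is_cell_def)
  then have "\<exists>D. finite D \<and> a i \<in> D \<and> b i \<in> D \<and> D \<subseteq> {a i..b i} \<and> (\<forall>r\<in>D. \<forall>s\<in>D. D \<inter> {r<..<s} = {} \<longrightarrow> s - r \<le> \<epsilon>)" for i
    using fine_division[OF _ \<epsilon>(1)] by metis
  then obtain D where D: "\<And>i. finite (D i)" "\<And>i. a i \<in> D i" "\<And>i. b i \<in> D i" "\<And>i. D i \<subseteq> {a i..b i}"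
    "\<And>i r s. r \<in> D i \<Longrightarrow> s \<in> D i \<Longrightarrow> D i \<inter> {r<..<s} = {} \<Longrightarrow> s - r \<le> \<epsilon>"
    by metis
  interpret grid_lifting E B p f \<V> a b D
  proof
    fix a' b'
    assume box: "\<And>i. a' i \<in> D i \<and> b' i \<in> D i \<and> a' i \<le> b' i \<and> D i \<inter> {a' i<..<b' i} = {}"
    have sub: "cell a' b' \<subseteq> cell a b"
    proof (rule cell_mono)
      show "a i \<le> a' i" "b' i \<le> b i" for i using box[of i] D(4)[of i] by auto
    qed
    have "a' \<in> cell a' b'" using box by (auto simp: cell_def)
    then obtain V where V: "V \<in> \<V>" "ball a' \<delta> \<subseteq> O' V" using \<delta>(2)[of a'] sub by auto
    have "dist a' t < \<delta>" if "t \<in> cell a' b'" for t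
    proof (rule \<epsilon>(2))
      fix i
      have "a' i \<le> t i" "t i \<le> b' i" using that by (auto simp: cell_def)
      moreover have "b' i - a' i \<le> \<epsilon>" using box[of i] by (intro D(5)[of _ i]) auto
      ultimately show "\<bar>a' i - t i\<bar> \<le> \<epsilon>" by simp
    qed
    then have "cell a' b' \<subseteq> cell a b \<inter> O' V" using V(2) sub by (auto simp: subset_iff)
    then have "f ` cell a' b' \<subseteq> V" using O'(2)[OF V(1)] by blast
    then show "\<exists>V\<in>\<V>. f ` cell a' b' \<subseteq> V" using V(1) by blast
  qed (use c f D cover lift in auto)
  have "grid_box a b" using D(2,3) c by (auto simp: grid_box_def is_cell_def)
  \<comment> \<open>A constant homotopy stays at \<open>f t\<close>, so it remains in every member
    that contains the image of an atom through \<open>t\<close>.\<close>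
  moreover have "partial_lift (rim a b) g (\<lambda>x. f (snd x))"
  proof -
    have "cont_into ({0..1::real} \<times> rim a b) B (\<lambda>x. f (snd x))"
      by (rule cont_into_compose[OF f]) (use rim_subset_cell in \<open>auto intro!: continuous_intros\<close>)
    then show ?thesis using g fg by (auto simp: partial_lift_def)
  qed
  ultimately obtain G K where "partial_lift (cell a b) G K"
    "\<forall>t\<in>rim a b. G t = g t \<and> (\<forall>\<tau>\<in>{0..1}. K (\<tau>, t) = f t)"
    using extend_over_grid_box by fastforce
  then show "\<exists>G K. cont_into (cell a b) E G \<and> cont_into ({0..1::real} \<times> cell a b) B K \<and>
        (\<forall>t\<in>cell a b. K (0, t) = f t \<and> K (1, t) = p (G t)) \<and>
        (\<forall>t\<in>rim a b. G t = g t \<and> (\<forall>\<tau>\<in>{0..1}. K (\<tau>, t) = f t))"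
    unfolding partial_lift_def by blast
qed

section \<open>Finite spaces\<close>

lemma openin_min_open:
  assumes "finite (topspace X)" "x \<in> topspace X"
  shows "openin X (min_open X x)"
proof -
  have "{U. openin X U \<and> x \<in> U} \<subseteq> Pow (topspace X)" by (auto dest: openin_subset)
  then have "finite {U. openin X U \<and> x \<in> U}" using assms(1) by (meson finite_Pow_iff finite_subset)
  then show ?thesis unfolding min_open_def using assms(2) by (intro openin_Inter) auto
qed

lemma min_open_subset: "openin X U \<Longrightarrow> x \<in> U \<Longrightarrow> min_open X x \<subseteq> U"
  by (auto simp: min_open_def)

lemma min_open_refl: "x \<in> min_open X x"
  by (auto simp: min_open_def)

lemma spec_le_refl: "spec_le X x x"
  by (simp add: spec_le_def min_open_refl)

lemma min_open_subset_topspace: "x \<in> topspace X \<Longrightarrow> min_open X x \<subseteq> topspace X"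
  by (rule min_open_subset) auto

lemma min_open_mono:
  assumes "spec_le X x y"
  shows "min_open X x \<subseteq> min_open X y"
  using assms by (auto simp: spec_le_def min_open_def)

lemma spec_le_antisym:
  assumes "t0_space X" "x \<in> topspace X" "y \<in> topspace X" "spec_le X x y" "spec_le X y x"
  shows "x = y"
proof (rule ccontr)
  assume "x \<noteq> y"
  then obtain U where "openin X U" "x \<notin> U \<longleftrightarrow> y \<in> U"
    using assms(1-3) unfolding t0_space_def by blast
  then show False using assms(4,5) by (auto simp: spec_le_def min_open_def)
qed

lemma openin_iff_down_closed:
  assumes "finite (topspace X)"
  shows "openin X U \<longleftrightarrow> U \<subseteq> topspace X \<and> (\<forall>y\<in>U. min_open X y \<subseteq> U)"
proof
  assume "openin X U"
  then show "U \<subseteq> topspace X \<and> (\<forall>y\<in>U. min_open X y \<subseteq> U)"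
    by (auto simp: openin_subset min_open_subset dest: openin_subset)
next
  assume U: "U \<subseteq> topspace X \<and> (\<forall>y\<in>U. min_open X y \<subseteq> U)"
  have "openin X (\<Union>(min_open X ` U))"
    using U openin_min_open[OF assms] by (intro openin_Union) auto
  moreover have "\<Union>(min_open X ` U) = U" using U min_open_refl[of _ X] by blast
  ultimately show "openin X U" by simp
qed

lemma min_open_subtopology:
  assumes "finite (topspace X)" "S \<subseteq> topspace X" "y \<in> S"
  shows "min_open (subtopology X S) y = min_open X y \<inter> S"
proof
  have "openin (subtopology X S) (min_open X y \<inter> S)"
    using openin_min_open[OF assms(1)] assms by (auto simp: openin_subtopology)
  then show "min_open (subtopology X S) y \<subseteq> min_open X y \<inter> S"
    using assms(3) by (intro min_open_subset) (auto simp: min_open_refl)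
  show "min_open X y \<inter> S \<subseteq> min_open (subtopology X S) y"
    unfolding min_open_def openin_subtopology by auto
qed

lemma spec_le_subtopology:
  assumes "finite (topspace X)" "S \<subseteq> topspace X" "y \<in> S" "z \<in> S"
  shows "spec_le (subtopology X S) z y \<longleftrightarrow> spec_le X z y"
  using assms by (simp add: spec_le_def min_open_subtopology)

text \<open>Minimal open sets grow along the order, and by the T0 axiom they determine their points.
  A point of \<open>A\<close> with the largest minimal open set is therefore maximal in
  \<open>A\<close>.\<close>

lemma ex_spec_maximal:
  assumes "finite (topspace X)" "t0_space X" "A \<subseteq> topspace X" "A \<noteq> {}"
  obtains m where "m \<in> A" "\<And>u. u \<in> A \<Longrightarrow> spec_le X m u \<Longrightarrow> u = m"
proof -
  have fin: "finite A" using assms finite_subset by blast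
  \<comment> \<open>Subtraction from the size of the whole space turns the largest minimal open set
    into a least value; it does not truncate, since minimal open sets lie inside the space.\<close>
  define m where "m = arg_min_on (\<lambda>u. card (topspace X) - card (min_open X u)) A"
  have m: "m \<in> A" unfolding m_def using fin assms(4) by (rule arg_min_if_finite)
  show ?thesis
  proof (rule that[OF m])
    fix u assume u: "u \<in> A" "spec_le X m u"
    then have sub: "min_open X m \<subseteq> min_open X u" by (intro min_open_mono)
    have fin_u: "min_open X u \<subseteq> topspace X" by (rule min_open_subset_topspace) (use u(1) assms(3) in auto)
    have "\<not> (\<exists>u\<in>A. card (topspace X) - card (min_open X u) < card (topspace X) - card (min_open X m))"
      unfolding m_def by (rule arg_min_if_finite(2)[OF fin assms(4)])
    then have "\<not> card (topspace X) - card (min_open X u) < card (topspace X) - card (min_open X m)"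
      using u(1) by blast
    moreover have "card (min_open X u) \<le> card (topspace X)" using fin_u assms(1) by (rule card_mono[rotated])
    ultimately have "card (min_open X u) \<le> card (min_open X m)" by linarith
    then have "min_open X m = min_open X u"
      using sub finite_subset[OF fin_u assms(1)] by (intro card_seteq)
    then have "spec_le X u m" by (simp add: spec_le_def min_open_refl)
    then show "u = m" using spec_le_antisym[OF assms(2)] u m assms(3) by blast
  qed
qed

text \<open>The hypothesis says that \<open>f\<close> is pointwise below \<open>g\<close>. The
  homotopy rests at \<open>f\<close> and jumps to \<open>g\<close> at time 1: the preimage of
  \<open>U\<close> is \<open>[0, 1)\<close> times the preimage under \<open>f\<close> together with
  \<open>[0, 1]\<close> times the smaller preimage under \<open>g\<close>, and \<open>[0, 1)\<close>
  is open in \<open>[0, 1]\<close>.\<close>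

lemma homotopic_with_if_specializes:
  assumes f: "continuous_map D E f" and g: "continuous_map D E g"
    and le: "\<And>U t. openin E U \<Longrightarrow> t \<in> topspace D \<Longrightarrow> g t \<in> U \<Longrightarrow> f t \<in> U"
  shows "homotopic_with (\<lambda>_. True) D E f g"
  unfolding homotopic_with_def
proof (intro exI conjI allI ballI)
  let ?h = "\<lambda>x. if fst x = (1::real) then g (snd x) else f (snd x)"
  show "continuous_map (prod_topology (top_of_set {0..1}) D) E ?h"
    unfolding continuous_map_def
  proof (intro conjI allI impI)
    show "?h \<in> topspace (prod_topology (top_of_set {0..1}) D) \<rightarrow> topspace E"
      using continuous_map_image_subset_topspace[OF f] continuous_map_image_subset_topspace[OF g]
      by (auto simp: image_subset_iff)
    fix U assume U: "openin E U"
    let ?F = "{t \<in> topspace D. f t \<in> U}" and ?G = "{t \<in> topspace D. g t \<in> U}"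
    have "{x \<in> topspace (prod_topology (top_of_set {0..1}) D). ?h x \<in> U} = {0..<1} \<times> ?F \<union> {0..1} \<times> ?G"
      using le[OF U] by auto
    moreover have "openin (top_of_set {0..1::real}) {0..<1}"
    proof -
      have "{0..<1::real} = {0..1} \<inter> {..<1}" by auto
      then show ?thesis by (metis open_lessThan openin_open_Int)
    qed
    then have "openin (prod_topology (top_of_set {0..1::real}) D) ({0..<1} \<times> ?F \<union> {0..1} \<times> ?G)"
      using openin_continuous_map_preimage[OF f U] openin_continuous_map_preimage[OF g U]
      by (intro openin_Un) (simp_all add: openin_prod_Times_iff)
    ultimately show "openin (prod_topology (top_of_set {0..1}) D) {x \<in> topspace (prod_topology (top_of_set {0..1}) D). ?h x \<in> U}"
      by simp
  qed
qed auto

text \<open>The identity is pointwise below the constant map at the maximum.\<close>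

lemma contractible_if_max:
  assumes "y \<in> topspace Y" "topspace Y \<subseteq> min_open Y y"
  shows "contractible_space Y"
proof -
  have "homotopic_with (\<lambda>_. True) Y Y id (\<lambda>_. y)"
  proof (rule homotopic_with_if_specializes)
    show "id t \<in> U" if "openin Y U" "t \<in> topspace Y" "y \<in> U" for U t
      using that assms(2) min_open_subset[OF that(1,3)] by auto
  qed (use assms in auto)
  then show ?thesis unfolding contractible_space_def by blast
qed

section \<open>The barycentric subdivision of a finite space\<close>

definition chains_of :: "'a topology \<Rightarrow> 'a set set" where
  "chains_of X = {\<sigma>. \<sigma> \<subseteq> topspace X \<and> \<sigma> \<noteq> {} \<and> (\<forall>u\<in>\<sigma>. \<forall>v\<in>\<sigma>. spec_le X u v \<or> spec_le X v u)}"

text \<open>The face poset of the order complex of \<open>X\<close>, with the down-set topology: the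
  minimal open set of a chain is the family of its non-empty subchains.\<close>

definition chain_space :: "'a topology \<Rightarrow> 'a set topology" where
  "chain_space X = topology (\<lambda>\<U>. \<U> \<subseteq> chains_of X \<and> (\<forall>\<sigma>\<in>\<U>. \<forall>\<rho>. \<rho> \<subseteq> \<sigma> \<longrightarrow> \<rho> \<noteq> {} \<longrightarrow> \<rho> \<in> \<U>))"

lemma chains_subset: "\<sigma> \<in> chains_of X \<Longrightarrow> \<rho> \<subseteq> \<sigma> \<Longrightarrow> \<rho> \<noteq> {} \<Longrightarrow> \<rho> \<in> chains_of X"
  unfolding chains_of_def by blast

lemma openin_chain_space:
  "openin (chain_space X) \<U> \<longleftrightarrow> \<U> \<subseteq> chains_of X \<and> (\<forall>\<sigma>\<in>\<U>. \<forall>\<rho>. \<rho> \<subseteq> \<sigma> \<longrightarrow> \<rho> \<noteq> {} \<longrightarrow> \<rho> \<in> \<U>)"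
proof -
  have "istopology (\<lambda>\<U>. \<U> \<subseteq> chains_of X \<and> (\<forall>\<sigma>\<in>\<U>. \<forall>\<rho>. \<rho> \<subseteq> \<sigma> \<longrightarrow> \<rho> \<noteq> {} \<longrightarrow> \<rho> \<in> \<U>))"
    unfolding istopology_def by blast
  then show ?thesis unfolding chain_space_def by (simp add: topology_inverse')
qed

lemma topspace_chain_space [simp]: "topspace (chain_space X) = chains_of X"
proof -
  have "openin (chain_space X) (chains_of X)"
    unfolding openin_chain_space by (auto intro: chains_subset)
  moreover have "topspace (chain_space X) \<subseteq> chains_of X"
    using openin_topspace[of "chain_space X"] unfolding openin_chain_space by blast
  ultimately show ?thesis by (meson openin_subset subset_antisym)
qed

lemma chains_subtopology:
  assumes "finite (topspace X)" "S \<subseteq> topspace X"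
  shows "chains_of (subtopology X S) = {\<sigma> \<in> chains_of X. \<sigma> \<subseteq> S}"
proof -
  have "(\<forall>u\<in>\<sigma>. \<forall>v\<in>\<sigma>. spec_le (subtopology X S) u v \<or> spec_le (subtopology X S) v u) \<longleftrightarrow>
      (\<forall>u\<in>\<sigma>. \<forall>v\<in>\<sigma>. spec_le X u v \<or> spec_le X v u)" if "\<sigma> \<subseteq> S" for \<sigma>
    using that spec_le_subtopology[OF assms] by (simp add: subset_iff)
  then have "(\<sigma> \<subseteq> S \<and> \<sigma> \<noteq> {} \<and> (\<forall>u\<in>\<sigma>. \<forall>v\<in>\<sigma>. spec_le (subtopology X S) u v \<or> spec_le (subtopology X S) v u)) \<longleftrightarrow>
      (\<sigma> \<subseteq> topspace X \<and> \<sigma> \<noteq> {} \<and> (\<forall>u\<in>\<sigma>. \<forall>v\<in>\<sigma>. spec_le X u v \<or> spec_le X v u)) \<and> \<sigma> \<subseteq> S" for \<sigma>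
    using assms(2) by (cases "\<sigma> \<subseteq> S") (simp_all add: subset_trans[of \<sigma> S])
  then show ?thesis
    unfolding chains_of_def topspace_subtopology_subset[OF assms(2)] by (simp only: mem_Collect_eq)
qed

text \<open>Subchains of a chain in \<open>S\<close> remain in \<open>S\<close>, whether or not
  \<open>S\<close> is open in \<open>X\<close>. This is what the passage to chains gains.\<close>

lemma openin_chains_in: "openin (chain_space X) {\<sigma> \<in> chains_of X. \<sigma> \<subseteq> S}"
  unfolding openin_chain_space using chains_subset by blast

lemma chain_space_subtopology:
  assumes "finite (topspace X)" "S \<subseteq> topspace X"
  shows "chain_space (subtopology X S) = subtopology (chain_space X) {\<sigma> \<in> chains_of X. \<sigma> \<subseteq> S}"
proof (rule topology_eq[THEN iffD2], rule allI)
  fix \<U>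
  have "openin (subtopology (chain_space X) {\<sigma> \<in> chains_of X. \<sigma> \<subseteq> S}) \<U> \<longleftrightarrow>
      openin (chain_space X) \<U> \<and> \<U> \<subseteq> {\<sigma> \<in> chains_of X. \<sigma> \<subseteq> S}"
    by (rule openin_open_subtopology) (rule openin_chains_in)
  also have "\<dots> \<longleftrightarrow> openin (chain_space (subtopology X S)) \<U>"
    unfolding openin_chain_space chains_subtopology[OF assms] by blast
  finally show "openin (chain_space (subtopology X S)) \<U> \<longleftrightarrow> openin (subtopology (chain_space X) {\<sigma> \<in> chains_of X. \<sigma> \<subseteq> S}) \<U>" ..
qed

text \<open>Adding the apex \<open>y\<close> keeps a chain a chain. The inclusions of
  \<open>\<sigma>\<close> and of \<open>{y}\<close> in \<open>insert y \<sigma>\<close> are two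
  pointwise comparisons, which join the identity to a constant map through
  \<open>insert y\<close>.\<close>

lemma contractible_chain_space_cone:
  assumes y: "y \<in> topspace Y" and cone: "\<And>z. z \<in> topspace Y \<Longrightarrow> spec_le Y z y \<or> spec_le Y y z"
  shows "contractible_space (chain_space Y)"
proof -
  let ?K = "chain_space Y"
  have ins: "insert y \<sigma> \<in> chains_of Y" if "\<sigma> \<in> chains_of Y" for \<sigma>
    using that y cone spec_le_refl[of Y y] unfolding chains_of_def by auto
  have yK: "{y} \<in> chains_of Y" using y spec_le_refl[of Y y] by (auto simp: chains_of_def)
  have cont: "continuous_map ?K ?K (insert y)"
    unfolding continuous_map_def
  proof (intro conjI allI impI)
    fix \<U> assume U: "openin ?K \<U>"
    show "openin ?K {\<sigma> \<in> topspace ?K. insert y \<sigma> \<in> \<U>}"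
      unfolding openin_chain_space
    proof (intro conjI ballI allI impI)
      fix \<sigma> \<rho> assume "\<sigma> \<in> {\<sigma> \<in> topspace ?K. insert y \<sigma> \<in> \<U>}" "\<rho> \<subseteq> \<sigma>" "\<rho> \<noteq> {}"
      moreover from this have "insert y \<rho> \<subseteq> insert y \<sigma>" by auto
      ultimately show "\<rho> \<in> {\<sigma> \<in> topspace ?K. insert y \<sigma> \<in> \<U>}"
        using U chains_subset[of \<sigma> Y \<rho>] unfolding openin_chain_space by auto
    qed auto
  qed (use ins in auto)
  have "homotopic_with (\<lambda>_. True) ?K ?K id (insert y)"
  proof (rule homotopic_with_if_specializes)
    show "id \<sigma> \<in> \<U>" if "openin ?K \<U>" "\<sigma> \<in> topspace ?K" "insert y \<sigma> \<in> \<U>" for \<U> \<sigma>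
      using that unfolding openin_chain_space by (auto simp: chains_of_def)
  qed (use cont in auto)
  moreover have "homotopic_with (\<lambda>_. True) ?K ?K (\<lambda>_. {y}) (insert y)"
  proof (rule homotopic_with_if_specializes)
    show "{y} \<in> \<U>" if "openin ?K \<U>" "\<sigma> \<in> topspace ?K" "insert y \<sigma> \<in> \<U>" for \<U> \<sigma>
      using that unfolding openin_chain_space by auto
  qed (use cont yK in auto)
  ultimately show ?thesis
    unfolding contractible_space_def by (meson homotopic_with_symD homotopic_with_trans)
qed

lemma fills_chain_space_cone:
  assumes "y \<in> topspace Y" "\<And>z. z \<in> topspace Y \<Longrightarrow> spec_le Y z y \<or> spec_le Y y z"
  shows "fills (chain_space Y)"
proof (rule contractible_imp_fills)
  have "{y} \<in> chains_of Y" using assms(1) spec_le_refl[of Y y] by (auto simp: chains_of_def)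
  then show "topspace (chain_space Y) \<noteq> {}" by auto
qed (rule contractible_chain_space_cone[OF assms])

definition chain_max :: "'a topology \<Rightarrow> 'a set \<Rightarrow> 'a" where
  "chain_max X \<sigma> = (THE m. m \<in> \<sigma> \<and> (\<forall>u\<in>\<sigma>. spec_le X u m))"

lemma chain_max_eqI:
  assumes "t0_space X" "\<sigma> \<in> chains_of X" "m \<in> \<sigma>" "\<And>u. u \<in> \<sigma> \<Longrightarrow> spec_le X u m"
  shows "chain_max X \<sigma> = m"
  unfolding chain_max_def
  using assms by (intro the_equality) (auto simp: chains_of_def intro: spec_le_antisym[OF assms(1)])

lemma chain_max:
  assumes "finite (topspace X)" "t0_space X" "\<sigma> \<in> chains_of X"
  shows "chain_max X \<sigma> \<in> \<sigma>" "\<And>u. u \<in> \<sigma> \<Longrightarrow> spec_le X u (chain_max X \<sigma>)"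
proof -
  have \<sigma>: "\<sigma> \<subseteq> topspace X" "\<sigma> \<noteq> {}" using assms(3) by (auto simp: chains_of_def)
  obtain m where m: "m \<in> \<sigma>" "\<And>u. u \<in> \<sigma> \<Longrightarrow> spec_le X m u \<Longrightarrow> u = m"
    using ex_spec_maximal[OF assms(1,2) \<sigma>] by blast
  have le: "spec_le X u m" if "u \<in> \<sigma>" for u
  proof -
    have "spec_le X u m \<or> spec_le X m u" using assms(3) m(1) that by (auto simp: chains_of_def)
    then show ?thesis using m(2)[OF that] spec_le_refl by metis
  qed
  then have "chain_max X \<sigma> = m" using chain_max_eqI[OF assms(2,3) m(1)] by blast
  then show "chain_max X \<sigma> \<in> \<sigma>" "\<And>u. u \<in> \<sigma> \<Longrightarrow> spec_le X u (chain_max X \<sigma>)" using m le by auto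
qed

text \<open>Open sets are down-sets. Consequently the preimage of an open set under the maximum map
  is the chain space of that set.\<close>

lemma chain_max_in_open_iff:
  assumes "finite (topspace X)" "t0_space X" "\<sigma> \<in> chains_of X" "openin X W"
  shows "chain_max X \<sigma> \<in> W \<longleftrightarrow> \<sigma> \<subseteq> W"
proof
  assume "chain_max X \<sigma> \<in> W"
  then have "min_open X (chain_max X \<sigma>) \<subseteq> W" by (rule min_open_subset[OF assms(4)])
  then show "\<sigma> \<subseteq> W" using chain_max(2)[OF assms(1-3)] by (auto simp: spec_le_def)
qed (use chain_max(1)[OF assms(1-3)] in auto)

lemma continuous_map_chain_max:
  assumes "finite (topspace X)" "t0_space X"
  shows "continuous_map (chain_space X) X (chain_max X)"
  unfolding continuous_map_def
proof (intro conjI allI impI)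
  show "chain_max X \<in> topspace (chain_space X) \<rightarrow> topspace X"
    using chain_max(1)[OF assms] by (auto simp: chains_of_def)
  fix W assume W: "openin X W"
  then have "{\<sigma> \<in> topspace (chain_space X). chain_max X \<sigma> \<in> W} = {\<sigma> \<in> chains_of X. \<sigma> \<subseteq> W}"
    using chain_max_in_open_iff[OF assms] by auto
  then show "openin (chain_space X) {\<sigma> \<in> topspace (chain_space X). chain_max X \<sigma> \<in> W}"
    by (simp add: openin_chains_in)
qed

text \<open>Over a minimal open set both sides fill: \<open>W\<close> has the maximum
  \<open>y\<close>, and its chains form a cone with apex \<open>y\<close>. Any other non-empty
  \<open>W\<close> is covered by the minimal open set of a maximal point \<open>w\<close> and by
  \<open>W - {w}\<close>; these and their intersection are smaller open sets, to which the induction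
  hypothesis applies.\<close>

lemma rel_lifting_chain_max_open:
  assumes X: "finite (topspace X)" "t0_space X" and "openin X W"
  shows "rel_lifting (chain_space X) (subtopology X W) (chain_max X)"
  using assms(3)
proof (induction "card W" arbitrary: W rule: less_induct)
  case less
  note W = less.prems
  have sub: "W \<subseteq> topspace X" using W by (rule openin_subset)
  have finW: "finite W" using sub X(1) finite_subset by blast
  have top: "topspace (subtopology X W) = W" using sub by auto
  consider "W = {}" | y where "y \<in> W" "W = min_open X y" | "W \<noteq> {}" "\<And>y. y \<in> W \<Longrightarrow> W \<noteq> min_open X y"
    by blast
  then show ?case
  proof cases
    case 1
    \<comment> \<open>The empty family covers the empty space.\<close>
    then show ?thesis by (auto intro: rel_lifting_glue[of "{}"])
  next
    case (2 y)
    have eq: "subtopology (chain_space X) {\<sigma> \<in> topspace (chain_space X). chain_max X \<sigma> \<in> topspace (subtopology X W)}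
        = chain_space (subtopology X W)"
      unfolding chain_space_subtopology[OF X(1) sub] top
      by (rule arg_cong[of _ _ "subtopology (chain_space X)"])
         (use chain_max_in_open_iff[OF X _ W] in auto)
    show ?thesis
    proof (rule rel_lifting_of_fills)
      have le: "spec_le (subtopology X W) z y" if "z \<in> W" for z
        using that 2 spec_le_subtopology[OF X(1) sub 2(1) that] by (simp add: spec_le_def)
      show "fills (subtopology (chain_space X) {\<sigma> \<in> topspace (chain_space X). chain_max X \<sigma> \<in> topspace (subtopology X W)})"
        unfolding eq by (rule fills_chain_space_cone[of y]) (use 2(1) top le in auto)
      show "fills (subtopology X W)"
      proof (intro contractible_imp_fills contractible_if_max[of y])
        show "topspace (subtopology X W) \<subseteq> min_open (subtopology X W) y"
          using le top by (auto simp: spec_le_def)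
      qed (use 2(1) top in auto)
      show "continuous_map (subtopology (chain_space X) {\<sigma> \<in> topspace (chain_space X). chain_max X \<sigma> \<in> topspace (subtopology X W)})
          (subtopology X W) (chain_max X)"
        using continuous_map_from_subtopology[OF continuous_map_chain_max[OF X]]
        by (auto simp: continuous_map_in_subtopology)
    qed
  next
    case 3
    obtain w where w: "w \<in> W" "\<And>u. u \<in> W \<Longrightarrow> spec_le X w u \<Longrightarrow> u = w"
      using ex_spec_maximal[OF X sub 3(1)] by blast
    let ?U = "min_open X w" and ?V = "W - {w}"
    have U: "openin X ?U" "?U \<subseteq> W" using openin_min_open[OF X(1)] w(1) sub min_open_subset[OF W] by auto
    \<comment> \<open>Removing a maximal point of a down-set leaves a down-set.\<close>
    have V: "openin X ?V"
      unfolding openin_iff_down_closed[OF X(1)]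
    proof (intro conjI ballI)
      fix u assume u: "u \<in> ?V"
      then have "w \<notin> min_open X u" using w(2)[of u] by (auto simp: spec_le_def)
      then show "min_open X u \<subseteq> ?V" using u min_open_subset[OF W] by auto
    qed (use sub in auto)
    have "?U \<noteq> W" using 3(2)[OF w(1)] by auto
    then have "?U \<subset> W" "?V \<subset> W" "?U \<inter> ?V \<subset> W" using U(2) w(1) by blast+
    then have cards: "card ?U < card W" "card ?V < card W" "card (?U \<inter> ?V) < card W"
      by (simp_all only: psubset_card_mono[OF finW])
    let ?\<V> = "{?U, ?V, ?U \<inter> ?V}"
    show ?thesis
    proof (rule rel_lifting_glue[of ?\<V>])
      show "topspace (subtopology X W) \<subseteq> \<Union>?\<V>" using min_open_refl[of w X] top by auto
      fix V assume V': "V \<in> ?\<V>"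
      then have "openin X V" "V \<subseteq> W" "card V < card W" using U V cards by auto
      then show "openin (subtopology X W) V" "rel_lifting (chain_space X) (subtopology (subtopology X W) V) (chain_max X)"
        using less.hyps[of V] W by (simp_all add: openin_open_subtopology subtopology_subtopology inf.absorb2)
      show "V \<inter> V2 \<in> ?\<V>" if "V2 \<in> ?\<V>" for V2
        using V' that by auto
    qed auto
  qed
qed

theorem rel_lifting_chain_max:
  assumes "finite (topspace X)" "t0_space X"
  shows "rel_lifting (chain_space X) X (chain_max X)"
  using rel_lifting_chain_max_open[OF assms openin_topspace] by simp

text \<open>The rim map is pushed to \<open>B\<close>, extended there, and the extension is lifted
  back relative to the rim. This moves weak contractibility against the direction of
  \<open>p\<close>, from the link to its chain space.\<close>

lemma fills_of_rel_lifting: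
  assumes lift: "rel_lifting E B p" and p: "continuous_map E B p" and B: "fills B"
  shows "fills E"
  unfolding fills_def
proof (intro allI impI)
  fix a b g
  assume c: "is_cell a b" and g: "cont_into (rim a b) E g"
  have "cont_into (rim a b) B (\<lambda>t. p (g t))" using continuous_map_compose[OF g p] by (simp add: o_def)
  then obtain f where f: "cont_into (cell a b) B f" "\<And>t. t \<in> rim a b \<Longrightarrow> f t = p (g t)"
    using fillsD[OF B c] by blast
  have "cont_into ({0..1::real} \<times> rim a b) B (\<lambda>x. f (snd x))"
    by (rule cont_into_compose[OF f(1)]) (use rim_subset_cell in \<open>auto intro!: continuous_intros\<close>)
  then show "\<exists>G. cont_into (cell a b) E G \<and> (\<forall>t\<in>rim a b. G t = g t)"
    using rel_liftingD[OF lift c f(1) g, of "\<lambda>x. f (snd x)"] f(2) by (metis snd_conv)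
qed

text \<open>A chain containing \<open>x\<close> lies in the star, since its elements are comparable
  with \<open>x\<close>; so the two families cover. Over chains avoiding \<open>x\<close>, and hence
  over the overlap, the target lies inside the source. Over chains in the star the target is a cone
  with apex \<open>x\<close>.\<close>

theorem rel_lifting_delete_point:
  assumes X: "finite (topspace X)" "t0_space X" and x: "x \<in> topspace X"
    and link: "fills (subtopology X (link X x))"
  shows "rel_lifting (chain_space (subtopology X (topspace X - {x}))) (chain_space X) (\<lambda>\<sigma>. \<sigma>)"
proof -
  let ?K = "chain_space X" and ?L = "chain_space (subtopology X (topspace X - {x}))"
  let ?V1 = "{\<sigma> \<in> chains_of X. \<sigma> \<subseteq> topspace X - {x}}" and ?V2 = "{\<sigma> \<in> chains_of X. \<sigma> \<subseteq> star X x}"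
  have L: "?L = subtopology ?K ?V1" by (rule chain_space_subtopology[OF X(1)]) auto
  have star: "star X x \<subseteq> topspace X"
    using min_open_subset_topspace[OF x] by (auto simp: star_def up_set_def)
  have link': "link X x \<subseteq> topspace X" using star by (auto simp: link_def)
  have comparable: "y \<in> star X x \<longleftrightarrow> y \<in> topspace X \<and> (spec_le X y x \<or> spec_le X x y)" for y
    using min_open_subset_topspace[OF x] by (auto simp: star_def up_set_def spec_le_def)
  have 1: "rel_lifting ?L (subtopology ?K V) (\<lambda>\<sigma>. \<sigma>)" if "V \<subseteq> ?V1" for V
  proof (rule rel_lifting_inclusion)
    show "topspace (subtopology ?K V) \<subseteq> topspace ?L" using that by (auto simp: L)
    show "subtopology ?K V = subtopology ?L (topspace (subtopology ?K V))"
      using that by (auto simp: L subtopology_subtopology intro!: arg_cong[of _ _ "subtopology ?K"])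
  qed
  have 2: "rel_lifting ?L (subtopology ?K ?V2) (\<lambda>\<sigma>. \<sigma>)"
  proof (rule rel_lifting_of_fills)
    \<comment> \<open>A chain in the star that avoids \<open>x\<close> is exactly a chain in the
      link.\<close>
    have eq: "subtopology ?L {\<sigma> \<in> topspace ?L. \<sigma> \<in> topspace (subtopology ?K ?V2)} = chain_space (subtopology X (link X x))"
      unfolding chain_space_subtopology[OF X(1) link'] L subtopology_subtopology
      by (rule arg_cong[of _ _ "subtopology ?K"]) (auto simp: link_def chains_of_def)
    have "fills (chain_space (subtopology X (link X x)))"
      by (rule fills_of_rel_lifting[OF rel_lifting_chain_max continuous_map_chain_max link])
         (use X link' in \<open>auto simp: t0_space_subtopology intro: finite_subset\<close>)
    then show "fills (subtopology ?L {\<sigma> \<in> topspace ?L. \<sigma> \<in> topspace (subtopology ?K ?V2)})"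
      by (simp only: eq)
    have xs: "x \<in> star X x" by (simp add: comparable x spec_le_refl)
    have "fills (chain_space (subtopology X (star X x)))"
    proof (rule fills_chain_space_cone[of x])
      show "x \<in> topspace (subtopology X (star X x))" using xs x by auto
      show "spec_le (subtopology X (star X x)) z x \<or> spec_le (subtopology X (star X x)) x z"
        if "z \<in> topspace (subtopology X (star X x))" for z
        using that comparable spec_le_subtopology[OF X(1) star] xs by auto
    qed
    then show "fills (subtopology ?K ?V2)" by (simp only: chain_space_subtopology[OF X(1) star])
    show "continuous_map (subtopology ?L {\<sigma> \<in> topspace ?L. \<sigma> \<in> topspace (subtopology ?K ?V2)}) (subtopology ?K ?V2) (\<lambda>\<sigma>. \<sigma>)"
      by (auto simp: L continuous_map_in_subtopology subtopology_subtopology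
          intro: continuous_map_from_subtopology[OF continuous_map_id[unfolded id_def]])
  qed
  show ?thesis
  proof (rule rel_lifting_glue[of "{?V1, ?V2, ?V1 \<inter> ?V2}"])
    show "topspace ?K \<subseteq> \<Union>{?V1, ?V2, ?V1 \<inter> ?V2}"
    proof
      fix \<sigma> assume \<sigma>: "\<sigma> \<in> topspace ?K"
      show "\<sigma> \<in> \<Union>{?V1, ?V2, ?V1 \<inter> ?V2}"
      proof (cases "x \<in> \<sigma>")
        case True
        then have "\<sigma> \<subseteq> star X x" using \<sigma> comparable by (auto simp: chains_of_def)
        then show ?thesis using \<sigma> by auto
      next
        case False
        then have "\<sigma> \<subseteq> topspace X - {x}" using \<sigma> by (auto simp: chains_of_def)
        then show ?thesis using \<sigma> by auto
      qed
    qed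
    show "openin ?K V" if "V \<in> {?V1, ?V2, ?V1 \<inter> ?V2}" for V
      using that openin_chains_in by (auto intro: openin_Int)
    show "rel_lifting ?L (subtopology ?K V) (\<lambda>\<sigma>. \<sigma>)" if "V \<in> {?V1, ?V2, ?V1 \<inter> ?V2}" for V
      using that 1[of V] 2 by blast
  qed auto
qed

section \<open>Homotopically trivial spaces\<close>

lemma continuous_map_cube_coord: "k < n \<Longrightarrow> continuous_map (cube n) euclideanreal (\<lambda>s. s k)"
  unfolding cube_def
  using continuous_map_product_projection[of k "{..<n}" "\<lambda>_. top_of_set {0..1::real}"]
  by (simp add: continuous_map_into_fulltopology)

lemma topspace_cube: "topspace (cube n) = ({..<n} \<rightarrow>\<^sub>E {0..1})"
  by (simp add: cube_def)

text \<open>Homotopy groups use functions that are \<open>undefined\<close> outside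
  \<open>{..<n}\<close>, boxes use full real sequences. A chart is a homeomorphism between the two
  formats that matches the rim with the boundary of the cube.\<close>

definition cube_chart :: "nat \<Rightarrow> (nat \<Rightarrow> real) \<Rightarrow> (nat \<Rightarrow> real) \<Rightarrow>
    ((nat \<Rightarrow> real) \<Rightarrow> nat \<Rightarrow> real) \<Rightarrow> ((nat \<Rightarrow> real) \<Rightarrow> nat \<Rightarrow> real) \<Rightarrow> bool" where
  "cube_chart n a b \<theta> \<eta> \<longleftrightarrow>
     continuous_map (top_of_set (cell a b)) (cube n) \<theta> \<and> continuous_map (cube n) (top_of_set (cell a b)) \<eta> \<and>
     (\<forall>t\<in>cell a b. \<eta> (\<theta> t) = t) \<and> (\<forall>s\<in>topspace (cube n). \<theta> (\<eta> s) = s) \<and>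
     (\<forall>t\<in>cell a b. \<theta> t \<in> cube_boundary n \<longleftrightarrow> t \<in> rim a b)"

lemma cube_boundary_subset: "cube_boundary n \<subseteq> topspace (cube n)"
  by (auto simp: cube_boundary_def)

text \<open>The non-degenerate coordinates are enumerated by \<open>e\<close> and each is rescaled
  to [0, 1]; the inverse puts the fixed values \<open>a i\<close> back on the degenerate
  ones.\<close>

lemma ex_cube_chart:
  assumes c: "is_cell a b" and n: "n = card {i. a i < b i}"
  obtains \<theta> \<eta> where "cube_chart n a b \<theta> \<eta>"
proof -
  define I where "I = {i. a i < b i}"
  have "finite I" using c by (simp add: is_cell_def I_def)
  then obtain e where e: "bij_betw e {..<n} I"
    using ex_bij_betw_nat_finite n by (auto simp: I_def atLeast0LessThan)
  define e' where "e' = inv_into {..<n} e"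
  have e1: "e k \<in> I" "a (e k) < b (e k)" "e' (e k) = k" if "k < n" for k
    using e that bij_betwE[OF e] by (auto simp: e'_def I_def bij_betw_inv_into_left)
  have e2: "e' i < n" "e (e' i) = i" if "i \<in> I" for i
    using e that bij_betw_inv_into[OF e] bij_betwE by (fastforce simp: e'_def bij_betw_inv_into_right)+
  have off: "t i = a i" if "t \<in> cell a b" "i \<notin> I" for t i
    using that c unfolding cell_def is_cell_def I_def mem_Collect_eq by (smt (verit))
  define \<theta> where "\<theta> = (\<lambda>t. restrict (\<lambda>k. (t (e k) - a (e k)) / (b (e k) - a (e k))) {..<n})"
  define \<eta> where "\<eta> = (\<lambda>s i. if i \<in> I then a i + (b i - a i) * s (e' i) else a i)"
  have range: "(t (e k) - a (e k)) / (b (e k) - a (e k)) \<in> {0..1}" if "t \<in> cell a b" "k < n" for t k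
    using e1(2)[OF that(2)] that(1) by (auto simp: cell_def divide_le_eq)
  show ?thesis
  proof (rule that[of \<theta> \<eta>], unfold cube_chart_def, intro conjI ballI)
    show "continuous_map (top_of_set (cell a b)) (cube n) \<theta>"
      unfolding cube_def continuous_map_componentwise
    proof (intro conjI ballI)
      show "\<theta> ` topspace (top_of_set (cell a b)) \<subseteq> extensional {..<n}" by (auto simp: \<theta>_def)
      fix k assume k: "k \<in> {..<n}"
      have "continuous_on (cell a b) (\<lambda>t. (t (e k) - a (e k)) / (b (e k) - a (e k)))"
        using e1(2)[of k] k by (intro continuous_intros) auto
      then have "continuous_on (cell a b) (\<lambda>t. \<theta> t k)" using k by (simp add: \<theta>_def)
      moreover have "\<theta> t k \<in> {0..1}" if "t \<in> cell a b" for t using range[OF that] k by (auto simp: \<theta>_def)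
      ultimately show "continuous_map (top_of_set (cell a b)) (top_of_set {0..1}) (\<lambda>t. \<theta> t k)"
        by auto
    qed
    show "continuous_map (cube n) (top_of_set (cell a b)) \<eta>"
      unfolding continuous_map_in_subtopology
    proof
      have "continuous_map (cube n) euclideanreal (\<lambda>s. \<eta> s i)" for i
        unfolding \<eta>_def using e2(1)[of i]
        by (cases "i \<in> I") (auto intro!: continuous_intros continuous_map_cube_coord)
      then have "continuous_map (cube n) (product_topology (\<lambda>_. euclidean) UNIV) \<eta>"
        by (simp add: continuous_map_componentwise_UNIV)
      then show "continuous_map (cube n) euclidean \<eta>" by (simp add: euclidean_product_topology)
      have "a i \<le> \<eta> s i \<and> \<eta> s i \<le> b i" if "s \<in> topspace (cube n)" for s i
      proof (cases "i \<in> I")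
        case True
        then have "0 \<le> s (e' i)" "s (e' i) \<le> 1" "a i < b i"
          using that e2(1) by (auto simp: topspace_cube I_def PiE_def Pi_def)
        then have "(b i - a i) * s (e' i) \<le> b i - a i" "0 \<le> (b i - a i) * s (e' i)"
          by (auto intro: mult_left_le)
        then show ?thesis using True by (simp add: \<eta>_def)
      qed (use c in \<open>simp add: \<eta>_def is_cell_def\<close>)
      then show "\<eta> \<in> topspace (cube n) \<rightarrow> cell a b" by (auto simp: cell_def)
    qed
    show "\<eta> (\<theta> t) = t" if "t \<in> cell a b" for t
      using e2 off[OF that] by (auto simp: \<theta>_def \<eta>_def I_def)
    show "\<theta> (\<eta> s) = s" if "s \<in> topspace (cube n)" for s
    proof
      fix k
      show "\<theta> (\<eta> s) k = s k"
      proof (cases "k < n")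
        case True
        have "b (e k) - a (e k) \<noteq> 0" using e1(2)[OF True] by simp
        then show ?thesis using True e1(1,3)[OF True] by (simp add: \<theta>_def \<eta>_def)
      next
        case False
        \<comment> \<open>Points of the cube are extensional, which is the value that
          \<open>restrict\<close> produces off \<open>{..<n}\<close>.\<close>
        then have "s k = undefined" using that by (intro PiE_arb[of s]) (auto simp: topspace_cube)
        then show ?thesis using False by (simp add: \<theta>_def)
      qed
    qed
    show "\<theta> t \<in> cube_boundary n \<longleftrightarrow> t \<in> rim a b" if t: "t \<in> cell a b" for t
    proof -
      have "\<theta> t \<in> topspace (cube n)" using range[OF t] by (auto simp: topspace_cube \<theta>_def)
      then have "\<theta> t \<in> cube_boundary n \<longleftrightarrow> (\<exists>k<n. t (e k) = a (e k) \<or> t (e k) = b (e k))"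
        using e1(2) by (force simp: cube_boundary_def \<theta>_def divide_eq_eq)
      also have "\<dots> \<longleftrightarrow> (\<exists>i\<in>I. t i = a i \<or> t i = b i)"
        using e1(1) e2 by metis
      finally show ?thesis using t by (auto simp: rim_def I_def)
    qed
  qed
qed

definition rim_homotopic :: "(nat \<Rightarrow> real) \<Rightarrow> (nat \<Rightarrow> real) \<Rightarrow> 'a topology \<Rightarrow> 'a
    \<Rightarrow> ((nat \<Rightarrow> real) \<Rightarrow> 'a) \<Rightarrow> ((nat \<Rightarrow> real) \<Rightarrow> 'a) \<Rightarrow> bool" where
  "rim_homotopic a b X c u v \<longleftrightarrow> (\<exists>h. cont_into ({0..1::real} \<times> cell a b) X h \<and>
     (\<forall>t\<in>cell a b. h (0, t) = u t \<and> h (1, t) = v t) \<and> (\<forall>t\<in>rim a b. \<forall>\<tau>\<in>{0..1}. h (\<tau>, t) = c))"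

lemma based_homotopy_iff:
  "(f, g) \<in> based_homotopy n X c \<longleftrightarrow>
    (\<exists>h. continuous_map (prod_topology (top_of_set {0..1::real}) (cube n)) X h \<and>
      (\<forall>s\<in>topspace (cube n). h (0, s) = f s \<and> h (1, s) = g s) \<and>
      (\<forall>s\<in>cube_boundary n. \<forall>\<tau>\<in>{0..1}. h (\<tau>, s) = c))"
proof -
  have "cube_boundary n \<subseteq> topspace (cube n)" by (auto simp: cube_boundary_def)
  then have "homotopic_with (\<lambda>h. h ` cube_boundary n \<subseteq> {c}) (cube n) X f g \<longleftrightarrow>
    (\<exists>h. continuous_map (prod_topology (top_of_set {0..1::real}) (cube n)) X h \<and>
      (\<forall>s\<in>topspace (cube n). h (0, s) = f s) \<and> (\<forall>s\<in>topspace (cube n). h (1, s) = g s) \<and>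
      (\<forall>\<tau>\<in>{0..1}. (\<lambda>s. h (\<tau>, s)) ` cube_boundary n \<subseteq> {c}))"
    by (intro homotopic_with) (simp add: image_subset_iff subset_iff)
  then show ?thesis unfolding based_homotopy_def by (simp add: image_subset_iff) blast
qed

context
  fixes n a b \<theta> \<eta>
  assumes chart: "cube_chart n a b \<theta> \<eta>"
begin

lemma
  shows chart_continuous: "continuous_map (top_of_set (cell a b)) (cube n) \<theta>"
    and chart_inv_continuous: "continuous_map (cube n) (top_of_set (cell a b)) \<eta>"
    and chart_inv: "\<And>t. t \<in> cell a b \<Longrightarrow> \<eta> (\<theta> t) = t" "\<And>s. s \<in> topspace (cube n) \<Longrightarrow> \<theta> (\<eta> s) = s"
    and chart_rim_iff: "\<And>t. t \<in> cell a b \<Longrightarrow> \<theta> t \<in> cube_boundary n \<longleftrightarrow> t \<in> rim a b"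
  using chart by (auto simp: cube_chart_def)

lemma chart_mem: "t \<in> cell a b \<Longrightarrow> \<theta> t \<in> topspace (cube n)"
  using continuous_map_image_subset_topspace[OF chart_continuous] by auto

lemma chart_inv_mem: "s \<in> topspace (cube n) \<Longrightarrow> \<eta> s \<in> cell a b"
  using continuous_map_image_subset_topspace[OF chart_inv_continuous] by auto

lemma chart_inv_rim: "s \<in> cube_boundary n \<Longrightarrow> \<eta> s \<in> rim a b"
  using chart_rim_iff[OF chart_inv_mem[of s]] chart_inv(2)[of s] cube_boundary_subset by auto

lemma chart_inv_on_rim: "t \<in> rim a b \<Longrightarrow> \<eta> (\<theta> t) = t"
  using chart_inv(1) rim_subset_cell by (metis subsetD)

lemma based_maps_iff_cell:
  "f \<in> based_maps n X x \<longleftrightarrow> cont_into (cell a b) X (\<lambda>t. f (\<theta> t)) \<and> (\<forall>t\<in>rim a b. f (\<theta> t) = x)"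
proof
  assume f: "f \<in> based_maps n X x"
  then have "cont_into (cell a b) X (f \<circ> \<theta>)" by (auto simp: based_maps_def intro: continuous_map_compose[OF chart_continuous])
  moreover have "f (\<theta> t) = x" if "t \<in> rim a b" for t
  proof -
    have "\<theta> t \<in> cube_boundary n" using that chart_rim_iff rim_subset_cell by blast
    then show ?thesis using f by (auto simp: based_maps_def)
  qed
  ultimately show "cont_into (cell a b) X (\<lambda>t. f (\<theta> t)) \<and> (\<forall>t\<in>rim a b. f (\<theta> t) = x)" by (simp add: o_def)
next
  assume f: "cont_into (cell a b) X (\<lambda>t. f (\<theta> t)) \<and> (\<forall>t\<in>rim a b. f (\<theta> t) = x)"
  have "continuous_map (cube n) X ((\<lambda>t. f (\<theta> t)) \<circ> \<eta>)" using f by (intro continuous_map_compose[OF chart_inv_continuous]) simp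
  then have "continuous_map (cube n) X f" by (rule continuous_map_eq) (simp add: chart_inv)
  moreover have "f s = x" if "s \<in> cube_boundary n" for s
    using f chart_inv_rim[OF that] chart_inv(2)[of s] that cube_boundary_subset by force
  ultimately show "f \<in> based_maps n X x" by (auto simp: based_maps_def)
qed

lemma based_homotopy_iff_cell:
  "(f, g) \<in> based_homotopy n X x \<longleftrightarrow> rim_homotopic a b X x (\<lambda>t. f (\<theta> t)) (\<lambda>t. g (\<theta> t))"
proof
  assume "(f, g) \<in> based_homotopy n X x"
  then obtain h where h: "continuous_map (prod_topology (top_of_set {0..1::real}) (cube n)) X h"
    "\<And>s. s \<in> topspace (cube n) \<Longrightarrow> h (0, s) = f s" "\<And>s. s \<in> topspace (cube n) \<Longrightarrow> h (1, s) = g s"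
    "\<And>s \<tau>. s \<in> cube_boundary n \<Longrightarrow> \<tau> \<in> {0..1} \<Longrightarrow> h (\<tau>, s) = x"
    unfolding based_homotopy_iff by auto
  have "continuous_map (prod_topology (top_of_set {0..1::real}) (top_of_set (cell a b)))
      (prod_topology (top_of_set {0..1::real}) (cube n)) (\<lambda>(\<tau>, t). (\<tau>, \<theta> t))"
    unfolding continuous_map_prod_top using chart_continuous by simp
  from continuous_map_compose[OF this h(1)]
  have "cont_into ({0..1::real} \<times> cell a b) X (\<lambda>y. h (fst y, \<theta> (snd y)))"
    by (simp add: o_def case_prod_beta)
  then show "rim_homotopic a b X x (\<lambda>t. f (\<theta> t)) (\<lambda>t. g (\<theta> t))"
    unfolding rim_homotopic_def using h(2-) chart_mem chart_rim_iff rim_subset_cell[of a b]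
    by (intro exI[of _ "\<lambda>y. h (fst y, \<theta> (snd y))"]) auto
next
  assume "rim_homotopic a b X x (\<lambda>t. f (\<theta> t)) (\<lambda>t. g (\<theta> t))"
  then obtain h where h: "cont_into ({0..1::real} \<times> cell a b) X h"
    "\<And>t. t \<in> cell a b \<Longrightarrow> h (0, t) = f (\<theta> t)" "\<And>t. t \<in> cell a b \<Longrightarrow> h (1, t) = g (\<theta> t)"
    "\<And>t \<tau>. t \<in> rim a b \<Longrightarrow> \<tau> \<in> {0..1} \<Longrightarrow> h (\<tau>, t) = x"
    unfolding rim_homotopic_def by auto
  have "continuous_map (prod_topology (top_of_set {0..1::real}) (cube n))
      (prod_topology (top_of_set {0..1::real}) (top_of_set (cell a b))) (\<lambda>(\<tau>, t). (\<tau>, \<eta> t))"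
    unfolding continuous_map_prod_top using chart_inv_continuous by simp
  from continuous_map_compose[OF this] h(1)
  have "continuous_map (prod_topology (top_of_set {0..1::real}) (cube n)) X (\<lambda>y. h (fst y, \<eta> (snd y)))"
    by (simp add: o_def case_prod_beta)
  then show "(f, g) \<in> based_homotopy n X x"
    unfolding based_homotopy_iff using h(2-) chart_inv_mem chart_inv_rim chart_inv(2)
    by (intro exI[of _ "\<lambda>y. h (fst y, \<eta> (snd y))"]) auto
qed

end

lemma homotopy_group_trivialD:
  assumes triv: "carrier (homotopy_group n X x) = {\<one>\<^bsub>homotopy_group n X x\<^esub>}" and f: "f \<in> based_maps n X x"
  shows "(f, \<lambda>_. x) \<in> based_homotopy n X x"
proof -
  have "based_homotopy n X x `` {f} \<in> carrier (homotopy_group n X x)"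
    using f by (simp add: homotopy_group_def quotientI)
  then have "based_homotopy n X x `` {f} = based_homotopy n X x `` {\<lambda>_. x}"
    using triv by (simp add: homotopy_group_def)
  moreover have "(f, f) \<in> based_homotopy n X x"
    using f by (simp add: based_homotopy_def based_maps_def)
  ultimately have "(\<lambda>_. x, f) \<in> based_homotopy n X x" by blast
  then show ?thesis by (simp add: based_homotopy_def homotopic_with_sym)
qed

text \<open>In dimension 0 the homotopy is a path from the single value of \<open>u\<close> to
  \<open>x\<close>. In positive dimension a chart turns \<open>u\<close> into a based map, whose
  class in the trivial homotopy group is that of the constant map.\<close>

lemma homotopically_trivial_rim_homotopic:
  fixes X :: "'a topology"
  assumes X: "homotopically_trivial X" and c: "is_cell a b" and x: "x \<in> topspace X"
    and u: "cont_into (cell a b) X u" "\<And>t. t \<in> rim a b \<Longrightarrow> u t = x"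
  shows "rim_homotopic a b X x u (\<lambda>_. x)"
proof (cases "{i. a i < b i} = {}")
  case True
  then have "rim a b = {}" by (auto simp: rim_def)
  have "b = a" using True c by (auto simp: is_cell_def not_less intro!: antisym le_funI)
  then have cell: "cell a b = {a}" by (auto simp: cell_def intro: antisym)
  have "u a \<in> topspace X" using continuous_map_image_subset_topspace[OF u(1)] cell by auto
  then obtain q where q: "pathin X q" "q 0 = u a" "q 1 = x"
    using X x unfolding homotopically_trivial_def path_connected_space_def by blast
  then have "cont_into ({0..1} \<times> cell a b) X (\<lambda>y. q (fst y))"
    unfolding pathin_def by (rule_tac cont_into_compose) (auto intro!: continuous_intros)
  then show ?thesis
    unfolding rim_homotopic_def using q cell \<open>rim a b = {}\<close> by (intro exI[of _ "\<lambda>y. q (fst y)"]) auto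
next
  case False
  define n where "n = card {i. a i < b i}"
  have "n \<ge> 1" using False c by (simp add: n_def is_cell_def Suc_le_eq card_gt_0_iff)
  obtain \<theta> \<eta> where chart: "cube_chart n a b \<theta> \<eta>" using ex_cube_chart[OF c n_def] .
  have "(\<lambda>s. u (\<eta> s)) \<in> based_maps n X x"
    unfolding based_maps_iff_cell[OF chart]
    using cont_into_eq[OF u(1), of "\<lambda>t. u (\<eta> (\<theta> t))"] u(2)
    by (simp add: chart_inv[OF chart] chart_inv_on_rim[OF chart])
  then have "(\<lambda>s. u (\<eta> s), \<lambda>_. x) \<in> based_homotopy n X x"
    using X x \<open>n \<ge> 1\<close> by (intro homotopy_group_trivialD) (auto simp: homotopically_trivial_def)
  then show ?thesis
    unfolding based_homotopy_iff_cell[OF chart] by (simp add: rim_homotopic_def chart_inv[OF chart])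
qed

section \<open>Filling rims in a homotopically trivial space\<close>

text \<open>In contrast to \<open>cylinder_as_box\<close>, no coordinate is added: the
  non-degenerate coordinate \<open>i\<close>, rescaled to [0, 1], becomes the time, and
  \<open>b0\<close> flattens the box in that direction.\<close>

lemma box_as_cylinder:
  assumes c: "is_cell a b" and i: "a i < b i"
  defines "b0 \<equiv> b(i := a i)"
  obtains \<phi> \<psi> where "is_cell a b0"
    "\<And>S. continuous_on S (\<phi> :: real \<times> (nat \<Rightarrow> real) \<Rightarrow> nat \<Rightarrow> real)" "\<And>S. continuous_on S \<psi>"
    "\<phi> ` cyl_rim a b0 \<subseteq> rim a b" "\<psi> ` rim a b \<subseteq> cyl_rim a b0" "\<psi> ` cell a b \<subseteq> {0..1} \<times> cell a b0"
    "\<And>t. t \<in> cell a b \<Longrightarrow> \<phi> (\<psi> t) = t"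
proof -
  let ?\<phi> = "\<lambda>x::real \<times> (nat \<Rightarrow> real). (snd x)(i := a i + fst x * (b i - a i))"
  let ?\<psi> = "\<lambda>t::nat \<Rightarrow> real. ((t i - a i) / (b i - a i), t(i := a i))"
  have "{j. a j < b0 j} \<subseteq> {j. a j < b j}" by (auto simp: b0_def)
  moreover have "finite {j. a j < b j}" using c by (simp add: is_cell_def)
  ultimately have "finite {j. a j < b0 j}" by (rule finite_subset)
  then have 1: "is_cell a b0" using c by (auto simp: is_cell_def b0_def)
  have 2: "continuous_on S ?\<phi>" for S by (intro continuous_on_fun_upd continuous_intros)
  have 3: "continuous_on S ?\<psi>" for S using i by (intro continuous_on_fun_upd continuous_intros) auto
  have cell: "t \<in> cell a b \<longleftrightarrow> a i \<le> t i \<and> t i \<le> b i \<and> t(i := a i) \<in> cell a b0" for t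
    unfolding cell_def b0_def mem_Collect_eq fun_upd_def by (smt (verit))
  have rim: "t \<in> rim a b \<longleftrightarrow> t \<in> cell a b \<and> (t i = a i \<or> t i = b i \<or> t(i := a i) \<in> rim a b0)" for t
    unfolding rim_def cell mem_Collect_eq using i by (auto simp: b0_def)
  have ti: "t i = a i" if "t \<in> cell a b0" for t
    using that unfolding cell_def b0_def mem_Collect_eq by (metis antisym fun_upd_same)
  have upd: "t(i := a i) = t" if "t \<in> cell a b0" for t using ti[OF that] by auto
  show ?thesis
  proof (rule that[OF 1 2 3])
    have \<tau>: "a i + \<tau> * (b i - a i) \<le> b i" "0 \<le> \<tau> * (b i - a i)" if "\<tau> \<in> {0..1}" for \<tau>
    proof -
      have "\<tau> * (b i - a i) \<le> b i - a i" using that i by (intro mult_left_le_one_le) auto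
      then show "a i + \<tau> * (b i - a i) \<le> b i" by linarith
      show "0 \<le> \<tau> * (b i - a i)" using that i by simp
    qed
    show "?\<phi> ` cyl_rim a b0 \<subseteq> rim a b"
    proof (rule image_subsetI)
      fix y assume y: "y \<in> cyl_rim a b0"
      then have "fst y \<in> {0..1}" "snd y \<in> cell a b0" using rim_subset_cell[of a b0] by (auto simp: cyl_rim_def)
      moreover from this have "(?\<phi> y)(i := a i) = snd y" using upd[of "snd y"] by simp
      ultimately have "?\<phi> y \<in> cell a b" unfolding cell using \<tau>[of "fst y"] by simp
      moreover have "?\<phi> y i = a i \<or> ?\<phi> y i = b i \<or> snd y \<in> rim a b0"
        using y by (auto simp: cyl_rim_def)
      ultimately show "?\<phi> y \<in> rim a b" unfolding rim using \<open>(?\<phi> y)(i := a i) = snd y\<close> by simp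
    qed
    show "?\<psi> ` cell a b \<subseteq> {0..1} \<times> cell a b0" using i by (auto simp: cell divide_le_eq)
    show "?\<psi> ` rim a b \<subseteq> cyl_rim a b0" using i by (auto simp: cyl_rim_def rim cell divide_le_eq)
    show "?\<phi> (?\<psi> t) = t" if "t \<in> cell a b" for t using i by auto
  qed
qed

text \<open>
  Bottom and sides form a contractible part of the rim of a cylinder, so a map on the rim can be
  deformed to one that is constant there; its restriction to the top then is a based map.
\<close>

lemma homotopically_trivial_fills_cylinder:
  assumes X: "homotopically_trivial X" and c: "is_cell a b" and g: "cont_into (cyl_rim a b) X g"
  obtains G where "cont_into ({0..1} \<times> cell a b) X G" "\<And>y. y \<in> cyl_rim a b \<Longrightarrow> G y = g y"
proof -
  let ?J = "{0::real} \<times> cell a b \<union> {0..1} \<times> rim a b" and ?T = "{1::real} \<times> cell a b"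
  \<comment> \<open>The straight-line contraction of the cylinder to the corner
    \<open>(0, a)\<close>, followed by the radial retraction onto floor and sides. On
    \<open>?J\<close> it is a contraction of \<open>?J\<close> within itself.\<close>
  define k where "k = (\<lambda>(s, y). cyl_retract a b ((1 - s) * fst y, \<lambda>i. (1 - s) * snd y i + s * a i))"
  define x where "x = g (0, a)"
  have a: "a \<in> cell a b" using c by (auto simp: cell_def is_cell_def)
  have J: "?J \<subseteq> cyl_rim a b" by (auto simp: cyl_rim_def)
  have Jcyl: "?J \<subseteq> {0..1} \<times> cell a b" using rim_subset_cell[of a b] by auto
  have "closed ?J" by (auto simp: closed_cell closed_rim[OF c] intro!: closed_Un closed_Times)
  have JT: "cyl_rim a b = ?T \<union> ?J" by (auto simp: cyl_rim_def)
  have move: "((1 - s) * fst y, \<lambda>i. (1 - s) * snd y i + s * a i) \<in> {0..1} \<times> cell a b"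
    if "s \<in> {0..1}" "y \<in> {0..1} \<times> cell a b" for s :: real and y
  proof -
    have "a i \<le> (1 - s) * snd y i + s * a i \<and> (1 - s) * snd y i + s * a i \<le> b i" for i
    proof -
      have y: "a i \<le> snd y i" "snd y i \<le> b i" using that(2) by (auto simp: cell_def)
      then have "0 \<le> (1 - s) * (snd y i - a i)" "(1 - s) * (snd y i - a i) \<le> snd y i - a i"
        using that(1) by (auto intro: mult_left_le_one_le)
      then show ?thesis using y by (simp add: algebra_simps)
    qed
    then show ?thesis using that by (auto simp: cell_def mult_le_one)
  qed
  have k_mem: "k (s, y) \<in> ?J" if "s \<in> {0..1}" "y \<in> {0..1} \<times> cell a b" for s y
    using move[OF that] cyl_retract_mem[OF c] by (auto simp: k_def)
  have k0: "k (0, y) = y" if "y \<in> ?J" for y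
    using that Jcyl cyl_retract_id[OF c, of "fst y" "snd y"] by (auto simp: k_def)
  have k1: "k (1, y) = (0, a)" for y
    using a cyl_retract_id[OF c, of 0 a] by (auto simp: k_def)
  have k_cont: "continuous_on ({0..1} \<times> ?J) k"
  proof -
    have coord: "continuous_on S (\<lambda>w :: real \<times> real \<times> (nat \<Rightarrow> real). snd (snd w) i)" for S i
      by (rule continuous_on_product_then_coordinatewise) (intro continuous_on_snd continuous_on_id)
    have "continuous_on ({0..1} \<times> ?J) (\<lambda>w :: real \<times> real \<times> (nat \<Rightarrow> real).
        ((1 - fst w) * fst (snd w), \<lambda>i. (1 - fst w) * snd (snd w) i + fst w * a i))"
      by (intro continuous_on_Pair continuous_on_coordinatewise_then_product continuous_on_add continuous_on_mult
          continuous_on_diff continuous_on_const continuous_on_fst continuous_on_snd continuous_on_id coord)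
    moreover have "(\<lambda>w :: real \<times> real \<times> (nat \<Rightarrow> real). ((1 - fst w) * fst (snd w), \<lambda>i. (1 - fst w) * snd (snd w) i + fst w * a i))
        ` ({0..1} \<times> ?J) \<subseteq> {0..1} \<times> cell a b"
    proof (rule image_subsetI)
      fix w assume "w \<in> {0..1::real} \<times> ?J"
      then have "fst w \<in> {0..1}" "snd w \<in> ?J" by (simp_all only: mem_Times_iff)
      then have "fst w \<in> {0..1}" "snd w \<in> {0..1} \<times> cell a b" using subsetD[OF Jcyl] by simp_all
      then show "((1 - fst w) * fst (snd w), \<lambda>i. (1 - fst w) * snd (snd w) i + fst w * a i) \<in> {0..1} \<times> cell a b"
        by (rule move)
    qed
    ultimately show ?thesis
      using continuous_on_compose2[OF continuous_on_cyl_retract[OF c, of "cell a b"]]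
      by (simp add: k_def case_prod_beta)
  qed
  have gk: "cont_into ({0..1} \<times> ?J) X (\<lambda>w. g (k w))"
  proof (rule cont_into_compose[OF g k_cont], rule image_subsetI)
    fix w assume "w \<in> {0..1::real} \<times> ?J"
    then have "k (fst w, snd w) \<in> ?J"
      by (intro k_mem subsetD[OF Jcyl]) (simp_all only: mem_Times_iff)
    then show "k w \<in> cyl_rim a b" using subsetD[OF J] by simp
  qed
  have x: "x \<in> topspace X" using continuous_map_image_subset_topspace[OF g] J a by (auto simp: x_def)
  have u: "cont_into (cell a b) X (\<lambda>t. g (1, t))"
    by (rule cont_into_compose[OF g]) (auto intro!: continuous_intros simp: cyl_rim_def)
  \<comment> \<open>The path of the rim of the top under the contraction; extended over the top, it
    ends at a map that is constantly \<open>x\<close> on the rim.\<close>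
  have h0: "cont_into ({0..1} \<times> rim a b) X (\<lambda>w. g (k (fst w, (1, snd w))))"
    by (rule cont_into_compose[OF gk]) (auto intro!: continuous_intros)
  obtain h where h: "cont_into ({0..1::real} \<times> cell a b) X h" "\<And>t. t \<in> cell a b \<Longrightarrow> h (0, t) = g (1, t)"
    "\<And>s t. s \<in> {0..1} \<Longrightarrow> t \<in> rim a b \<Longrightarrow> h (s, t) = g (k (s, (1, t)))"
    using homotopy_extension[OF c u h0] k0 by auto
  have "rim_homotopic a b X x (\<lambda>t. h (1, t)) (\<lambda>_. x)"
    using cont_into_homotopy_slice[OF h(1)] h(3) k1
    by (intro homotopically_trivial_rim_homotopic[OF X c x]) (auto simp: x_def)
  then obtain L where L: "cont_into ({0..1::real} \<times> cell a b) X L" "\<And>t. t \<in> cell a b \<Longrightarrow> L (0, t) = h (1, t)"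
    "\<And>t. t \<in> cell a b \<Longrightarrow> L (1, t) = x" "\<And>t s. t \<in> rim a b \<Longrightarrow> s \<in> {0..1} \<Longrightarrow> L (s, t) = x"
    unfolding rim_homotopic_def by auto
  have prod: "{0..1::real} \<times> cyl_rim a b = {0..1} \<times> ?T \<union> {0..1} \<times> ?J" by (auto simp: JT)
  \<comment> \<open>The null homotopy \<open>L\<close> run backwards on the top, with
    \<open>?J\<close> kept at \<open>x\<close>. It starts at the constant map, which extends over
    the cylinder, so the map at its end extends too.\<close>
  define H1 where "H1 = (\<lambda>w. if w \<in> {0..1::real} \<times> ?T then L (1 - fst w, snd (snd w)) else x)"
  have "cont_into ({0..1::real} \<times> ?T) X (\<lambda>w. L (1 - fst w, snd (snd w)))"
    by (rule cont_into_compose[OF L(1)]) (auto intro!: continuous_on_Pair continuous_on_diff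
          continuous_on_const continuous_on_fst continuous_on_snd continuous_on_id)
  then have H1: "cont_into ({0..1} \<times> cyl_rim a b) X H1"
    unfolding H1_def prod
    by (intro cont_into_paste) (use x L(4) \<open>closed ?J\<close> in \<open>auto simp: closed_Times closed_cell\<close>)
  have "H1 (0, y) = x" for y using L(3) by (auto simp: H1_def)
  moreover have "cont_into ({0..1} \<times> cell a b) X (\<lambda>_. x)" using x by simp
  ultimately obtain u1 where u1: "cont_into ({0..1} \<times> cell a b) X u1" "\<And>y. y \<in> cyl_rim a b \<Longrightarrow> u1 y = H1 (1, y)"
    using change_cyl_rim_values[OF c _ H1, of "\<lambda>_. x"] by blast
  \<comment> \<open>The contraction run backwards, \<open>h\<close> on the top and
    \<open>g \<circ> k\<close> on the rest. It leads from the end of \<open>H1\<close> back to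
    \<open>g\<close>.\<close>
  define H2 where "H2 = (\<lambda>w. if w \<in> {0..1::real} \<times> ?T then h (1 - fst w, snd (snd w)) else g (k (1 - fst w, snd w)))"
  have "cont_into ({0..1::real} \<times> ?T) X (\<lambda>w. h (1 - fst w, snd (snd w)))"
    by (rule cont_into_compose[OF h(1)]) (auto intro!: continuous_on_Pair continuous_on_diff
          continuous_on_const continuous_on_fst continuous_on_snd continuous_on_id)
  moreover have "cont_into ({0..1::real} \<times> ?J) X (\<lambda>w. g (k (1 - fst w, snd w)))"
    by (rule cont_into_compose[OF gk]) (auto intro!: continuous_on_Pair continuous_on_diff
          continuous_on_const continuous_on_fst continuous_on_snd continuous_on_id)
  ultimately have H2: "cont_into ({0..1} \<times> cyl_rim a b) X H2"
    unfolding H2_def prod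
    by (intro cont_into_paste) (use h(3) \<open>closed ?J\<close> in \<open>auto simp: closed_Times closed_cell\<close>)
  have "H2 (0, y) = u1 y" if "y \<in> cyl_rim a b" for y
    unfolding u1(2)[OF that] using that L(2) k1 by (auto simp: H1_def H2_def JT x_def)
  then obtain G where G: "cont_into ({0..1} \<times> cell a b) X G" "\<And>y. y \<in> cyl_rim a b \<Longrightarrow> G y = H2 (1, y)"
    using change_cyl_rim_values[OF c u1(1) H2] by blast
  have "G y = g y" if "y \<in> cyl_rim a b" for y
    unfolding G(2)[OF that] using that h(2) k0 by (auto simp: H2_def JT)
  with G(1) show ?thesis using that by blast
qed

text \<open>A point box is handled by non-emptiness; any other box is a cylinder over a box with one
  non-degenerate side fewer.\<close>

lemma homotopically_trivial_imp_fills: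
  assumes X: "homotopically_trivial X"
  shows "fills X"
  unfolding fills_def
proof (intro allI impI)
  fix a b g
  assume c: "is_cell a b" and g: "cont_into (rim a b) X g"
  show "\<exists>G. cont_into (cell a b) X G \<and> (\<forall>t\<in>rim a b. G t = g t)"
  proof (cases "\<exists>i. a i < b i")
    case False
    obtain x where "x \<in> topspace X" using X unfolding homotopically_trivial_def by blast
    then show ?thesis using False by (intro exI[of _ "\<lambda>_. x"]) (auto simp: rim_def)
  next
    case True
    then obtain i where i: "a i < b i" by blast
    obtain \<phi> \<psi> where cyl: "is_cell a (b(i := a i))"
      "\<And>S. continuous_on S (\<phi> :: real \<times> (nat \<Rightarrow> real) \<Rightarrow> nat \<Rightarrow> real)" "\<And>S. continuous_on S \<psi>"
      "\<phi> ` cyl_rim a (b(i := a i)) \<subseteq> rim a b" "\<psi> ` rim a b \<subseteq> cyl_rim a (b(i := a i))"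
      "\<psi> ` cell a b \<subseteq> {0..1} \<times> cell a (b(i := a i))" "\<And>t. t \<in> cell a b \<Longrightarrow> \<phi> (\<psi> t) = t"
      using box_as_cylinder[of a b i, OF c i] by metis
    have "cont_into (cyl_rim a (b(i := a i))) X (\<lambda>y. g (\<phi> y))"
      by (rule cont_into_compose[OF g cyl(2,4)])
    then obtain G where G: "cont_into ({0..1} \<times> cell a (b(i := a i))) X G"
      "\<And>y. y \<in> cyl_rim a (b(i := a i)) \<Longrightarrow> G y = g (\<phi> y)"
      using homotopically_trivial_fills_cylinder[OF X cyl(1)] by metis
    have "cont_into (cell a b) X (\<lambda>t. G (\<psi> t))"
      by (rule cont_into_compose[OF G(1) cyl(3,6)])
    moreover have "G (\<psi> t) = g t" if "t \<in> rim a b" for t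
    proof -
      have "\<psi> t \<in> cyl_rim a (b(i := a i))" "\<phi> (\<psi> t) = t" using that cyl(5,7) rim_subset_cell by blast+
      then show ?thesis using G(2) by simp
    qed
    ultimately show ?thesis by (intro exI[of _ "\<lambda>t. G (\<psi> t)"]) simp
  qed
qed

section \<open>Lifting and homotopy groups\<close>

definition unit_box_top :: "nat \<Rightarrow> nat \<Rightarrow> real" where
  "unit_box_top n = (\<lambda>i. if i < n then 1 else 0)"

lemma unit_box:
  "is_cell (\<lambda>_. 0) (unit_box_top n)" "n = card {i. (\<lambda>_. 0) i < unit_box_top n i}"
proof -
  have "{i. 0 < unit_box_top n i} = {..<n}" by (auto simp: unit_box_top_def)
  then show "is_cell (\<lambda>_. 0) (unit_box_top n)" "n = card {i. (\<lambda>_. 0) i < unit_box_top n i}"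
    by (auto simp: is_cell_def unit_box_top_def)
qed

text \<open>The square over the boundary commutes strictly, so the constant homotopy serves as rim
  data. Injectivity statements follow by prescribing the two ends of the cylinder.\<close>

lemma rel_lifting_cylinder:
  assumes lift: "rel_lifting E B p" and c: "is_cell a b"
    and f: "cont_into ({0..1} \<times> cell a b) B f" and g: "cont_into (cyl_rim a b) E g"
    and fg: "\<And>y. y \<in> cyl_rim a b \<Longrightarrow> f y = p (g y)"
  obtains G where "cont_into ({0..1} \<times> cell a b) E G" "\<And>y. y \<in> cyl_rim a b \<Longrightarrow> G y = g y"
proof -
  obtain a' b' \<phi> \<psi> where box: "is_cell a' b'"
    "\<And>S. continuous_on S (\<phi> :: real \<times> (nat \<Rightarrow> real) \<Rightarrow> nat \<Rightarrow> real)" "\<And>S. continuous_on S \<psi>"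
    "\<phi> ` ({0..1} \<times> cell a b) \<subseteq> cell a' b'" "\<psi> ` cell a' b' \<subseteq> {0..1} \<times> cell a b"
    "\<phi> ` cyl_rim a b \<subseteq> rim a' b'" "\<psi> ` rim a' b' \<subseteq> cyl_rim a b"
    "\<And>x. x \<in> {0..1} \<times> cell a b \<Longrightarrow> \<psi> (\<phi> x) = x"
    using cylinder_as_box[OF c] by metis
  have f': "cont_into (cell a' b') B (\<lambda>t. f (\<psi> t))"
    by (rule cont_into_compose[OF f box(3,5)])
  have g': "cont_into (rim a' b') E (\<lambda>t. g (\<psi> t))"
    by (rule cont_into_compose[OF g box(3,7)])
  have H: "cont_into ({0..1::real} \<times> rim a' b') B (\<lambda>y. f (\<psi> (snd y)))"
    by (rule cont_into_compose[OF f']) (use rim_subset_cell in \<open>auto intro!: continuous_on_snd continuous_on_id\<close>)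
  have eq: "f (\<psi> t) = p (g (\<psi> t))" if "t \<in> rim a' b'" for t
    using that box(7) by (intro fg) auto
  obtain G where G: "cont_into (cell a' b') E G" "\<And>t. t \<in> rim a' b' \<Longrightarrow> G t = g (\<psi> t)"
    by (rule rel_liftingD[OF lift box(1) f' g' H]) (auto simp: eq)
  show ?thesis
  proof (rule that[of "\<lambda>x. G (\<phi> x)"])
    show "cont_into ({0..1} \<times> cell a b) E (\<lambda>x. G (\<phi> x))"
      by (rule cont_into_compose[OF G(1) box(2,4)])
    show "G (\<phi> x) = g x" if "x \<in> cyl_rim a b" for x
    proof -
      have "x \<in> {0..1} \<times> cell a b" "\<phi> x \<in> rim a' b'" using that box(6) cyl_rim_subset by blast+
      then show ?thesis using G(2) box(8) by metis
    qed
  qed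
qed

text \<open>Surjectivity on homotopy classes: with the constant lift \<open>e\<close> and the
  constant homotopy at \<open>p e\<close> prescribed on the rim, both the lift and the homotopy come
  out based.\<close>

lemma rel_lifting_based_map:
  assumes lift: "rel_lifting E B p" and e: "e \<in> topspace E" and p: "continuous_map E B p"
    and f: "f \<in> based_maps n B (p e)"
  obtains g where "g \<in> based_maps n E e" "(f, p \<circ> g) \<in> based_homotopy n B (p e)"
proof -
  let ?a = "\<lambda>_::nat. 0::real" and ?b = "unit_box_top n"
  obtain \<theta> \<eta> where chart: "cube_chart n ?a ?b \<theta> \<eta>" using ex_cube_chart[OF unit_box] .
  have f': "cont_into (cell ?a ?b) B (\<lambda>t. f (\<theta> t))" "\<And>t. t \<in> rim ?a ?b \<Longrightarrow> f (\<theta> t) = p e"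
    using f unfolding based_maps_iff_cell[OF chart] by auto
  have "p e \<in> topspace B" using continuous_map_image_subset_topspace[OF p] e by auto
  then have H: "cont_into ({0..1::real} \<times> rim ?a ?b) B (\<lambda>_. p e)" by simp
  have g: "cont_into (rim ?a ?b) E (\<lambda>_. e)" using e by simp
  obtain G K where G: "cont_into (cell ?a ?b) E G" "\<And>t. t \<in> rim ?a ?b \<Longrightarrow> G t = e"
    and K: "cont_into ({0..1::real} \<times> cell ?a ?b) B K"
    "\<And>t. t \<in> cell ?a ?b \<Longrightarrow> K (0, t) = f (\<theta> t)" "\<And>t. t \<in> cell ?a ?b \<Longrightarrow> K (1, t) = p (G t)"
    "\<And>\<tau> t. \<tau> \<in> {0..1} \<Longrightarrow> t \<in> rim ?a ?b \<Longrightarrow> K (\<tau>, t) = p e"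
    by (rule rel_liftingD[OF lift unit_box(1) f'(1) g H]) (auto simp: f'(2))
  show ?thesis
  proof (rule that[of "\<lambda>s. G (\<eta> s)"])
    show "(\<lambda>s. G (\<eta> s)) \<in> based_maps n E e"
      unfolding based_maps_iff_cell[OF chart]
      using cont_into_eq[OF G(1), of "\<lambda>t. G (\<eta> (\<theta> t))"] G(2)
      by (simp add: chart_inv[OF chart] chart_inv_on_rim[OF chart])
    show "(f, p \<circ> (\<lambda>s. G (\<eta> s))) \<in> based_homotopy n B (p e)"
      unfolding based_homotopy_iff_cell[OF chart] rim_homotopic_def using K
      by (intro exI[of _ K]) (auto simp: chart_inv[OF chart])
  qed
qed

text \<open>Injectivity on homotopy classes: the homotopy in \<open>B\<close> is lifted over the
  cylinder with \<open>g1\<close> on the floor, \<open>g2\<close> on the top and \<open>e\<close> on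
  the sides.\<close>

lemma rel_lifting_based_homotopy:
  assumes lift: "rel_lifting E B p" and e: "e \<in> topspace E"
    and g: "g1 \<in> based_maps n E e" "g2 \<in> based_maps n E e"
    and hom: "(p \<circ> g1, p \<circ> g2) \<in> based_homotopy n B (p e)"
  shows "(g1, g2) \<in> based_homotopy n E e"
proof -
  let ?a = "\<lambda>_::nat. 0::real" and ?b = "unit_box_top n"
  let ?C = "cell ?a ?b" and ?R = "rim ?a ?b"
  obtain \<theta> \<eta> where chart: "cube_chart n ?a ?b \<theta> \<eta>" using ex_cube_chart[OF unit_box] .
  have g1: "cont_into ?C E (\<lambda>t. g1 (\<theta> t))" "\<And>t. t \<in> ?R \<Longrightarrow> g1 (\<theta> t) = e"
    and g2: "cont_into ?C E (\<lambda>t. g2 (\<theta> t))" "\<And>t. t \<in> ?R \<Longrightarrow> g2 (\<theta> t) = e"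
    using g unfolding based_maps_iff_cell[OF chart] by auto
  obtain h where h: "cont_into ({0..1::real} \<times> ?C) B h"
    "\<And>t. t \<in> ?C \<Longrightarrow> h (0, t) = p (g1 (\<theta> t))" "\<And>t. t \<in> ?C \<Longrightarrow> h (1, t) = p (g2 (\<theta> t))"
    "\<And>t \<tau>. t \<in> ?R \<Longrightarrow> \<tau> \<in> {0..1} \<Longrightarrow> h (\<tau>, t) = p e"
    using hom unfolding based_homotopy_iff_cell[OF chart] rim_homotopic_def o_apply by blast
  define \<gamma> where "\<gamma> = (\<lambda>y. if y \<in> {0..1::real} \<times> ?R then e
    else if y \<in> {0} \<times> ?C then g1 (\<theta> (snd y)) else g2 (\<theta> (snd y)))"
  have ends: "cont_into ({0::real} \<times> ?C) E (\<lambda>y. g1 (\<theta> (snd y)))" "cont_into ({1::real} \<times> ?C) E (\<lambda>y. g2 (\<theta> (snd y)))"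
    by (rule cont_into_compose[OF g1(1)] cont_into_compose[OF g2(1)]; auto intro!: continuous_on_snd continuous_on_id)+
  then have "cont_into ({0} \<times> ?C \<union> {1} \<times> ?C) E
      (\<lambda>y::real \<times> (nat \<Rightarrow> real). if y \<in> {0} \<times> ?C then g1 (\<theta> (snd y)) else g2 (\<theta> (snd y)))"
    by (intro cont_into_paste) (auto simp: closed_cell closed_Times)
  moreover have "cont_into ({0..1::real} \<times> ?R) E (\<lambda>_. e)" using e by simp
  ultimately have "cont_into ({0..1} \<times> ?R \<union> ({0} \<times> ?C \<union> {1} \<times> ?C)) E \<gamma>"
    unfolding \<gamma>_def
    by (intro cont_into_paste ends) (auto simp: closed_cell closed_rim[OF unit_box(1)] closed_Times g1(2) g2(2))
  moreover have "{0..1} \<times> ?R \<union> ({0} \<times> ?C \<union> {1} \<times> ?C) = cyl_rim ?a ?b"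
    by (auto simp: cyl_rim_def)
  ultimately have \<gamma>: "cont_into (cyl_rim ?a ?b) E \<gamma>" by simp
  have "h y = p (\<gamma> y)" if "y \<in> cyl_rim ?a ?b" for y
    using that h(2-4) by (auto simp: cyl_rim_def \<gamma>_def)
  then obtain G where G: "cont_into ({0..1} \<times> ?C) E G" "\<And>y. y \<in> cyl_rim ?a ?b \<Longrightarrow> G y = \<gamma> y"
    using rel_lifting_cylinder[OF lift unit_box(1) h(1) \<gamma>] by blast
  show ?thesis
    unfolding based_homotopy_iff_cell[OF chart] rim_homotopic_def
    using G(1) by (intro exI[of _ G]) (auto simp: G(2) cyl_rim_def \<gamma>_def g1(2) g2(2))
qed

lemma point_box: "is_cell a a" "cell a a = {a}" "rim a a = {}"
  by (auto simp: is_cell_def cell_def rim_def intro: antisym)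

text \<open>Lifting over a point box; its rim is empty, so \<open>undefined\<close> is acceptable
  rim data. The resulting homotopy is the required path.\<close>

lemma rel_lifting_path_component_surj:
  assumes lift: "rel_lifting E B p" and b: "b \<in> topspace B"
  obtains e where "e \<in> topspace E" "path_component_of B (p e) b"
proof -
  let ?a = "\<lambda>_::nat. 0::real"
  have 1: "cont_into (cell ?a ?a) B (\<lambda>_. b)" using b by simp
  have 2: "cont_into (rim ?a ?a) E (\<lambda>_. undefined)" "cont_into ({0..1::real} \<times> rim ?a ?a) B (\<lambda>_. undefined)"
    by (simp_all add: point_box)
  obtain G K where G: "cont_into (cell ?a ?a) E G" and K: "cont_into ({0..1::real} \<times> cell ?a ?a) B K"
    "\<And>t. t \<in> cell ?a ?a \<Longrightarrow> K (0, t) = b" "\<And>t. t \<in> cell ?a ?a \<Longrightarrow> K (1, t) = p (G t)"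
    by (rule rel_liftingD[OF lift point_box(1) 1 2]) (simp_all add: point_box)
  have "cont_into {0..1} B (\<lambda>\<tau>. K (\<tau>, ?a))"
    by (rule cont_into_compose[OF K(1)]) (auto intro!: continuous_on_Pair continuous_on_id continuous_on_const simp: point_box)
  then have "path_component_of B b (p (G ?a))"
    unfolding path_component_of_def pathin_def using K(2,3)[of ?a] by (auto simp: point_box)
  moreover have "G ?a \<in> topspace E" using continuous_map_image_subset_topspace[OF G] by (simp add: point_box)
  ultimately show ?thesis using that path_component_of_sym by metis
qed

text \<open>The cylinder over a point box is an interval, with boundary its two ends.\<close>

lemma rel_lifting_path_component_inj:
  assumes lift: "rel_lifting E B p" and e: "e1 \<in> topspace E" "e2 \<in> topspace E"
    and path: "path_component_of B (p e1) (p e2)"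
  shows "path_component_of E e1 e2"
proof -
  let ?a = "\<lambda>_::nat. 0::real"
  obtain q where q: "cont_into {0..1::real} B q" "q 0 = p e1" "q 1 = p e2"
    using path by (auto simp: path_component_of_def pathin_def)
  have cr: "cyl_rim ?a ?a = {(0, ?a)} \<union> {(1, ?a)}" by (auto simp: cyl_rim_def point_box)
  have f: "cont_into ({0..1} \<times> cell ?a ?a) B (\<lambda>y. q (fst y))"
    by (rule cont_into_compose[OF q(1)]) (auto intro!: continuous_on_fst continuous_on_id)
  have g: "cont_into (cyl_rim ?a ?a) E (\<lambda>y. if y \<in> {(0, ?a)} then e1 else e2)"
    unfolding cr by (rule cont_into_paste) (use e in auto)
  have "q (fst y) = p (if y \<in> {(0, ?a)} then e1 else e2)" if "y \<in> cyl_rim ?a ?a" for y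
    using that q by (auto simp: cr)
  from rel_lifting_cylinder[OF lift point_box(1) f g this]
  obtain G where G: "cont_into ({0..1} \<times> cell ?a ?a) E G"
    "\<And>y. y \<in> cyl_rim ?a ?a \<Longrightarrow> G y = (if y \<in> {(0, ?a)} then e1 else e2)" by blast
  have "cont_into {0..1} E (\<lambda>\<tau>. G (\<tau>, ?a))"
    by (rule cont_into_compose[OF G(1)]) (auto intro!: continuous_on_Pair continuous_on_id continuous_on_const simp: point_box)
  then show ?thesis
    unfolding path_component_of_def pathin_def using G(2) by (intro exI[of _ "\<lambda>\<tau>. G (\<tau>, ?a)"]) (auto simp: cr)
qed

section \<open>Homotopy classes of based maps and the product on them\<close>

lemma based_homotopy_refl: "f \<in> based_maps n X a \<Longrightarrow> (f, f) \<in> based_homotopy n X a"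
  by (simp add: based_homotopy_def based_maps_def)

lemma based_homotopy_sym: "(f, g) \<in> based_homotopy n X a \<Longrightarrow> (g, f) \<in> based_homotopy n X a"
  by (simp add: based_homotopy_def homotopic_with_sym)

lemma based_homotopy_trans:
  "(f, g) \<in> based_homotopy n X a \<Longrightarrow> (g, h) \<in> based_homotopy n X a \<Longrightarrow> (f, h) \<in> based_homotopy n X a"
  unfolding based_homotopy_def by (blast intro: homotopic_with_trans)

lemma based_homotopy_imp_based_maps:
  assumes "(f, g) \<in> based_homotopy n X a"
  shows "f \<in> based_maps n X a" "g \<in> based_maps n X a"
proof -
  have "homotopic_with (\<lambda>h. h ` cube_boundary n \<subseteq> {a}) (cube n) X f g"
    using assms by (simp add: based_homotopy_def)
  from homotopic_with_imp_continuous_maps[OF this] homotopic_with_imp_property[OF this]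
  show "f \<in> based_maps n X a" "g \<in> based_maps n X a" by (simp_all add: based_maps_def)
qed

lemma based_homotopy_class_eq:
  assumes "f \<in> based_maps n X a"
  shows "based_homotopy n X a `` {f} = based_homotopy n X a `` {g} \<longleftrightarrow> (f, g) \<in> based_homotopy n X a"
proof
  assume eq: "based_homotopy n X a `` {f} = based_homotopy n X a `` {g}"
  have "f \<in> based_homotopy n X a `` {f}" using based_homotopy_refl[OF assms] by simp
  then have "(g, f) \<in> based_homotopy n X a" unfolding eq by simp
  then show "(f, g) \<in> based_homotopy n X a" by (rule based_homotopy_sym)
next
  assume fg: "(f, g) \<in> based_homotopy n X a"
  show "based_homotopy n X a `` {f} = based_homotopy n X a `` {g}"
    using based_homotopy_trans[OF fg] based_homotopy_trans[OF based_homotopy_sym[OF fg]] by auto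
qed

lemma based_homotopy_cong:
  assumes "(f, g) \<in> based_homotopy n X a" "\<And>s. s \<in> topspace (cube n) \<Longrightarrow> f' s = f s"
    "\<And>s. s \<in> topspace (cube n) \<Longrightarrow> g' s = g s"
  shows "(f', g') \<in> based_homotopy n X a"
  using assms unfolding based_homotopy_iff by simp

lemma based_homotopy_compose:
  assumes "(f, g) \<in> based_homotopy n X a" "continuous_map X Y p"
  shows "(p \<circ> f, p \<circ> g) \<in> based_homotopy n Y (p a)"
proof -
  have "homotopic_with (\<lambda>h. h ` cube_boundary n \<subseteq> {a}) (cube n) X f g"
    using assms(1) by (simp add: based_homotopy_def)
  then have "homotopic_with (\<lambda>h. h ` cube_boundary n \<subseteq> {p a}) (cube n) Y (p \<circ> f) (p \<circ> g)"
    by (rule homotopic_with_compose_continuous_map_left[OF _ assms(2)]) (auto simp: image_subset_iff)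
  then show ?thesis by (simp add: based_homotopy_def)
qed

lemma based_maps_compose:
  "f \<in> based_maps n X a \<Longrightarrow> continuous_map X Y p \<Longrightarrow> p \<circ> f \<in> based_maps n Y (p a)"
  by (auto simp: based_maps_def intro: continuous_map_compose)

lemma continuous_map_cube_upd:
  assumes "continuous_map Z (cube n) \<sigma>" "continuous_map Z euclideanreal r" "\<And>z. z \<in> topspace Z \<Longrightarrow> r z \<in> {0..1}" "0 < n"
  shows "continuous_map Z (cube n) (\<lambda>z. (\<sigma> z)(0 := r z))"
proof -
  have \<sigma>: "\<sigma> ` topspace Z \<subseteq> extensional {..<n}" "\<And>k. k < n \<Longrightarrow> continuous_map Z (top_of_set {0..1}) (\<lambda>z. \<sigma> z k)"
    using assms(1) unfolding cube_def continuous_map_componentwise by auto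
  show ?thesis
    unfolding cube_def continuous_map_componentwise
  proof (intro conjI ballI)
    show "(\<lambda>z. (\<sigma> z)(0 := r z)) ` topspace Z \<subseteq> extensional {..<n}"
      using \<sigma>(1) assms(4) by (auto simp: extensional_def image_subset_iff)
    fix k assume "k \<in> {..<n}"
    moreover have "continuous_map Z (top_of_set {0..1}) r"
      using assms(2,3) by (auto simp: continuous_map_in_subtopology)
    ultimately show "continuous_map Z (top_of_set {0..1}) (\<lambda>z. ((\<sigma> z)(0 := r z)) k)"
      using \<sigma>(2) by (cases "k = 0") auto
  qed
qed

text \<open>The homotopies are concatenated at each time. Applied to reflexive homotopies, the
  statement also shows that a concatenation of based maps is based.\<close>

lemma based_homotopy_concat:
  assumes n: "n \<ge> 1" and f: "(f, f') \<in> based_homotopy n X a" and g: "(g, g') \<in> based_homotopy n X a"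
  shows "(cube_concat f g, cube_concat f' g') \<in> based_homotopy n X a"
proof -
  let ?I = "top_of_set {0..1::real}" and ?Z = "prod_topology (top_of_set {0..1::real}) (cube n)"
  obtain h where h: "continuous_map ?Z X h" "\<And>s. s \<in> topspace (cube n) \<Longrightarrow> h (0, s) = f s \<and> h (1, s) = f' s"
      "\<And>s \<tau>. s \<in> cube_boundary n \<Longrightarrow> \<tau> \<in> {0..1} \<Longrightarrow> h (\<tau>, s) = a"
    using f unfolding based_homotopy_iff by blast
  obtain k where k: "continuous_map ?Z X k" "\<And>s. s \<in> topspace (cube n) \<Longrightarrow> k (0, s) = g s \<and> k (1, s) = g' s"
      "\<And>s \<tau>. s \<in> cube_boundary n \<Longrightarrow> \<tau> \<in> {0..1} \<Longrightarrow> k (\<tau>, s) = a"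
    using g unfolding based_homotopy_iff by blast
  let ?l = "\<lambda>s::nat \<Rightarrow> real. s(0 := 2 * s 0)" and ?r = "\<lambda>s::nat \<Rightarrow> real. s(0 := 2 * s 0 - 1)"
  have s0: "0 \<le> s 0" "s 0 \<le> 1" if "s \<in> topspace (cube n)" for s
    using that n by (auto simp: topspace_cube PiE_def Pi_def)
  have l_mem: "?l s \<in> topspace (cube n)" if "s \<in> topspace (cube n)" "s 0 \<le> 1/2" for s
    using that n s0[OF that(1)] by (auto simp: topspace_cube PiE_def Pi_def extensional_def)
  have r_mem: "?r s \<in> topspace (cube n)" if "s \<in> topspace (cube n)" "\<not> s 0 \<le> 1/2" for s
    using that n s0[OF that(1)] by (auto simp: topspace_cube PiE_def Pi_def extensional_def)
  define H where "H = (\<lambda>y. if snd y 0 \<le> 1/2 then h (fst y, ?l (snd y)) else k (fst y, ?r (snd y)))"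
  have coord: "continuous_map (subtopology ?Z S) euclideanreal (\<lambda>y. snd y 0)" for S
    using continuous_map_compose[OF continuous_map_snd continuous_map_cube_coord[of 0 n], of ?I] n
    by (auto simp: o_def intro: continuous_map_from_subtopology)
  have fst_snd: "continuous_map (subtopology ?Z S) ?I fst" "continuous_map (subtopology ?Z S) (cube n) snd" for S
    by (auto intro: continuous_map_from_subtopology continuous_map_fst continuous_map_snd)
  have "continuous_map ?Z X H"
    unfolding H_def
  proof (rule continuous_map_cases_le)
    show "continuous_map ?Z euclideanreal (\<lambda>y. snd y 0)" using coord[of UNIV] by simp
    show "continuous_map ?Z euclideanreal (\<lambda>_. 1 / 2)" by simp
    let ?S = "{y \<in> topspace ?Z. snd y 0 \<le> 1/2}" and ?T = "{y \<in> topspace ?Z. 1/2 \<le> snd y 0}"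
    have "continuous_map (subtopology ?Z ?S) (cube n) (\<lambda>y. ?l (snd y))"
      by (rule continuous_map_cube_upd[OF fst_snd(2)])
         (use n s0 coord in \<open>auto intro!: continuous_intros\<close>)
    then have "continuous_map (subtopology ?Z ?S) ?Z (\<lambda>y. (fst y, ?l (snd y)))"
      using fst_snd(1) by (simp add: continuous_map_paired)
    from continuous_map_compose[OF this h(1)]
    show "continuous_map (subtopology ?Z ?S) X (\<lambda>y. h (fst y, ?l (snd y)))" by (simp add: o_def)
    have "continuous_map (subtopology ?Z ?T) (cube n) (\<lambda>y. ?r (snd y))"
      by (rule continuous_map_cube_upd[OF fst_snd(2)])
         (use n s0 coord in \<open>auto intro!: continuous_intros\<close>)
    then have "continuous_map (subtopology ?Z ?T) ?Z (\<lambda>y. (fst y, ?r (snd y)))"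
      using fst_snd(1) by (simp add: continuous_map_paired)
    from continuous_map_compose[OF this k(1)]
    show "continuous_map (subtopology ?Z ?T) X (\<lambda>y. k (fst y, ?r (snd y)))" by (simp add: o_def)
    fix y assume y: "y \<in> topspace ?Z" "snd y 0 = 1/2"
    then have "snd y \<in> topspace (cube n)" "fst y \<in> {0..1}" by auto
    \<comment> \<open>At the seam coordinate 0 becomes 1 on the left and 0 on the right, so both
      values are the base point.\<close>
    then have "?l (snd y) \<in> cube_boundary n" "?r (snd y) \<in> cube_boundary n"
      using y(2) n l_mem[of "snd y"] by (auto simp: cube_boundary_def topspace_cube PiE_def Pi_def extensional_def intro!: exI[of _ 0])
    then show "h (fst y, ?l (snd y)) = k (fst y, ?r (snd y))" using h(3) k(3) \<open>fst y \<in> {0..1}\<close> by simp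
  qed
  moreover have "H (0, s) = cube_concat f g s \<and> H (1, s) = cube_concat f' g' s" if "s \<in> topspace (cube n)" for s
    using h(2)[OF l_mem] k(2)[OF r_mem] that by (simp add: H_def cube_concat_def)
  moreover have "H (\<tau>, s) = a" if s: "s \<in> cube_boundary n" and \<tau>: "\<tau> \<in> {0..1}" for s \<tau>
  proof -
    have mem: "s \<in> topspace (cube n)" and "\<exists>i<n. s i = 0 \<or> s i = 1" using s by (auto simp: cube_boundary_def)
    then obtain i where i: "i < n" "s i = 0 \<or> s i = 1" by blast
    show ?thesis
    proof (cases "s 0 \<le> 1/2")
      case True
      then have "?l s i = 0 \<or> ?l s i = 1" using i(2) by (cases "i = 0") auto
      then have "?l s \<in> cube_boundary n" unfolding cube_boundary_def using l_mem[OF mem True] i(1) by blast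
      then show ?thesis using h(3) True \<tau> by (simp add: H_def)
    next
      case False
      then have "?r s i = 0 \<or> ?r s i = 1" using i(2) by (cases "i = 0") auto
      then have "?r s \<in> cube_boundary n" unfolding cube_boundary_def using r_mem[OF mem False] i(1) by blast
      then show ?thesis using k(3) False \<tau> by (simp add: H_def)
    qed
  qed
  ultimately show ?thesis unfolding based_homotopy_iff by blast
qed

lemma carrier_homotopy_group:
  "A \<in> carrier (homotopy_group n X a) \<longleftrightarrow> (\<exists>f\<in>based_maps n X a. A = based_homotopy n X a `` {f})"
  by (auto simp: homotopy_group_def quotient_def)

text \<open>All concatenations of representatives lie in one class, so the union defining the
  product is a union of equal sets; it is non-empty because \<open>f\<close> and \<open>g\<close>
  belong to their own classes.\<close>

lemma homotopy_group_mult_class: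
  assumes "n \<ge> 1" "f \<in> based_maps n X a" "g \<in> based_maps n X a"
  shows "based_homotopy n X a `` {f} \<otimes>\<^bsub>homotopy_group n X a\<^esub> based_homotopy n X a `` {g}
    = based_homotopy n X a `` {cube_concat f g}"
proof -
  let ?b = "based_homotopy n X a"
  have same: "?b `` {cube_concat f' g'} = ?b `` {cube_concat f g}" if "f' \<in> ?b `` {f}" "g' \<in> ?b `` {g}" for f' g'
  proof -
    have "(f, f') \<in> ?b" "(g, g') \<in> ?b" using that by simp_all
    note concat = based_homotopy_concat[OF assms(1) this]
    show ?thesis
      by (rule based_homotopy_class_eq[OF based_homotopy_imp_based_maps(1)[OF concat], THEN iffD2, OF concat, symmetric])
  qed
  have mem: "f \<in> ?b `` {f}" "g \<in> ?b `` {g}"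
    using based_homotopy_refl assms(2,3) by simp_all
  have "(\<Union>f'\<in>?b `` {f}. \<Union>g'\<in>?b `` {g}. ?b `` {cube_concat f' g'}) = ?b `` {cube_concat f g}"
  proof (intro equalityI UN_least)
    show "?b `` {cube_concat f g} \<subseteq> (\<Union>f'\<in>?b `` {f}. \<Union>g'\<in>?b `` {g}. ?b `` {cube_concat f' g'})"
      by (rule order_trans[OF UN_upper[OF mem(2)] UN_upper[OF mem(1)]])
  qed (simp only: same order_refl)
  then show ?thesis by (simp add: homotopy_group_def)
qed

lemma path_component_of_continuous_map:
  assumes "path_component_of X a b" "continuous_map X Y p"
  shows "path_component_of Y (p a) (p b)"
proof -
  obtain q where "pathin X q" "q 0 = a" "q 1 = b" using assms(1) by (auto simp: path_component_of_def)
  then show ?thesis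
    unfolding path_component_of_def using pathin_compose[OF _ assms(2), of q] by (intro exI[of _ "p \<circ> q"]) simp
qed

text \<open>Reduces the bijections on components and classes to statements about points and based
  maps. The homomorphism property comes for free, since the inclusion leaves representatives and
  their concatenations unchanged.\<close>

lemma subspace_inclusion_weak_equivalence:
  assumes S: "S \<subseteq> topspace X"
    and surj0: "\<And>b. b \<in> topspace X \<Longrightarrow> \<exists>a\<in>S. path_component_of X a b"
    and inj0: "\<And>a b. a \<in> S \<Longrightarrow> b \<in> S \<Longrightarrow> path_component_of X a b \<Longrightarrow> path_component_of (subtopology X S) a b"
    and surj: "\<And>n a f. a \<in> S \<Longrightarrow> f \<in> based_maps n X a \<Longrightarrow>
      \<exists>g\<in>based_maps n (subtopology X S) a. (f, g) \<in> based_homotopy n X a"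
    and inj: "\<And>n a f g. a \<in> S \<Longrightarrow> f \<in> based_maps n (subtopology X S) a \<Longrightarrow> g \<in> based_maps n (subtopology X S) a \<Longrightarrow>
      (f, g) \<in> based_homotopy n X a \<Longrightarrow> (f, g) \<in> based_homotopy n (subtopology X S) a"
  shows "weak_homotopy_equivalence (subtopology X S) X (\<lambda>y. y)"
proof -
  let ?Y = "subtopology X S"
  have top: "topspace ?Y = S" using S by auto
  have incl: "continuous_map ?Y X (\<lambda>y. y)" by (rule continuous_map_from_subtopology) (simp add: id_def[symmetric])
  have path_up: "path_component_of X a b" if "path_component_of ?Y a b" for a b
    using path_component_of_continuous_map[OF that incl] .
  have pcm: "path_component_map X (\<lambda>y. y) (path_component_of_set ?Y a) = path_component_of_set X a" if "a \<in> S" for a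
  proof -
    have same: "path_component_of_set X a' = path_component_of_set X a" if "a' \<in> path_component_of_set ?Y a" for a'
      using path_up[of a a'] path_component_of_equiv[of X a a'] that by simp
    have "a \<in> path_component_of_set ?Y a" using \<open>a \<in> S\<close> top by (simp add: path_component_of_refl)
    from UN_upper[OF this, of "path_component_of_set X"] show ?thesis
      unfolding path_component_map_def by (intro equalityI UN_least) (simp_all only: same order_refl)
  qed
  have "bij_betw (path_component_map X (\<lambda>y. y)) (path_components_of ?Y) (path_components_of X)"
    unfolding bij_betw_def
  proof
    show "inj_on (path_component_map X (\<lambda>y. y)) (path_components_of ?Y)"
    proof (rule inj_onI)
      fix C C' assume "C \<in> path_components_of ?Y" "C' \<in> path_components_of ?Y"
        and eq: "path_component_map X (\<lambda>y. y) C = path_component_map X (\<lambda>y. y) C'"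
      then obtain a a' where a: "a \<in> S" "C = path_component_of_set ?Y a" "a' \<in> S" "C' = path_component_of_set ?Y a'"
        unfolding path_components_of_def top by auto
      then have "path_component_of_set X a = path_component_of_set X a'" using eq pcm by simp
      then have "path_component_of X a a'" using a S by (metis mem_Collect_eq path_component_of_refl subsetD)
      then have "path_component_of ?Y a a'" using inj0 a by blast
      then show "C = C'" using a path_component_of_equiv[of ?Y a a'] by auto
    qed
    have "path_component_of_set X b \<in> path_component_of_set X ` S" if b: "b \<in> topspace X" for b
    proof -
      obtain a where "a \<in> S" "path_component_of X a b" using surj0[OF b] by blast
      then show ?thesis using path_component_of_equiv[of X a b] by (intro image_eqI[of _ _ a]) auto
    qed
    then have "path_component_of_set X ` S = path_component_of_set X ` topspace X" using S by auto
    moreover have "path_component_map X (\<lambda>y. y) ` path_components_of ?Y = path_component_of_set X ` S"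
      unfolding path_components_of_def top image_image using pcm by simp
    ultimately show "path_component_map X (\<lambda>y. y) ` path_components_of ?Y = path_components_of X"
      by (simp add: path_components_of_def)
  qed
  moreover have "homotopy_group_map n X (\<lambda>y. y) a \<in> iso (homotopy_group n ?Y a) (homotopy_group n X a)"
    if n: "n \<ge> 1" and a: "a \<in> S" for n a
  proof -
    let ?h = "homotopy_group_map n X (\<lambda>y. y) a" and ?bY = "based_homotopy n ?Y a" and ?bX = "based_homotopy n X a"
    have up: "(f, g) \<in> ?bX" if "(f, g) \<in> ?bY" for f g
      using based_homotopy_compose[OF that incl] by (simp add: o_def)
    have up_map: "f \<in> based_maps n X a" if "f \<in> based_maps n ?Y a" for f
      using based_maps_compose[OF that incl] by (simp add: o_def)
    have h_class: "?h (?bY `` {f}) = ?bX `` {f}" if f: "f \<in> based_maps n ?Y a" for f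
    proof -
      have same: "?bX `` {p} = ?bX `` {f}" if "p \<in> ?bY `` {f}" for p
        using based_homotopy_class_eq[OF up_map[OF f], of p] up[of f p] that by simp
      have "f \<in> ?bY `` {f}" using based_homotopy_refl[OF f] by simp
      from UN_upper[OF this, of "\<lambda>p. ?bX `` {p}"] have "(\<Union>p\<in>?bY `` {f}. ?bX `` {p}) = ?bX `` {f}"
        by (intro equalityI UN_least) (simp_all only: same order_refl)
      then show ?thesis by (simp only: homotopy_group_map_def o_def)
    qed
    have h_carrier: "?h A \<in> carrier (homotopy_group n X a)" if A: "A \<in> carrier (homotopy_group n ?Y a)" for A
    proof -
      obtain f where "f \<in> based_maps n ?Y a" "A = ?bY `` {f}" using A unfolding carrier_homotopy_group by blast
      then show ?thesis unfolding carrier_homotopy_group using h_class up_map by auto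
    qed
    have "?h \<in> hom (homotopy_group n ?Y a) (homotopy_group n X a)"
    proof (rule homI)
      fix A assume "A \<in> carrier (homotopy_group n ?Y a)"
      then show "?h A \<in> carrier (homotopy_group n X a)" by (rule h_carrier)
      fix B assume "B \<in> carrier (homotopy_group n ?Y a)"
      with \<open>A \<in> _\<close> obtain f g where fg: "f \<in> based_maps n ?Y a" "A = ?bY `` {f}" "g \<in> based_maps n ?Y a" "B = ?bY `` {g}"
        unfolding carrier_homotopy_group by blast
      have "cube_concat f g \<in> based_maps n ?Y a"
        using based_homotopy_imp_based_maps(1)[OF based_homotopy_concat[OF n based_homotopy_refl[OF fg(1)] based_homotopy_refl[OF fg(3)]]] .
      then show "?h (A \<otimes>\<^bsub>homotopy_group n ?Y a\<^esub> B) = ?h A \<otimes>\<^bsub>homotopy_group n X a\<^esub> ?h B"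
        using fg up_map by (simp add: homotopy_group_mult_class[OF n] h_class)
    qed
    moreover have "bij_betw ?h (carrier (homotopy_group n ?Y a)) (carrier (homotopy_group n X a))"
      unfolding bij_betw_def
    proof
      show "inj_on ?h (carrier (homotopy_group n ?Y a))"
      proof (rule inj_onI)
        fix A B assume "A \<in> carrier (homotopy_group n ?Y a)" "B \<in> carrier (homotopy_group n ?Y a)" and eq: "?h A = ?h B"
        then obtain f g where fg: "f \<in> based_maps n ?Y a" "A = ?bY `` {f}" "g \<in> based_maps n ?Y a" "B = ?bY `` {g}"
          unfolding carrier_homotopy_group by blast
        then have "?bX `` {f} = ?bX `` {g}" using eq h_class by simp
        then have "(f, g) \<in> ?bX" using based_homotopy_class_eq[OF up_map[OF fg(1)], of g] by simp
        then have "(f, g) \<in> ?bY" using inj[OF a fg(1,3)] by blast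
        then show "A = B" using fg(2,4) based_homotopy_class_eq[OF fg(1), of g] by simp
      qed
      show "?h ` carrier (homotopy_group n ?Y a) = carrier (homotopy_group n X a)"
      proof
        show "?h ` carrier (homotopy_group n ?Y a) \<subseteq> carrier (homotopy_group n X a)"
          using h_carrier by (rule image_subsetI)
        show "carrier (homotopy_group n X a) \<subseteq> ?h ` carrier (homotopy_group n ?Y a)"
        proof
          fix A assume "A \<in> carrier (homotopy_group n X a)"
          then obtain f where f: "f \<in> based_maps n X a" "A = ?bX `` {f}" unfolding carrier_homotopy_group by blast
          obtain g where g: "g \<in> based_maps n ?Y a" "(f, g) \<in> ?bX" using surj[OF a f(1)] by blast
          have "A = ?h (?bY `` {g})" using h_class[OF g(1)] based_homotopy_class_eq[OF f(1), of g] g(2) f(2) by simp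
          moreover have "?bY `` {g} \<in> carrier (homotopy_group n ?Y a)" unfolding carrier_homotopy_group by (rule bexI[OF refl g(1)])
          ultimately show "A \<in> ?h ` carrier (homotopy_group n ?Y a)" by (rule image_eqI)
        qed
      qed
    qed
    ultimately show ?thesis by (simp add: iso_def)
  qed
  ultimately show ?thesis unfolding weak_homotopy_equivalence_def top using incl by blast
qed

text \<open>The square of the two maximum maps and the two inclusions commutes. Three of its sides
  have the lifting property, and the fourth inherits the four conditions above, with
  \<open>{a}\<close> as base point over \<open>a\<close>.\<close>

theorem proposition3p10:
  fixes X :: "'a topology" and x :: 'a
  assumes "finite (topspace X)" and "t0_space X"
    and "x \<in> topspace X" and "gamma_point X x"
  shows "weak_homotopy_equivalence (subtopology X (topspace X - {x})) X (\<lambda>y. y)"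
proof -
  let ?S = "topspace X - {x}"
  let ?Y = "subtopology X ?S"
  let ?K = "chain_space X" and ?L = "chain_space ?Y"
  note X = assms(1,2)
  have S: "?S \<subseteq> topspace X" by auto
  have Y: "finite (topspace ?Y)" "t0_space ?Y" and topY: "topspace ?Y = ?S"
    using X by (auto simp: t0_space_subtopology)
  have mX: "rel_lifting ?K X (chain_max X)" and cX: "continuous_map ?K X (chain_max X)"
    and mY: "rel_lifting ?L ?Y (chain_max ?Y)" and cY: "continuous_map ?L ?Y (chain_max ?Y)"
    using rel_lifting_chain_max continuous_map_chain_max X Y by blast+
  have "fills (subtopology X (link X x))"
    using assms(4) by (intro homotopically_trivial_imp_fills) (simp add: gamma_point_def)
  then have j: "rel_lifting ?L ?K (\<lambda>\<sigma>. \<sigma>)" by (rule rel_lifting_delete_point[OF X assms(3)])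
  have L: "?L = subtopology ?K {\<sigma> \<in> chains_of X. \<sigma> \<subseteq> ?S}" by (rule chain_space_subtopology[OF X(1) S])
  have cj: "continuous_map ?L ?K (\<lambda>\<sigma>. \<sigma>)"
    unfolding L by (rule continuous_map_from_subtopology) (simp add: id_def[symmetric])
  have incl: "continuous_map ?Y X (\<lambda>y. y)" by (rule continuous_map_from_subtopology) (simp add: id_def[symmetric])
  have chainsY: "chains_of ?Y = {\<sigma> \<in> chains_of X. \<sigma> \<subseteq> ?S}" by (rule chains_subtopology[OF X(1) S])
  have max_eq: "chain_max X \<sigma> = chain_max ?Y \<sigma>" if "\<sigma> \<in> chains_of ?Y" for \<sigma>
  proof (rule chain_max_eqI[OF X(2)])
    have sub: "\<sigma> \<subseteq> ?S" using that chainsY by blast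
    show "spec_le X u (chain_max ?Y \<sigma>)" if "u \<in> \<sigma>" for u
      using chain_max[OF Y \<open>\<sigma> \<in> chains_of ?Y\<close>] spec_le_subtopology[OF X(1) S] sub that by blast
  qed (use that chainsY chain_max(1)[OF Y that] in auto)
  have sing: "{y} \<in> chains_of ?Y" "chain_max X {y} = y" "chain_max ?Y {y} = y" if "y \<in> ?S" for y
  proof -
    show *: "{y} \<in> chains_of ?Y" using that topY spec_le_refl[of ?Y y] by (auto simp: chains_of_def)
    show "chain_max ?Y {y} = y" using chain_max(1)[OF Y *] by simp
    then show "chain_max X {y} = y" using max_eq[OF *] by simp
  qed
  \<comment> \<open>The composites are compared on the cube only, where \<open>g\<close> takes
    chains as values; this is all that a based homotopy sees.\<close>
  have lift_eq: "(chain_max X \<circ> g) s = (chain_max ?Y \<circ> g) s" if "g \<in> based_maps n ?L e" "s \<in> topspace (cube n)" for g n e s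
    using that max_eq continuous_map_image_subset_topspace[of "cube n" ?L g] by (auto simp: based_maps_def)
  show ?thesis
  proof (rule subspace_inclusion_weak_equivalence[OF S])
    \<comment> \<open>\<open>b\<close> is joined to the maximum of a chain, and that chain to one
      avoiding \<open>x\<close>; the maximum of the latter is a point of \<open>?S\<close>.\<close>
    fix b assume "b \<in> topspace X"
    then obtain \<sigma> where \<sigma>: "\<sigma> \<in> topspace ?K" "path_component_of X (chain_max X \<sigma>) b"
      using rel_lifting_path_component_surj[OF mX] by blast
    then obtain \<rho> where \<rho>: "\<rho> \<in> topspace ?L" "path_component_of ?K \<rho> \<sigma>"
      using rel_lifting_path_component_surj[OF j] by blast
    have "path_component_of X (chain_max X \<rho>) (chain_max X \<sigma>)"
      using path_component_of_continuous_map[OF \<rho>(2) cX] .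
    then have "path_component_of X (chain_max X \<rho>) b" using \<sigma>(2) path_component_of_trans by metis
    moreover have "chain_max X \<rho> \<in> ?S"
      using \<rho>(1) chain_max(1)[OF Y, of \<rho>] max_eq[of \<rho>] chainsY by auto
    ultimately show "\<exists>a\<in>?S. path_component_of X a b" by blast
  next
    fix a b assume ab: "a \<in> ?S" "b \<in> ?S" "path_component_of X a b"
    then have "path_component_of ?K {a} {b}"
      using sing chainsY by (intro rel_lifting_path_component_inj[OF mX]) auto
    then have "path_component_of ?L {a} {b}"
      using sing ab by (intro rel_lifting_path_component_inj[OF j]) auto
    then have "path_component_of ?Y (chain_max ?Y {a}) (chain_max ?Y {b})"
      by (rule path_component_of_continuous_map[OF _ cY])
    then show "path_component_of ?Y a b" using sing ab by simp
  next
    \<comment> \<open>\<open>f\<close> is lifted to chains of \<open>X\<close>, deformed into chains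
      avoiding \<open>x\<close>, and pushed down by the maximum map of the subspace.\<close>
    fix n a f assume a: "a \<in> ?S" and f: "f \<in> based_maps n X a"
    have aK: "{a} \<in> topspace ?K" and aL: "{a} \<in> topspace ?L" using sing(1)[OF a] chainsY by auto
    have "f \<in> based_maps n X (chain_max X {a})" using f sing(2)[OF a] by simp
    then obtain g where g: "g \<in> based_maps n ?K {a}" "(f, chain_max X \<circ> g) \<in> based_homotopy n X a"
      using rel_lifting_based_map[OF mX aK cX] sing(2)[OF a] by metis
    obtain g' where g': "g' \<in> based_maps n ?L {a}" "(g, (\<lambda>\<sigma>. \<sigma>) \<circ> g') \<in> based_homotopy n ?K {a}"
      using rel_lifting_based_map[OF j aL cj g(1)] by blast
    have "(chain_max X \<circ> g, chain_max X \<circ> g') \<in> based_homotopy n X a"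
      using based_homotopy_compose[OF g'(2) cX] sing(2)[OF a] by (simp add: o_def)
    then have "(f, chain_max X \<circ> g') \<in> based_homotopy n X a" using g(2) based_homotopy_trans by metis
    then have "(f, chain_max ?Y \<circ> g') \<in> based_homotopy n X a"
      by (rule based_homotopy_cong) (use lift_eq[OF g'(1)] in auto)
    moreover have "chain_max ?Y \<circ> g' \<in> based_maps n ?Y a"
      using based_maps_compose[OF g'(1) cY] sing(3)[OF a] by simp
    ultimately show "\<exists>g\<in>based_maps n ?Y a. (f, g) \<in> based_homotopy n X a" by blast
  next
    \<comment> \<open>Up to homotopy in the subspace, \<open>f\<close> and \<open>g\<close> are
      maxima of maps into chains avoiding \<open>x\<close>. Their homotopy in \<open>X\<close> is
      reflected to chains of \<open>X\<close>, from there to chains avoiding \<open>x\<close>, and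
      then pushed down.\<close>
    fix n a f g
    assume a: "a \<in> ?S" and f: "f \<in> based_maps n ?Y a" and g: "g \<in> based_maps n ?Y a"
      and fg: "(f, g) \<in> based_homotopy n X a"
    have aK: "{a} \<in> topspace ?K" and aL: "{a} \<in> topspace ?L" using sing(1)[OF a] chainsY by auto
    have ex: "\<exists>u'\<in>based_maps n ?L {a}. (u, chain_max ?Y \<circ> u') \<in> based_homotopy n ?Y a" if "u \<in> based_maps n ?Y a" for u
      using rel_lifting_based_map[OF mY aL cY, of u n] that sing(3)[OF a] by metis
    obtain f' g' where f': "f' \<in> based_maps n ?L {a}" "(f, chain_max ?Y \<circ> f') \<in> based_homotopy n ?Y a"
      and g': "g' \<in> based_maps n ?L {a}" "(g, chain_max ?Y \<circ> g') \<in> based_homotopy n ?Y a"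
      using ex[OF f] ex[OF g] by blast
    have up: "(u, v) \<in> based_homotopy n X a" if "(u, v) \<in> based_homotopy n ?Y a" for u v
      using based_homotopy_compose[OF that incl] by (simp add: o_def)
    have "(chain_max ?Y \<circ> f', chain_max ?Y \<circ> g') \<in> based_homotopy n X a"
      using up[OF f'(2)] up[OF g'(2)] fg based_homotopy_sym based_homotopy_trans by metis
    then have "(chain_max X \<circ> f', chain_max X \<circ> g') \<in> based_homotopy n X (chain_max X {a})"
      unfolding sing(2)[OF a]
      by (rule based_homotopy_cong) (use lift_eq[OF f'(1)] lift_eq[OF g'(1)] in auto)
    moreover have "f' \<in> based_maps n ?K {a}" "g' \<in> based_maps n ?K {a}"
      using based_maps_compose[OF f'(1) cj] based_maps_compose[OF g'(1) cj] by (simp_all add: o_def)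
    ultimately have "(f', g') \<in> based_homotopy n ?K {a}"
      by (intro rel_lifting_based_homotopy[OF mX aK])
    then have "(f', g') \<in> based_homotopy n ?L {a}"
      using f'(1) g'(1) by (intro rel_lifting_based_homotopy[OF j aL]) (simp_all add: o_def)
    then have "(chain_max ?Y \<circ> f', chain_max ?Y \<circ> g') \<in> based_homotopy n ?Y a"
      using based_homotopy_compose[OF _ cY] sing(3)[OF a] by metis
    then show "(f, g) \<in> based_homotopy n ?Y a"
      using f'(2) g'(2) based_homotopy_sym based_homotopy_trans by metis
  qed
qed

end
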